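(* Let $G$, $E_A$, $x\in\mathbb C^E$ be as in the context, and let $\rho(x)$ be the spectral radius of the transition matrix $\Lambda(x)$. If $\rho(x)<1$, then $\sum_{r\ge1}|f_r(x)|<\infty$ and \[ Z(x)=\exp\Big(\sum_{r=1}^\infty f_r(x)\Big)=\prod_i\big(1-\lambda_i(x)\big)^{1/2}, \] where $\lambda_i(x)$, $i=1,\dots,2|E\setminus E_A|$, are the eigenvalues of $\Lambda(x)$ and $(1-\lambda)^{1/2}=\exp(\tfrac12\operatorname{Log}(1-\lambda))$ with the principal logarithm; in particular $Z(x)^2=\det(\mathrm{Id}-\Lambda(x))$.
   Context: Setting: $G=(V,E)$ is a finite graph without self-loops or multiple edges, embedded in $\mathbb R^2$: vertices are distinct points, each edge $uv$ is the straight segment from $u$ to $v$, and no vertex lies in the interior of an edge; edges may cross (intersect at a non-vertex point). $E$ is split into additional edges $E_A$ and representative edges $E\setminus E_A$, with $(V,E_A)$ containing no cycle. Paths, closed paths, loops: a path of $n$ steps is $(v_0,\dots,v_{n-1})$ with $v_iv_{i+1}\in E$ and $v_{i+2}\neq v_i$; closed if all rotations are paths; a loop is a closed path that is lexicographically smallest (vertices ordered lexicographically by coordinates) among all rotations of itself and its reversal. Multiplicity $m(\ell)$ = number of steps / smallest period. Turning angle $\angle(a,b)\in(-\pi,\pi)$ from vector $a$ to $b$; winding angle $\alpha(\ell)=\sum_{i=0}^{n-1}\angle(v_{i+1}-v_i,v_{i+2}-v_{i+1})$ (indices mod $n$); sign $\operatorname{sgn}(\ell)=-e^{i\alpha(\ell)/2}$;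 weight $w(\ell;x)=\frac{\operatorname{sgn}(\ell)}{m(\ell)}\prod_{i=0}^{n-1}x_{v_iv_{i+1}}$. The length $r(\ell)$ is the number of $i\in\{0,\dots,n-1\}$ with $v_iv_{i+1}\in E\setminus E_A$, and $f_r(x)=\sum_{\ell:\,r(\ell)=r}w(\ell;x)$. Even sets and $Z$: $F\subseteq E$ is even if all degrees in $(V,F)$ are even; $C_F$ is the number of unordered crossing pairs of edges in $F$; $Z(x)=\sum_{F\text{ even}}(-1)^{C_F}\prod_{e\in F}x_e$. Transition matrix: $\Lambda(x)$ is indexed by directed representative edges $\vec{uv}$ (both orientations of each representative edge). For directed representative edges $\vec{uv},\vec{wz}$: $v$ is linked to $w$ if $v=w$, or there is a (necessarily unique) sequence of distinct additional edges $v_1v_2,\dots,v_{n-1}v_n$ with $v_1=v$, $v_n=w$ ("$v\leadsto w$ via $(v_1,\dots,v_n)$"). If $v=w$, $u\ne z$, set $\angle(\vec{uv},\vec{wz})=\angle(v-u,z-w)$; if $v\leadsto w$ via $(v_1,\dots,v_n)$, set $\angle(\vec{uv},\vec{wz})=\angle(v-u,v_2-v)+\sum_{i=1}^{n-2}\angle(v_{i+1}-v_i,v_{i+2}-v_{i+1})+\angle(w-v_{n-1},z-w)$. Then $\Lambda_{\vec{uv},\vec{wz}}(x)=x_{uv}e^{i\angle(\vec{uv},\vec{wz})/2}$ if $v=w,u\neq z$; $=x_{uv}\prod_{i=1}^{n-1}x_{v_iv_{i+1}}e^{i\angle(\vec{uv},\vec{wz})/2}$ if $v\leadsto w$ via $(v_1,\dots,v_n)$;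 and $0$ otherwise. *)

theory Defs
  imports "HOL-Analysis.Analysis" "HOL-Computational_Algebra.Polynomial"
    "Jordan_Normal_Form.Spectral_Radius" "Jordan_Normal_Form.Determinant"
    "Jordan_Normal_Form.Char_Poly"
begin

text \<open>Vertices are points of the plane, represented as complex numbers.
  An (undirected) edge is the two-element set of its endpoints; the straight
  segment of an edge e is convex hull e.\<close>

definition simple_edges :: "complex set \<Rightarrow> complex set set \<Rightarrow> bool" where
  "simple_edges V E \<longleftrightarrow> E \<subseteq> {{u, v} | u v. u \<in> V \<and> v \<in> V \<and> u \<noteq> v}"

definition no_vertex_on_edge :: "complex set \<Rightarrow> complex set set \<Rightarrow> bool" where
  "no_vertex_on_edge V E \<longleftrightarrow> (\<forall>e\<in>E. \<forall>w\<in>V. w \<notin> e \<longrightarrow> w \<notin> convex hull e)"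

definition acyclic_edges :: "complex set set \<Rightarrow> bool" where
  "acyclic_edges EA \<longleftrightarrow> \<not> (\<exists>cs. distinct cs \<and> length cs \<ge> 3 \<and>
      (\<forall>i < length cs. {cs ! i, cs ! ((i + 1) mod length cs)} \<in> EA))"

definition turn :: "complex \<Rightarrow> complex \<Rightarrow> real" where
  "turn a b = Arg (b / a)"

definition turnsum :: "complex list \<Rightarrow> real" where
  "turnsum l = (\<Sum>i < length l - 2. turn (l ! (i+1) - l ! i) (l ! (i+2) - l ! (i+1)))"

definition nxt :: "complex list \<Rightarrow> nat \<Rightarrow> complex" where
  "nxt l i = l ! (i mod length l)"

definition closed_path :: "complex set set \<Rightarrow> complex list \<Rightarrow> bool" where
  "closed_path E l \<longleftrightarrow> length l \<ge> 1 \<and>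
     (\<forall>i < length l. {nxt l i, nxt l (i+1)} \<in> E \<and> nxt l (i+2) \<noteq> nxt l i)"

definition vless :: "complex \<Rightarrow> complex \<Rightarrow> bool" where
  "vless a b \<longleftrightarrow> Re a < Re b \<or> (Re a = Re b \<and> Im a < Im b)"

definition lexle :: "complex list \<Rightarrow> complex list \<Rightarrow> bool" where
  "lexle l l' \<longleftrightarrow> l = l' \<or> (l, l') \<in> lexord {(a, b). vless a b}"

definition dihedral_orbit :: "complex list \<Rightarrow> complex list set" where
  "dihedral_orbit l = {rotate k l | k. k < length l} \<union> {rotate k (rev l) | k. k < length l}"

definition is_loop :: "complex set set \<Rightarrow> complex list \<Rightarrow> bool" where
  "is_loop E l \<longleftrightarrow> closed_path E l \<and> (\<forall>l' \<in> dihedral_orbit l. lexle l l')"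

definition multiplicity_loop :: "complex list \<Rightarrow> nat" where
  "multiplicity_loop l = length l div (LEAST p. 0 < p \<and> rotate p l = l)"

definition winding :: "complex list \<Rightarrow> real" where
  "winding l = (\<Sum>i < length l.
      turn (nxt l (i+1) - nxt l i) (nxt l (i+2) - nxt l (i+1)))"

definition loop_sign :: "complex list \<Rightarrow> complex" where
  "loop_sign l = - exp (\<i> * of_real (winding l) / 2)"

definition loop_weight :: "(complex set \<Rightarrow> complex) \<Rightarrow> complex list \<Rightarrow> complex" where
  "loop_weight x l = loop_sign l / of_nat (multiplicity_loop l) *
     (\<Prod>i < length l. x {nxt l i, nxt l (i+1)})"

definition loop_length :: "complex set set \<Rightarrow> complex set set \<Rightarrow> complex list \<Rightarrow> nat" where
  "loop_length E EA l = card {i. i < length l \<and> {nxt l i, nxt l (i+1)} \<in> E - EA}"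

definition f_r :: "complex set set \<Rightarrow> complex set set \<Rightarrow> (complex set \<Rightarrow> complex) \<Rightarrow> nat \<Rightarrow> complex" where
  "f_r E EA x r = (\<Sum>l \<in> {l. is_loop E l \<and> loop_length E EA l = r}. loop_weight x l)"

definition even_set :: "complex set \<Rightarrow> complex set set \<Rightarrow> complex set set \<Rightarrow> bool" where
  "even_set V E F \<longleftrightarrow> F \<subseteq> E \<and> (\<forall>v \<in> V. even (card {e \<in> F. v \<in> e}))"

definition crosses :: "complex set \<Rightarrow> complex set \<Rightarrow> complex set \<Rightarrow> bool" where
  "crosses V e f \<longleftrightarrow> e \<noteq> f \<and> (\<exists>p. p \<in> convex hull e \<and> p \<in> convex hull f \<and> p \<notin> V)"

definition crossings :: "complex set \<Rightarrow> complex set set \<Rightarrow> nat" where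
  "crossings V F = card {{e, f} | e f. e \<in> F \<and> f \<in> F \<and> crosses V e f}"

definition Zfun :: "complex set \<Rightarrow> complex set set \<Rightarrow> (complex set \<Rightarrow> complex) \<Rightarrow> complex" where
  "Zfun V E x = (\<Sum>F \<in> {F. even_set V E F}. (-1) ^ crossings V F * (\<Prod>e\<in>F. x e))"

definition dir_rep :: "complex set set \<Rightarrow> complex set set \<Rightarrow> (complex \<times> complex) set" where
  "dir_rep E EA = {(u, v). {u, v} \<in> E - EA}"

definition linkpath :: "complex set set \<Rightarrow> complex \<Rightarrow> complex \<Rightarrow> complex list \<Rightarrow> bool" where
  "linkpath EA v w p \<longleftrightarrow> length p \<ge> 2 \<and> hd p = v \<and> last p = w \<and>
     (\<forall>i < length p - 1. {p ! i, p ! (i+1)} \<in> EA) \<and>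
     distinct (map (\<lambda>i. {p ! i, p ! (i+1)}) [0..<length p - 1])"

definition Lam_entry :: "complex set set \<Rightarrow> (complex set \<Rightarrow> complex) \<Rightarrow>
    complex \<times> complex \<Rightarrow> complex \<times> complex \<Rightarrow> complex" where
  "Lam_entry EA x a b = (case (a, b) of ((u, v), (w, z)) \<Rightarrow>
     if v = w then
       (if u \<noteq> z then x {u, v} * exp (\<i> * of_real (turnsum [u, v, z]) / 2) else 0)
     else if (\<exists>p. linkpath EA v w p) then
       (let p = (SOME p. linkpath EA v w p) in
          x {u, v} * (\<Prod>i < length p - 1. x {p ! i, p ! (i+1)}) *
          exp (\<i> * of_real (turnsum (u # p @ [z])) / 2))
     else 0)"

text \<open>A fixed enumeration of the directed representative edges; spectral radius,
  eigenvalues and determinant do not depend on the choice.\<close>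
definition dir_list :: "complex set set \<Rightarrow> complex set set \<Rightarrow> (complex \<times> complex) list" where
  "dir_list E EA = (SOME l. distinct l \<and> set l = dir_rep E EA)"

definition Lambda_mat :: "complex set set \<Rightarrow> complex set set \<Rightarrow> (complex set \<Rightarrow> complex) \<Rightarrow> complex mat" where
  "Lambda_mat E EA x = (let ds = dir_list E EA in
     mat (length ds) (length ds) (\<lambda>(i, j). Lam_entry EA x (ds ! i) (ds ! j)))"

end

theory Submission
  imports Defs
begin

text \<open>Conjugating the Kac-Ward matrix by half angles turns $\det(1 - T)$ into the determinant of a real
  skew-symmetric matrix, hence into the square of a Pfaffian. If the directed edges are ordered by the
  height of their tail and then by angle, the matchings in the Pfaffian correspond to even sets
  with pairings of their edges at the vertices; the pairings sum to one, and the remaining sign is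
  $(-1)^{C_F}$: for two edges, actual crossing and interlacing in the order differ by
  the parity of the number of end points of one lying to the right of the other, and summed over an
  even set these numbers cancel because all degrees are even. Thus $Z^2 = \det(1 - T)$. Since
  $E_A$ is a forest, a Schur complement replaces $T$ by $\Lambda$. Finally
  $f_r = - \mathrm{tr}(\Lambda^r)/(2r)$, because every loop has two orientations, and the sign of the square root is
  determined by scaling the representative edges continuously to zero.\<close>

section \<open>Pfaffians\<close>

text \<open>After conjugation and symmetrization, \<open>1 - T\<close> is not yet skew: it is a
  signed reversal of directed edges, of determinant 1, times a skew matrix \<open>K + B\<close>.
  Here \<open>K\<close> pairs each directed edge with its reverse and \<open>B\<close> couples
  directed edges with a common tail. Expanding the Pfaffian of \<open>K + B\<close> means choosing
  the indices matched by \<open>K\<close>; these form the edges outside \<open>F\<close>, and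
  \<open>B\<close> must match the rest. The order by tail and angle makes the blocks of
  \<open>B\<close> intervals with entries \<open>y i * y j\<close> above the diagonal, so no pairing
  is ever enumerated. Since \<open>y i\<close> is a square root of an edge weight and may vanish,
  symmetrization cannot be a conjugation by \<open>y\<close>. The real form of the matrix serves a
  second time: it shows that a closed path and its reversal have equal weight, which is the origin
  of the factor 2 in the trace formula. For the sign of the root, \<open>rho < 1\<close> keeps every
  \<open>1 - \<tau> * a\<close>, with \<open>a\<close> an eigenvalue and \<open>\<tau>\<close> in
  \<open>[0, 1]\<close>, in the right half plane, where the principal root is continuous. At
  \<open>\<tau> = 0\<close> the additional edges are still present, so a second scaling is needed to
  see that both sides start at 1.\<close>

definition del :: "nat \<Rightarrow> 'a list \<Rightarrow> 'a list" where
  "del k xs = take k xs @ drop (Suc k) xs"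

lemma length_del: "k < length xs \<Longrightarrow> length (del k xs) = length xs - 1"
  by (simp add: del_def)

lemma length_del_le: "length (del k xs) \<le> length xs"
  by (simp add: del_def)

text \<open>Expansion along the first entry. Only values \<open>w x y\<close> with \<open>x\<close>
  before \<open>y\<close> enter, and lists of odd length get 0. The entries are arbitrary objects
  rather than indices, so that they can later be replaced by linear combinations.\<close>

function pf :: "('a \<Rightarrow> 'a \<Rightarrow> complex) \<Rightarrow> 'a list \<Rightarrow> complex" where
  "pf w [] = 1"
| "pf w (x # xs) = (\<Sum>k<length xs. (-1) ^ k * w x (xs ! k) * pf w (del k xs))"
  by pat_completeness auto
termination
  by (relation "Wellfounded.measure (length \<circ> snd)") (auto simp: less_Suc_eq_le length_del_le)

lemma sum_lessThan_add:
  fixes f :: "nat \<Rightarrow> 'a::comm_monoid_add"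
  shows "(\<Sum>k<m + n. f k) = (\<Sum>k<m. f k) + (\<Sum>k<n. f (m + k))"
  by (induction n) (auto simp: add_ac)

lemma del_append1: "k < length xs \<Longrightarrow> del k (xs @ ys) = del k xs @ ys"
  by (simp add: del_def)

lemma del_append2: "del (length xs + k) (xs @ ys) = xs @ del k ys"
  by (simp add: del_def)

lemma del_0 [simp]: "del 0 (x # xs) = xs"
  and del_Suc [simp]: "del (Suc k) (x # xs) = x # del k xs"
  by (simp_all add: del_def)

lemma del_nth: "k < length xs \<Longrightarrow> j < length xs - 1 \<Longrightarrow>
    del k xs ! j = (if j < k then xs ! j else xs ! Suc j)"
  by (auto simp: del_def nth_append min_def)

lemma del_del: "k < length xs \<Longrightarrow> l \<le> k \<Longrightarrow> Suc k < length xs \<Longrightarrow> del l (del (Suc k) xs) = del k (del l xs)"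
proof (induction xs arbitrary: k l)
  case (Cons x xs)
  then show ?case by (cases l; cases k) auto
qed simp

lemma pf_expand_append:
  "pf w (x # us @ vs) =
    (\<Sum>k<length us. (-1) ^ k * w x (us ! k) * pf w (del k us @ vs)) +
    (-1) ^ length us * (\<Sum>k<length vs. (-1) ^ k * w x (vs ! k) * pf w (us @ del k vs))"
  by (simp add: sum_lessThan_add nth_append del_append1 del_append2 sum_distrib_left power_add mult.assoc)

text \<open>Separates the matchings that join \<open>a\<close> to \<open>b\<close> from those in
  which both have partners further on. The double sum records the partners in the order of removal,
  which makes the effect of exchanging \<open>a\<close> and \<open>b\<close> visible.\<close>

lemma pf_expand_two:
  "pf w (a # b # ys) = w a b * pf w ys
     - (\<Sum>k<length ys. \<Sum>l<length ys - 1. (-1) ^ (k + l) * w a (ys ! k) * w b (del k ys ! l) * pf w (del l (del k ys)))"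
proof -
  have "pf w (a # b # ys) = w a b * pf w ys + (\<Sum>k<length ys. (-1) ^ Suc k * w a (ys ! k) * pf w (b # del k ys))"
    by (simp add: sum.lessThan_Suc_shift del: sum.lessThan_Suc pf.simps(2) add: pf.simps(2)[of w a "b # ys"])
  also have "(\<Sum>k<length ys. (-1) ^ Suc k * w a (ys ! k) * pf w (b # del k ys)) =
     - (\<Sum>k<length ys. \<Sum>l<length ys - 1. (-1) ^ (k + l) * w a (ys ! k) * w b (del k ys ! l) * pf w (del l (del k ys)))"
    by (simp add: length_del sum_negf[symmetric] sum_distrib_left power_add algebra_simps)
  finally show ?thesis by simp
qed

text \<open>Removing two positions in either order leaves the same list, but the parity of
  \<open>k + l\<close> changes, because the second position is counted after the first removal. The
  conditional recovers the entry of the original list.\<close>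

lemma double_del_antisym:
  fixes f g :: "nat \<Rightarrow> complex" and P :: "'a list \<Rightarrow> complex"
  shows "(\<Sum>k<length ys. \<Sum>l<length ys - 1. (-1) ^ (k + l) * f k * (if l < k then g l else g (Suc l)) * P (del l (del k ys))) =
     - (\<Sum>k<length ys. \<Sum>l<length ys - 1. (-1) ^ (k + l) * g k * (if l < k then f l else f (Suc l)) * P (del l (del k ys)))"
proof -
  let ?n = "length ys"
  let ?I = "{..<?n} \<times> {..<?n - 1}"
  \<comment> \<open>The involution that exchanges the two removals: position \<open>l\<close> of
    \<open>del k ys\<close> is position \<open>l\<close> or \<open>Suc l\<close> of
    \<open>ys\<close>.\<close>
  define h where "h = (\<lambda>(k::nat, l::nat). if l < k then (l, k - 1) else (Suc l, k))"
  have "(\<Sum>(k,l)\<in>?I. (-1) ^ (k + l) * f k * (if l < k then g l else g (Suc l)) * P (del l (del k ys))) =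
     (\<Sum>(k,l)\<in>?I. - ((-1) ^ (k + l) * g k * (if l < k then f l else f (Suc l)) * P (del l (del k ys))))"
  proof (rule sum.reindex_bij_witness[of _ h h])
    fix a assume "a \<in> ?I"
    then obtain k l where a: "a = (k, l)" and k: "k < ?n" and l: "l < ?n - 1" by auto
    show "h (h a) = a" using a by (auto simp: h_def)
    show "h a \<in> ?I" using a k l by (auto simp: h_def)
    show "(case h a of (k, l) \<Rightarrow> - ((-1) ^ (k + l) * g k * (if l < k then f l else f (Suc l)) * P (del l (del k ys)))) =
      (case a of (k, l) \<Rightarrow> (-1) ^ (k + l) * f k * (if l < k then g l else g (Suc l)) * P (del l (del k ys)))"
    proof (cases "l < k")
      case True
      then obtain k' where k': "k = Suc k'" by (cases k) auto
      have "del l (del (Suc k') ys) = del k' (del l ys)"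
        using True k l k' by (intro del_del) auto
      then show ?thesis using True a k' by (auto simp: h_def add_ac)
    next
      case False
      have "del k (del (Suc l) ys) = del l (del k ys)"
        using False k l by (intro del_del) auto
      then show ?thesis using False a by (auto simp: h_def add_ac)
    qed
  next
    fix a assume "a \<in> ?I"
    then obtain k l where a: "a = (k, l)" and k: "k < ?n" and l: "l < ?n - 1" by auto
    show "h (h a) = a" using a by (auto simp: h_def)
    show "h a \<in> ?I" using a k l by (auto simp: h_def)
  qed
  then show ?thesis by (simp add: sum.cartesian_product sum_negf case_prod_unfold)
qed

text \<open>With \<open>a\<close> and \<open>b\<close> in front, the term joining them changes sign
  by skewness and the double sum by \<open>double_del_antisym\<close>. Behind another entry
  \<open>x\<close>, the terms joining \<open>x\<close> to \<open>a\<close> or to \<open>b\<close>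
  trade places with opposite signs, and the remaining ones follow by induction.\<close>

lemma pf_swap:
  assumes skew: "\<And>u v. w u v = - w v u"
  shows "pf w (xs @ a # b # ys) = - pf w (xs @ b # a # ys)"
proof (induction "length xs + length ys" arbitrary: xs ys rule: less_induct)
  case less
  show ?case
  proof (cases xs)
    case Nil
    have eq: "(\<Sum>k<length ys. \<Sum>l<length ys - 1. (-1) ^ (k + l) * w a (ys ! k) * w b (del k ys ! l) * pf w (del l (del k ys)))
      = (\<Sum>k<length ys. \<Sum>l<length ys - 1. (-1) ^ (k + l) * w a (ys ! k) * (if l < k then w b (ys ! l) else w b (ys ! Suc l)) * pf w (del l (del k ys)))" for a b
      by (intro sum.cong refl) (auto simp: del_nth)
    have "pf w (a # b # ys) = - pf w (b # a # ys)"
      unfolding pf_expand_two eq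
      using double_del_antisym[where ys = ys and f = "\<lambda>k. w a (ys ! k)" and g = "\<lambda>k. w b (ys ! k)" and P = "pf w"] skew[of a b]
      by simp
    then show ?thesis using Nil by simp
  next
    case (Cons x zs)
    have 1: "pf w (del k zs @ a # b # ys) = - pf w (del k zs @ b # a # ys)" if "k < length zs" for k
      by (rule less) (use that Cons in \<open>simp add: length_del\<close>)
    have 2: "pf w (zs @ a # b # del k ys) = - pf w (zs @ b # a # del k ys)" if "k < length ys" for k
      by (rule less) (use that Cons in \<open>simp add: length_del\<close>)
    have "pf w (x # zs @ a # b # ys) = - pf w (x # zs @ b # a # ys)"
      unfolding pf_expand_append
      by (simp add: 1 2 sum.lessThan_Suc_shift sum_negf algebra_simps del: sum.lessThan_Suc)
    then show ?thesis using Cons by simp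
  qed
qed

lemma pf_move_front:
  assumes skew: "\<And>u v. w u v = - w v u"
  shows "pf w (xs @ a # ys) = (-1) ^ length xs * pf w (a # xs @ ys)"
proof (induction xs arbitrary: ys rule: rev_induct)
  case (snoc x xs)
  have "pf w ((xs @ [x]) @ a # ys) = - pf w (xs @ a # x # ys)"
    using pf_swap[where w = w and xs = xs and a = x and b = a and ys = ys, OF skew] by simp
  also have "\<dots> = (-1) ^ length (xs @ [x]) * pf w (a # (xs @ [x]) @ ys)"
    using snoc[of "x # ys"] by simp
  finally show ?case .
qed simp

lemma pf_dup:
  assumes skew: "\<And>u v. w u v = - w v u"
  shows "pf w (xs @ a # ys @ a # zs) = 0"
proof -
  have "pf w (a # a # v) = 0" for v
    using pf_swap[where w = w and xs = "[]" and a = a and b = a and ys = v, OF skew] by (simp del: pf.simps)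
  then have "pf w (a # (a # xs @ ys) @ zs) = 0" unfolding append_Cons .
  moreover have "pf w (xs @ a # ys @ a # zs) = (-1) ^ length xs * ((-1) ^ length (a # xs @ ys) * pf w (a # (a # xs @ ys) @ zs))"
    using pf_move_front[where w = w and xs = xs and a = a and ys = "ys @ a # zs", OF skew] pf_move_front[where w = w and xs = "a # xs @ ys" and a = a and ys = zs, OF skew] by (simp del: pf.simps)
  ultimately show ?thesis by (simp del: pf.simps)
qed

section \<open>Gram matrices and the identity between determinant and squared Pfaffian\<close>

definition gram :: "('a \<Rightarrow> 'a \<Rightarrow> 'b) \<Rightarrow> 'a list \<Rightarrow> 'b mat" where
  "gram w xs = mat (length xs) (length xs) (\<lambda>(i, j). w (xs ! i) (xs ! j))"

lemma gram_carrier [simp]: "gram w xs \<in> carrier_mat (length xs) (length xs)"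
  by (simp add: gram_def)

text \<open>Rows and columns are exchanged together, so the two signs cancel.\<close>

lemma det_gram_swap:
  fixes w :: "'a \<Rightarrow> 'a \<Rightarrow> complex"
  shows "det (gram w (xs @ a # b # ys)) = det (gram w (xs @ b # a # ys))"
proof -
  let ?k = "length xs" and ?n = "length xs + length ys + 2"
  let ?l = "Suc ?k"
  let ?A = "gram w (xs @ a # b # ys)"
  have A: "?A \<in> carrier_mat ?n ?n" by (simp add: gram_def)
  have "gram w (xs @ b # a # ys) = swaprows ?k ?l (swapcols ?k ?l ?A)"
    by (rule eq_matI) (auto simp: gram_def nth_append nth_Cons' mat_swaprows_def mat_swapcols_def)
  moreover have "det (swapcols ?k ?l ?A) = - det ?A"
    by (rule det_swapcols[OF _ _ _ A]) auto
  moreover have "det (swaprows ?k ?l (swapcols ?k ?l ?A)) = - det (swapcols ?k ?l ?A)"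
    by (rule det_swaprows[where n = ?n]) (use A in auto)
  ultimately show ?thesis by simp
qed

lemma det_gram_move_front:
  fixes w :: "'a \<Rightarrow> 'a \<Rightarrow> complex"
  shows "det (gram w (xs @ a # ys)) = det (gram w (a # xs @ ys))"
proof (induction xs arbitrary: ys rule: rev_induct)
  case (snoc x xs)
  then show ?case using det_gram_swap[of w xs x a ys] by simp
qed simp

lemma det_gram_add:
  fixes w :: "'a \<Rightarrow> 'a \<Rightarrow> complex"
  assumes l: "\<And>u. w z' u = w z u + c * w a u" and r: "\<And>u. w u z' = w u z + c * w u a"
    and k: "k < length xs" "xs ! k = z" and l: "l < length xs" "xs ! l = a" "k \<noteq> l"
  shows "det (gram w (xs[k := z'])) = det (gram w xs)"
proof -
  let ?n = "length xs" and ?A = "gram w xs"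
  have A: "?A \<in> carrier_mat ?n ?n" by (simp add: gram_def)
  have "gram w (xs[k := z']) = addcol c k l (addrow c k l ?A)"
    by (rule eq_matI) (use assms in \<open>auto simp: gram_def mat_addcol_def mat_addrow_def nth_list_update algebra_simps\<close>)
  moreover have "det (addrow c k l ?A) = det ?A"
    by (rule det_addrow[OF _ _ A]) (use assms in auto)
  moreover have "det (addcol c k l (addrow c k l ?A)) = det (addrow c k l ?A)"
    by (rule det_addcol[where n = ?n]) (use A assms in auto)
  ultimately show ?thesis by simp
qed

lemma pf_add:
  assumes skew: "\<And>u v. w u v = - w v u"
    and l: "\<And>u. w z' u = w z u + c * w a u"
  shows "pf w (xs @ z' # ys) = pf w (xs @ z # ys) + c * pf w (xs @ a # ys)"
proof -
  have "pf w (z' # v) = pf w (z # v) + c * pf w (a # v)" for v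
    by (simp add: l algebra_simps sum.distrib sum_distrib_left)
  then show ?thesis
    by (simp only: pf_move_front[where w = w and xs = xs, OF skew] algebra_simps)
qed

text \<open>Since \<open>u\<close> and \<open>v\<close> stay in the list, adding their multiples to
  other entries changes the Pfaffian only by terms with a repeated entry, which vanish, and acts on
  the matrix by paired row and column operations. The prefix \<open>xs\<close> collects the entries
  already modified, so that the induction can move along the list.\<close>

lemma gram_pf_eliminate:
  fixes w :: "('i \<Rightarrow> complex) \<Rightarrow> ('i \<Rightarrow> complex) \<Rightarrow> complex"
  assumes skew: "\<And>u v. w u v = - w v u"
    and lin: "\<And>u v c z. w (\<lambda>i. u i + c * v i) z = w u z + c * w v z"
  shows "pf w (u # v # xs @ map (\<lambda>z i. (z i + \<alpha> z * u i) + \<beta> z * v i) zs) = pf w (u # v # xs @ zs) \<and>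
    det (gram w (u # v # xs @ map (\<lambda>z i. (z i + \<alpha> z * u i) + \<beta> z * v i) zs)) = det (gram w (u # v # xs @ zs))"
proof (induction zs arbitrary: xs)
  case (Cons z zs)
  have lin2: "w z (\<lambda>i. u i + c * v i) = w z u + c * w z v" for u v c z
    using lin[of u c v z] skew[of z] by simp
  let ?z1 = "\<lambda>i. z i + \<alpha> z * u i"
  let ?z2 = "\<lambda>i. ?z1 i + \<beta> z * v i"
  let ?ys = "map (\<lambda>z i. (z i + \<alpha> z * u i) + \<beta> z * v i) zs"
  have z: "pf w ((u # v # xs) @ u # zs) = 0" "pf w ((u # v # xs) @ v # zs) = 0"
    using pf_dup[where w = w and xs = "[]" and a = u and ys = "v # xs" and zs = zs, OF skew]
      pf_dup[where w = w and xs = "[u]" and a = v and ys = "xs" and zs = zs, OF skew]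
    by (simp_all del: pf.simps)
  have p1: "pf w ((u # v # xs) @ ?z1 # zs) = pf w ((u # v # xs) @ z # zs)"
    using pf_add[where w = w and z' = ?z1 and z = z and c = "\<alpha> z" and a = u and xs = "u # v # xs" and ys = zs, OF skew lin]
    by (simp only: z) simp
  have p2: "pf w ((u # v # xs) @ ?z2 # zs) = pf w ((u # v # xs) @ ?z1 # zs)"
    using pf_add[where w = w and z' = ?z2 and z = ?z1 and c = "\<beta> z" and a = v and xs = "u # v # xs" and ys = zs, OF skew lin]
    by (simp only: z) simp
  let ?k = "Suc (Suc (length xs))"
  have d1: "det (gram w ((u # v # xs @ z # zs)[?k := ?z1])) = det (gram w (u # v # xs @ z # zs))"
    by (rule det_gram_add[where w = w and z' = ?z1 and z = z and c = "\<alpha> z" and a = u and k = ?k and l = 0, OF lin lin2]) auto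
  have d2: "det (gram w ((u # v # xs @ ?z1 # zs)[?k := ?z2])) = det (gram w (u # v # xs @ ?z1 # zs))"
    by (rule det_gram_add[where w = w and z' = ?z2 and z = ?z1 and c = "\<beta> z" and a = v and k = ?k and l = 1, OF lin lin2]) auto
  show ?case using Cons.IH[of "xs @ [?z2]"] p1 p2 d1 d2 by (simp del: pf.simps)
qed simp

lemma det_2x2_skew: "det (mat 2 2 (\<lambda>(i, j). if i = j then 0 else if i < j then b else - b)) = (b :: complex)\<^sup>2"
  by (subst laplace_expansion_row[where n = 2 and i = 0])
     (auto simp: numeral_2_eq_2 cofactor_def det_single mat_delete_def)

text \<open>Symplectic Gram-Schmidt: a partner \<open>u\<close> with \<open>w v u\<close> nonzero
  splits off a plane, the other entries are projected to its complement, and both sides lose the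
  same factor. Without a partner the first row vanishes, and so does the Pfaffian. A bilinear form
  on vectors is used because projected basis vectors are no longer basis vectors.\<close>

lemma det_gram_eq_pf_square_bilinear:
  fixes w :: "('i \<Rightarrow> complex) \<Rightarrow> ('i \<Rightarrow> complex) \<Rightarrow> complex"
  assumes skew: "\<And>u v. w u v = - w v u"
    and lin: "\<And>u v c z. w (\<lambda>i. u i + c * v i) z = w u z + c * w v z"
  shows "det (gram w vs) = (pf w vs)\<^sup>2"
proof (induction "length vs" arbitrary: vs rule: less_induct)
  case less
  have self: "w u u = 0" for u using skew[of u u] by simp
  have lin2: "w z (\<lambda>i. u i + c * v i) = w z u + c * w z v" for u v c z
    using lin[of u c v z] skew[of z] by simp
  show ?case
  proof (cases vs)
    case Nil
    then show ?thesis by (simp add: gram_def)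
  next
    case (Cons v ws)
    show ?thesis
    proof (cases "\<exists>k<length ws. w v (ws ! k) \<noteq> 0")
      case False
      then have "pf w vs = 0" using Cons by simp
      moreover have "det (gram w vs) = (\<Sum>j<length vs. gram w vs $$ (0, j) * cofactor (gram w vs) 0 j)"
        by (rule laplace_expansion_row) (use Cons gram_carrier[of w vs] in auto)
      moreover have "gram w vs $$ (0, j) = 0" if "j < length vs" for j
        using False that Cons self by (cases j) (auto simp: gram_def)
      ultimately show ?thesis by simp
    next
      case True
      then obtain us u ys where ws: "ws = us @ u # ys" and a0: "w v u \<noteq> 0"
        by (metis id_take_nth_drop)
      define zs where "zs = us @ ys"
      define a where "a = w v u"
      \<comment> \<open>The coefficients are forced by requiring \<open>f z\<close> to be orthogonal
        to \<open>u\<close> and \<open>v\<close>, given \<open>w v u = a\<close> and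
        \<open>w u v = - a\<close>.\<close>
      define f where "f = (\<lambda>z i. (z i + (- (w v z) / a) * u i) + (w u z / a) * v i)"
      have wvu: "w u v = - a" using skew[of u v] a_def by simp
      have a: "a \<noteq> 0" using a0 a_def by simp
      have fv: "w v (f z) = 0" and fu: "w u (f z) = 0" for z
        unfolding f_def lin2 using a by (auto simp: self wvu a_def[symmetric])
      have pf1: "(pf w vs)\<^sup>2 = (pf w (u # v # zs))\<^sup>2"
        using pf_move_front[where w = w and xs = "v # us" and a = u and ys = ys, OF skew] Cons ws zs_def
        by (simp add: power_mult_distrib minus_one_power_iff del: pf.simps)
      have d1: "det (gram w vs) = det (gram w (u # v # zs))"
        using det_gram_move_front[of w "v # us" u ys] Cons ws zs_def by simp
      have e: "pf w (u # v # map f zs) = pf w (u # v # zs)"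
        "det (gram w (u # v # map f zs)) = det (gram w (u # v # zs))"
        using gram_pf_eliminate[where w = w and xs = "[]" and zs = zs and u = u and v = v
          and \<alpha> = "\<lambda>z. - w v z / a" and \<beta> = "\<lambda>z. w u z / a", OF skew lin]
        unfolding f_def append_Nil by blast+
      have pf2: "pf w (u # v # map f zs) = - a * pf w (map f zs)"
        by (simp only: pf_expand_two wvu) (simp add: fu)
      let ?m = "length zs"
      let ?B = "mat 2 2 (\<lambda>(i, j). if i = j then 0 else if i < j then - a else - (- a))"
      have "gram w (u # v # map f zs) = four_block_mat ?B (0\<^sub>m 2 ?m) (0\<^sub>m ?m 2) (gram w (map f zs))"
      proof (rule eq_matI)
        fix i j
        assume "i < dim_row (four_block_mat ?B (0\<^sub>m 2 ?m) (0\<^sub>m ?m 2) (gram w (map f zs)))"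
          "j < dim_col (four_block_mat ?B (0\<^sub>m 2 ?m) (0\<^sub>m ?m 2) (gram w (map f zs)))"
        then have ij: "i < Suc (Suc ?m)" "j < Suc (Suc ?m)" by (auto simp: gram_def)
        have fv': "w (f z) v = 0" and fu': "w (f z) u = 0" for z
          using fv fu skew[of "f z"] by simp_all
        have "i = 0 \<or> i = 1 \<or> (\<exists>i'. i = Suc (Suc i') \<and> i' < ?m)" "j = 0 \<or> j = 1 \<or> (\<exists>j'. j = Suc (Suc j') \<and> j' < ?m)"
          using ij by presburger+
        then show "gram w (u # v # map f zs) $$ (i, j) = four_block_mat ?B (0\<^sub>m 2 ?m) (0\<^sub>m ?m 2) (gram w (map f zs)) $$ (i, j)"
          by (elim disjE exE conjE) (simp_all add: gram_def self wvu fv fu fv' fu' a_def[symmetric])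
      qed (auto simp: gram_def)
      then have "det (gram w (u # v # map f zs)) = det ?B * det (gram w (map f zs))"
        by (simp only:) (rule det_four_block_mat_lower_left_zero[where n = 2 and m = ?m], simp_all add: gram_def)
      also have "det ?B = a\<^sup>2" by (subst det_2x2_skew) simp
      also have "det (gram w (map f zs)) = (pf w (map f zs))\<^sup>2"
        by (rule less) (simp add: Cons ws zs_def)
      finally show ?thesis unfolding pf1 d1 e(2) e(1)[symmetric] pf2 by (simp add: power_mult_distrib)
    qed
  qed
qed

lemma del_map: "del k (map f xs) = map f (del k xs)"
  by (simp add: del_def take_map drop_map)

lemma pf_map: "pf w (map f xs) = pf (\<lambda>x y. w (f x) (f y)) xs"
proof (induction "length xs" arbitrary: xs rule: less_induct)
  case less
  show ?case
  proof (cases xs)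
    case (Cons x ys)
    have "pf w (map f (del k ys)) = pf (\<lambda>x y. w (f x) (f y)) (del k ys)" if "k < length ys" for k
      by (rule less) (use that Cons in \<open>simp add: length_del\<close>)
    then show ?thesis using Cons by (simp add: del_map)
  qed simp
qed

lemma set_del: "set (del k xs) \<subseteq> set xs"
  by (auto simp: del_def dest: in_set_takeD in_set_dropD)

lemma pf_cong:
  assumes "\<And>x y. x \<in> set xs \<Longrightarrow> y \<in> set xs \<Longrightarrow> w x y = w' x y"
  shows "pf w xs = pf w' xs"
  using assms
proof (induction "length xs" arbitrary: xs rule: less_induct)
  case less
  show ?case
  proof (cases xs)
    case (Cons x ys)
    have "pf w (del k ys) = pf w' (del k ys)" if "k < length ys" for k
      by (rule less) (use that Cons less.prems set_del[of k ys] in \<open>auto simp: length_del\<close>)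
    then show ?thesis using Cons less.prems by simp
  qed simp
qed

theorem det_eq_pf_square:
  fixes A :: "nat \<Rightarrow> nat \<Rightarrow> complex"
  assumes skew: "\<And>i j. i < n \<Longrightarrow> j < n \<Longrightarrow> A i j = - A j i"
  shows "det (mat n n (\<lambda>(i, j). A i j)) = (pf A [0..<n])\<^sup>2"
proof -
  define w where "w = (\<lambda>u v. \<Sum>i<n. \<Sum>j<n. u i * A i j * (v j :: complex))"
  define e where "e = (\<lambda>k i :: nat. if i = k then 1 else 0 :: complex)"
  have skew_w: "w u v = - w v u" for u v
  proof -
    have "w u v = (\<Sum>i<n. \<Sum>j<n. - (v j * A j i * u i))"
      unfolding w_def by (intro sum.cong refl) (metis skew lessThan_iff mult.commute mult_minus_right mult.assoc)
    also have "\<dots> = - w v u" unfolding w_def by (subst sum.swap) (simp add: sum_negf)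
    finally show ?thesis .
  qed
  have lin: "w (\<lambda>i. u i + c * v i) z = w u z + c * w v z" for u v c z
    by (simp add: w_def algebra_simps sum.distrib sum_distrib_left)
  have we: "w (e i) (e j) = A i j" if "i < n" "j < n" for i j
  proof -
    have "w (e i) (e j) = (\<Sum>k<n. if k = i then (\<Sum>l<n. if l = j then A k l else 0) else 0)"
      unfolding w_def e_def by (intro sum.cong refl) (simp add: mult_delta_right)
    then show ?thesis using that by (simp only: sum.delta finite_lessThan lessThan_iff if_True)
  qed
  have "mat n n (\<lambda>(i, j). A i j) = gram w (map e [0..<n])"
    by (rule eq_matI) (auto simp: gram_def we)
  moreover have "pf w (map e [0..<n]) = pf A [0..<n]"
    unfolding pf_map by (rule pf_cong) (auto simp: we)
  ultimately show ?thesis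
    using det_gram_eq_pf_square_bilinear[where w = w, OF skew_w lin] by simp
qed

section \<open>Pfaffians of sums, of block matrices and of pairings\<close>

text \<open>Two chords of a linear order interlace iff the number of pairs $(a, b)$ with $a$ in the
  first chord, $b$ in the second and $a < b$ is odd, so \<open>sinv\<close> applied to two chords is their crossing sign.\<close>

definition sg :: "nat \<Rightarrow> nat \<Rightarrow> complex" where
  "sg i j = (if i < j then -1 else 1)"

definition sinv :: "nat set \<Rightarrow> nat set \<Rightarrow> complex" where
  "sinv U W = (\<Prod>u\<in>U. \<Prod>w\<in>W. sg u w)"

lemma sg_square [simp]: "sg i j * sg i j = 1" "sg i j * (sg i j * z) = z"
  by (auto simp: sg_def)

lemma sg_min: "m < j \<Longrightarrow> j \<noteq> k \<Longrightarrow> sg m j * sg k j = sg j k"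
  by (auto simp: sg_def)

lemma prod_sg_eq_power:
  "finite S \<Longrightarrow> (\<Prod>j\<in>S. sg j k) = (-1) ^ card {j\<in>S. j < k}"
  unfolding sg_def by (simp add: prod.If_cases Int_def)

section \<open>Pfaffians indexed by finite sets of natural numbers\<close>

definition pfs :: "(nat \<Rightarrow> nat \<Rightarrow> complex) \<Rightarrow> nat set \<Rightarrow> complex" where
  "pfs A S = pf A (sorted_list_of_set S)"

lemma pfs_empty [simp]: "pfs A {} = 1"
  by (simp add: pfs_def)

lemma remove1_nth: "distinct xs \<Longrightarrow> k < length xs \<Longrightarrow> remove1 (xs ! k) xs = del k xs"
proof (induction xs arbitrary: k)
  case (Cons x xs)
  then show ?case by (cases k) auto
qed simp

lemma card_less_nth_sorted:
  fixes xs :: "nat list"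
  assumes "sorted_wrt (<) xs" "k < length xs"
  shows "card {j \<in> set xs. j < xs ! k} = k"
proof -
  have "{j \<in> set xs. j < xs ! k} = (!) xs ` {..<k}"
    using assms by (auto simp: in_set_conv_nth sorted_wrt_iff_nth_less)
      (metis linorder_neqE_nat not_less_iff_gr_or_eq lessThan_iff image_iff order.strict_trans, metis order.strict_trans)
  moreover have "inj_on ((!) xs) {..<k}"
    using assms by (intro inj_onI) (metis lessThan_iff nth_eq_iff_index_eq order.strict_trans strict_sorted_iff)
  ultimately show ?thesis by (simp add: card_image)
qed

lemma sum_nth_distinct: "distinct ys \<Longrightarrow> (\<Sum>k\<in>set ys. f k) = (\<Sum>i<length ys. f (ys ! i))"
  using sum.reindex_bij_betw[OF bij_betw_nth[of ys "{..<length ys}" "set ys"], of f] by simp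

text \<open>The sign \<open>(-1) ^ k\<close> of the list expansion is the parity of the number of
  remaining elements below the partner. As a product of comparisons it no longer refers to positions
  and can be split along subsets.\<close>

lemma pfs_rec:
  assumes fin: "finite S" and ne: "S \<noteq> {}" and m: "m = Min S"
  shows "pfs A S = (\<Sum>k\<in>S - {m}. (\<Prod>j\<in>S - {m,k}. sg j k) * A m k * pfs A (S - {m, k}))"
proof -
  define ys where "ys = sorted_list_of_set (S - {m})"
  have set_ys: "set ys = S - {m}" and ss: "sorted_wrt (<) ys" and dist: "distinct ys"
    using fin by (auto simp: ys_def)
  have S: "sorted_list_of_set S = m # ys"
    using sorted_list_of_set_nonempty[OF fin ne] m ys_def by simp
  have 1: "(\<Prod>j\<in>S - {m, ys ! i}. sg j (ys ! i)) = (-1) ^ i" if "i < length ys" for i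
  proof -
    have "{j \<in> S - {m, ys ! i}. j < ys ! i} = {j \<in> set ys. j < ys ! i}"
      using set_ys by auto
    then show ?thesis
      using card_less_nth_sorted[OF ss that] fin by (simp add: prod_sg_eq_power)
  qed
  have 2: "pfs A (S - {m, ys ! i}) = pf A (del i ys)" if "i < length ys" for i
  proof -
    have "S - {m, ys ! i} = (S - {m}) - {ys ! i}" by auto
    then have "sorted_list_of_set (S - {m, ys ! i}) = remove1 (ys ! i) ys"
      using fin sorted_list_of_set_remove[of "S - {m}" "ys ! i"] by (simp add: ys_def)
    then show ?thesis by (simp add: pfs_def remove1_nth[OF dist that])
  qed
  have "pfs A S = (\<Sum>i<length ys. (-1) ^ i * A m (ys ! i) * pf A (del i ys))"
    unfolding pfs_def S by simp
  also have "\<dots> = (\<Sum>i<length ys. (\<Prod>j\<in>S - {m,ys ! i}. sg j (ys ! i)) * A m (ys ! i) * pfs A (S - {m, ys ! i}))"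
    by (intro sum.cong refl) (simp add: 1 2)
  finally show ?thesis unfolding set_ys[symmetric] sum_nth_distinct[OF dist] .
qed

lemma sinv_insert1: "finite U \<Longrightarrow> u \<notin> U \<Longrightarrow> sinv (insert u U) W = (\<Prod>w\<in>W. sg u w) * sinv U W"
  by (simp add: sinv_def)

lemma sinv_insert2: "finite W \<Longrightarrow> w \<notin> W \<Longrightarrow> sinv U (insert w W) = (\<Prod>u\<in>U. sg u w) * sinv U W"
  by (simp add: sinv_def prod.distrib)

text \<open>The partner of the minimum \<open>m\<close> is supplied by \<open>A\<close> or by
  \<open>B\<close>, which decides whether \<open>m\<close> belongs to \<open>U\<close>; induction
  treats the rest. \<open>sinv\<close> counts pairs \<open>u < w\<close> instead of the inversions
  \<open>u > w\<close>; the parities agree in the nonzero terms, where \<open>U\<close> and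
  \<open>S - U\<close> have even size.\<close>

lemma pfs_add:
  assumes "finite S"
  shows "pfs (\<lambda>i j. A i j + B i j) S = (\<Sum>U\<in>Pow S. sinv U (S - U) * pfs A U * pfs B (S - U))"
  using assms
proof (induction "card S" arbitrary: S rule: less_induct)
  case less
  show ?case
  proof (cases "S = {}")
    case True
    then show ?thesis by (simp add: sinv_def)
  next
    case False
    define m where "m = Min S"
    have mS: "m \<in> S" using False less.prems m_def by simp
    have mless: "m < j" if "j \<in> S" "j \<noteq> m" for j
      using that less.prems m_def by (simp add: order.not_eq_order_implies_strict)
    let ?T = "\<lambda>k. S - {m, k}"
    let ?f = "\<lambda>k U. (\<Prod>j\<in>?T k. sg j k) * A m k * (sinv U (?T k - U) * pfs A U * pfs B (?T k - U))"
    let ?g = "\<lambda>k U. (\<Prod>j\<in>?T k. sg j k) * B m k * (sinv U (?T k - U) * pfs A U * pfs B (?T k - U))"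
    let ?h = "\<lambda>U. sinv U (S - U) * pfs A U * pfs B (S - U)"
    have IH: "pfs (\<lambda>i j. A i j + B i j) (?T k) = (\<Sum>U\<in>Pow (?T k). sinv U (?T k - U) * pfs A U * pfs B (?T k - U))" for k
      by (rule less.hyps) (use less.prems mS in \<open>auto intro!: psubset_card_mono\<close>)
    have "pfs (\<lambda>i j. A i j + B i j) S = (\<Sum>k\<in>S - {m}. \<Sum>U\<in>Pow (?T k). ?f k U) + (\<Sum>k\<in>S - {m}. \<Sum>U\<in>Pow (?T k). ?g k U)"
      by (subst pfs_rec[OF less.prems False m_def]) (simp add: IH algebra_simps sum.distrib sum_distrib_left)
    also have "(\<Sum>k\<in>S - {m}. \<Sum>U\<in>Pow (?T k). ?f k U) = (\<Sum>U\<in>{U\<in>Pow S. m \<in> U}. ?h U)"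
    proof -
      have h: "?h U = (\<Sum>k\<in>U - {m}. ?f k (U - {m, k}))" if U: "U \<subseteq> S" "m \<in> U" for U
      proof -
        have finU: "finite U" using U less.prems finite_subset by auto
        have mU: "m = Min U"
          using U finU less.prems unfolding m_def by (metis Min_antimono Min_le antisym empty_iff)
        have "?h U = (\<Sum>k\<in>U - {m}. sinv U (S - U) * ((\<Prod>j\<in>U - {m,k}. sg j k) * A m k * pfs A (U - {m, k})) * pfs B (S - U))"
          using U by (subst pfs_rec[OF finU _ mU]) (auto simp: sum_distrib_left sum_distrib_right)
        also have "\<dots> = (\<Sum>k\<in>U - {m}. ?f k (U - {m, k}))"
        proof (rule sum.cong[OF refl])
          fix k assume k: "k \<in> U - {m}"
          let ?W = "S - U" and ?U = "U - {m, k}"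
          have W: "?T k - ?U = ?W" using k U by auto
          have Ui: "U = insert m (insert k ?U)" using k U by auto
          \<comment> \<open>As \<open>m\<close> lies below every \<open>w\<close>, its factor just
            reverses the comparison of \<open>w\<close> with \<open>k\<close>.\<close>
          have "sinv U ?W = (\<Prod>w\<in>?W. sg m w) * ((\<Prod>w\<in>?W. sg k w) * sinv ?U ?W)"
            by (subst Ui) (use k finU in \<open>simp add: sinv_insert1\<close>)
          also have "\<dots> = (\<Prod>w\<in>?W. sg w k) * sinv ?U ?W"
            unfolding mult.assoc[symmetric] prod.distrib[symmetric]
            by (intro arg_cong2[where f = "(*)"] prod.cong refl sg_min) (use U k mless in auto)
          finally have s: "sinv U ?W = (\<Prod>w\<in>?W. sg w k) * sinv ?U ?W" .
          have "?T k = ?U \<union> ?W" using k U by auto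
          then have "(\<Prod>j\<in>?T k. sg j k) = (\<Prod>j\<in>?U. sg j k) * (\<Prod>j\<in>?W. sg j k)"
            using less.prems finU by (simp add: prod.union_disjoint Int_def)
          then show "sinv U (S - U) * ((\<Prod>j\<in>U - {m,k}. sg j k) * A m k * pfs A (U - {m, k})) * pfs B (S - U) = ?f k (U - {m, k})"
            unfolding W s by (simp add: mult_ac)
        qed
        finally show ?thesis .
      qed
      have "(\<Sum>U\<in>{U\<in>Pow S. m \<in> U}. ?h U) = (\<Sum>U\<in>{U\<in>Pow S. m \<in> U}. \<Sum>k\<in>U - {m}. ?f k (U - {m, k}))"
        by (intro sum.cong refl h) auto
      also have "\<dots> = (\<Sum>(U,k)\<in>(SIGMA U:{U\<in>Pow S. m \<in> U}. U - {m}). ?f k (U - {m, k}))"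
        using less.prems by (intro sum.Sigma) (auto intro: finite_subset)
      also have "\<dots> = (\<Sum>(k,U)\<in>(SIGMA k:S - {m}. Pow (?T k)). ?f k U)"
        by (rule sum.reindex_bij_witness[of _ "\<lambda>(k,U). (insert m (insert k U), k)" "\<lambda>(U,k). (k, U - {m,k})"])
          (use mS in \<open>auto simp: insert_absorb\<close>)
      also have "\<dots> = (\<Sum>k\<in>S - {m}. \<Sum>U\<in>Pow (?T k). ?f k U)"
        using less.prems by (intro sum.Sigma[symmetric]) auto
      finally show ?thesis ..
    qed
    also have "(\<Sum>k\<in>S - {m}. \<Sum>U\<in>Pow (?T k). ?g k U) = (\<Sum>U\<in>{U\<in>Pow S. m \<notin> U}. ?h U)"
    proof -
      have h: "?h U = (\<Sum>k\<in>S - U - {m}. ?g k U)" if U: "U \<subseteq> S" "m \<notin> U" for U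
      proof -
        let ?W = "S - U"
        have finW: "finite ?W" and finU: "finite U" using less.prems U finite_subset by auto
        have mW: "m = Min ?W"
          using U finW less.prems mS unfolding m_def by (metis DiffI Diff_subset Min_antimono Min_le antisym empty_iff)
        have "?h U = (\<Sum>k\<in>?W - {m}. sinv U ?W * pfs A U * ((\<Prod>j\<in>?W - {m,k}. sg j k) * B m k * pfs B (?W - {m, k})))"
          using U mS by (subst pfs_rec[OF finW _ mW]) (auto simp: sum_distrib_left sum_distrib_right)
        also have "\<dots> = (\<Sum>k\<in>?W - {m}. ?g k U)"
        proof (rule sum.cong[OF refl])
          fix k assume k: "k \<in> ?W - {m}"
          let ?W' = "?W - {m, k}"
          have W: "?T k - U = ?W'" by auto
          have Wi: "?W = insert m (insert k ?W')" using k U mS by auto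
          have um: "(\<Prod>u\<in>U. sg u m) = 1"
            by (intro prod.neutral ballI) (use U mless in \<open>force simp: sg_def\<close>)
          have "sinv U ?W = (\<Prod>u\<in>U. sg u m) * ((\<Prod>u\<in>U. sg u k) * sinv U ?W')"
            by (subst Wi) (use k finW in \<open>simp add: sinv_insert2\<close>)
          then have s: "sinv U ?W = (\<Prod>u\<in>U. sg u k) * sinv U ?W'" by (simp add: um)
          have "?T k = U \<union> ?W'" using k U by auto
          then have "(\<Prod>j\<in>?T k. sg j k) = (\<Prod>j\<in>U. sg j k) * (\<Prod>j\<in>?W'. sg j k)"
            using less.prems finU by (simp add: prod.union_disjoint Int_def)
          then show "sinv U ?W * pfs A U * ((\<Prod>j\<in>?W - {m,k}. sg j k) * B m k * pfs B (?W - {m, k})) = ?g k U"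
            unfolding W s by (simp add: mult_ac)
        qed
        finally show ?thesis .
      qed
      have "(\<Sum>U\<in>{U\<in>Pow S. m \<notin> U}. ?h U) = (\<Sum>U\<in>{U\<in>Pow S. m \<notin> U}. \<Sum>k\<in>S - U - {m}. ?g k U)"
        by (intro sum.cong refl h) auto
      also have "\<dots> = (\<Sum>(U,k)\<in>(SIGMA U:{U\<in>Pow S. m \<notin> U}. S - U - {m}). ?g k U)"
        using less.prems by (intro sum.Sigma) (auto intro: finite_subset)
      also have "\<dots> = (\<Sum>(k,U)\<in>(SIGMA k:S - {m}. Pow (?T k)). ?g k U)"
        by (rule sum.reindex_bij_witness[of _ "\<lambda>(k,U). (U, k)" "\<lambda>(U,k). (k, U)"]) auto
      also have "\<dots> = (\<Sum>k\<in>S - {m}. \<Sum>U\<in>Pow (?T k). ?g k U)"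
        using less.prems by (intro sum.Sigma[symmetric]) auto
      finally show ?thesis ..
    qed
    also have "(\<Sum>U\<in>{U\<in>Pow S. m \<in> U}. ?h U) + (\<Sum>U\<in>{U\<in>Pow S. m \<notin> U}. ?h U) = (\<Sum>U\<in>Pow S. ?h U)"
    proof -
      have "Pow S = {U\<in>Pow S. m \<in> U} \<union> {U\<in>Pow S. m \<notin> U}" by auto
      then show ?thesis using less.prems by (subst (3) \<open>Pow S = _\<close>) (subst sum.union_disjoint, auto)
    qed
    finally show ?thesis .
  qed
qed

text \<open>The summand is minus one to the rank of \<open>k\<close> in \<open>X\<close>, so the sum
  is \<open>1 - 1 + 1 - ...\<close>.\<close>

lemma sum_sg_alternating:
  assumes "finite X"
  shows "(\<Sum>k\<in>X. \<Prod>j\<in>X - {k}. sg j k) = (if odd (card X) then 1 else 0)"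
  using assms
proof (induction rule: finite_linorder_max_induct)
  case (insert b X)
  have bX: "b \<notin> X" using insert by auto
  have "(\<Prod>j\<in>insert b X - {k}. sg j k) = (\<Prod>j\<in>X - {k}. sg j k)" if "k \<in> X" for k
  proof -
    have "insert b X - {k} = insert b (X - {k})" using that bX by auto
    then show ?thesis using insert that bX by (auto simp: sg_def)
  qed
  moreover have "(\<Prod>j\<in>X. sg j b) = (-1) ^ card X"
    using insert by (simp add: sg_def)
  ultimately show ?case using insert bX by (simp add: minus_one_power_iff)
qed simp

text \<open>This is where the pairings at a vertex sum to one: a skew matrix with ones above the
  diagonal has Pfaffian 1 in even size, by the alternating sum over the partner of the first index.
  Because the fibres of \<open>b\<close> are intervals, indices of other blocks lie behind that
  partner and contribute no sign.\<close>

lemma pfs_blocks: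
  assumes "finite S"
    and conv: "\<And>i j k. i \<in> S \<Longrightarrow> j \<in> S \<Longrightarrow> k \<in> S \<Longrightarrow> i < j \<Longrightarrow> j < k \<Longrightarrow> b i = b k \<Longrightarrow> b j = b i"
    and B: "\<And>i j. i \<in> S \<Longrightarrow> j \<in> S \<Longrightarrow> i < j \<Longrightarrow> B i j = (if b i = b j then y i * y j else 0)"
  shows "pfs B S = (if \<forall>v. even (card {i\<in>S. b i = v}) then \<Prod>i\<in>S. y i else 0)"
  using assms
proof (induction "card S" arbitrary: S rule: less_induct)
  case less
  show ?case
  proof (cases "S = {}")
    case False
    note fin = \<open>finite S\<close>
    define m where "m = Min S"
    have mS: "m \<in> S" using False fin m_def by simp
    have mless: "m < j" if "j \<in> S" "j \<noteq> m" for j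
      using that fin m_def by (simp add: order.not_eq_order_implies_strict)
    let ?E = "\<lambda>S. \<forall>v. even (card {i\<in>S. b i = v})"
    define X where "X = {i\<in>S. b i = b m} - {m}"
    have IH: "pfs B (S - {m, k}) = (if ?E (S - {m,k}) then \<Prod>i\<in>S - {m,k}. y i else 0)" for k
    proof (rule less.hyps)
      show "card (S - {m, k}) < card S" using fin mS by (auto intro!: psubset_card_mono)
    qed (use fin less.prems in blast)+
    define e where "e \<longleftrightarrow> ?E S"
    have "pfs B S = (\<Sum>k\<in>S - {m}. (\<Prod>j\<in>S - {m,k}. sg j k) * B m k * pfs B (S - {m, k}))"
      by (rule pfs_rec[OF fin False m_def])
    also have "\<dots> = (\<Sum>k\<in>X. (\<Prod>j\<in>S - {m,k}. sg j k) * B m k * pfs B (S - {m, k}))"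
      using fin less.prems(3)[OF mS] mless by (intro sum.mono_neutral_right) (auto simp: X_def)
    also have "\<dots> = (\<Sum>k\<in>X. (\<Prod>j\<in>X - {k}. sg j k) * (if e then \<Prod>i\<in>S. y i else 0))"
    proof (rule sum.cong[OF refl])
      fix k assume "k \<in> X"
      then have k: "k \<in> S" "b k = b m" "k \<noteq> m" by (auto simp: X_def)
      have "(\<Prod>j\<in>S - {m,k}. sg j k) = (\<Prod>j\<in>X - {k}. sg j k)"
      proof (rule prod.mono_neutral_right)
        show "\<forall>i\<in>S - {m, k} - (X - {k}). sg i k = 1"
          using less.prems(2)[of m _ k] k mS mless by (auto simp: X_def sg_def)
      qed (use fin in \<open>auto simp: X_def\<close>)
      moreover have "B m k = y m * y k"
        using less.prems(3)[of m k] k mS mless[of k] by simp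
      moreover have "?E (S - {m,k}) = e"
      proof -
        have ev: "even (card {i\<in>S - {m,k}. b i = v}) = even (card {i\<in>S. b i = v})" for v
        proof (cases "v = b m")
          case True
          then have "{i\<in>S. b i = v} = insert m (insert k {i\<in>S - {m,k}. b i = v})" using k mS by auto
          then show ?thesis using fin k by (simp only:) simp
        next
          case False
          then have "{i\<in>S. b i = v} = {i\<in>S - {m,k}. b i = v}" using k by auto
          then show ?thesis by simp
        qed
        show ?thesis unfolding e_def by (simp only: ev)
      qed
      moreover have "(\<Prod>i\<in>S. y i) = y m * y k * (\<Prod>i\<in>S - {m,k}. y i)"
      proof -
        have "S = insert m (insert k (S - {m,k}))" using k mS by auto
        then have "(\<Prod>i\<in>S. y i) = (\<Prod>i\<in>insert m (insert k (S - {m,k})). y i)" by simp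
        then show ?thesis using fin k by simp
      qed
      ultimately show "(\<Prod>j\<in>S - {m,k}. sg j k) * B m k * pfs B (S - {m, k}) =
          (\<Prod>j\<in>X - {k}. sg j k) * (if e then \<Prod>i\<in>S. y i else 0)"
        using IH[of k] by (simp only:) simp
    qed
    also have "\<dots> = (\<Sum>k\<in>X. \<Prod>j\<in>X - {k}. sg j k) * (if e then \<Prod>i\<in>S. y i else 0)"
      by (simp add: sum_distrib_right)
    also have "\<dots> = (if e then \<Prod>i\<in>S. y i else 0)"
    proof (cases "e")
      case True
      have "card {i\<in>S. b i = b m} = Suc (card X)"
        using fin mS unfolding X_def by (subst card_Suc_Diff1) auto
      then have "odd (card X)" using True[unfolded e_def, rule_format, of "b m"] by simp
      moreover have "finite X" using fin by (simp add: X_def)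
      ultimately show ?thesis by (simp add: sum_sg_alternating)
    qed simp
    finally show ?thesis unfolding e_def .
  qed simp
qed

text \<open>The sign of the matching \<open>i <-> r i\<close>: minus one to the number of
  interlacing pairs of chords. A chord is represented by its lower end, and \<open>c < d\<close>
  counts each pair once.\<close>

definition sgl :: "(nat \<Rightarrow> nat) \<Rightarrow> nat set \<Rightarrow> complex" where
  "sgl r S = (\<Prod>(c,d)\<in>{(c,d). c \<in> S \<and> d \<in> S \<and> c < r c \<and> d < r d \<and> c < d}. sinv {c, r c} {d, r d})"

lemma prod_pairing:
  fixes r :: "nat \<Rightarrow> nat"
  assumes "finite S" and "\<And>i. i \<in> S \<Longrightarrow> r i \<in> S \<and> r (r i) = i \<and> r i \<noteq> i"
  shows "(\<Prod>i\<in>S. f i) = (\<Prod>i\<in>{i\<in>S. i < r i}. f i * f (r i))"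
proof -
  let ?L = "{i\<in>S. i < r i}" and ?U = "{i\<in>S. r i < i}"
  have "S = ?L \<union> ?U" using assms(2) by (auto simp: neq_iff)
  then have "(\<Prod>i\<in>S. f i) = (\<Prod>i\<in>?L \<union> ?U. f i)" by simp
  also have "\<dots> = (\<Prod>i\<in>?L. f i) * (\<Prod>i\<in>?U. f i)"
    by (rule prod.union_disjoint) (use assms(1) in auto)
  also have "(\<Prod>i\<in>?U. f i) = (\<Prod>i\<in>?L. f (r i))"
    by (rule prod.reindex_bij_witness[of _ r r]) (use assms(2) in auto)
  finally show ?thesis by (simp add: prod.distrib)
qed

text \<open>At most one matching survives. Removing the chord of the minimum \<open>m\<close>
  produces the parity of the number of remaining elements below \<open>r m\<close>; a chord lying
  wholly below \<open>r m\<close> has two such ends, one interlacing with \<open>{m, r m}\<close>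
  has exactly one.\<close>

lemma pfs_pairing:
  assumes "finite S" and inv: "\<And>i. i \<in> S \<Longrightarrow> r (r i) = i \<and> r i \<noteq> i"
    and K: "\<And>i j. i \<in> S \<Longrightarrow> j \<in> S \<Longrightarrow> i < j \<Longrightarrow> K i j = (if j = r i then 1 else 0)"
  shows "pfs K S = (if r ` S \<subseteq> S then sgl r S else 0)"
  using assms
proof (induction "card S" arbitrary: S rule: less_induct)
  case less
  show ?case
  proof (cases "S = {}")
    case True
    then show ?thesis by (simp add: sgl_def)
  next
    case False
    note fin = \<open>finite S\<close>
    define m where "m = Min S"
    have mS: "m \<in> S" using False fin m_def by simp
    have mless: "m < j" if "j \<in> S" "j \<noteq> m" for j
      using that fin m_def by (simp add: order.not_eq_order_implies_strict)
    have rec: "pfs K S = (\<Sum>k\<in>S - {m}. (\<Prod>j\<in>S - {m,k}. sg j k) * K m k * pfs K (S - {m, k}))"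
      by (rule pfs_rec[OF fin False m_def])
    show ?thesis
    proof (cases "r m \<in> S")
      case rS: False
      have "K m k = 0" if "k \<in> S - {m}" for k
        using less.prems(3)[OF mS, of k] mless[of k] that rS by auto
      then have "pfs K S = 0" unfolding rec by simp
      then show ?thesis using rS mS by auto
    next
      case True
      let ?S = "S - {m, r m}"
      have rm: "r m \<noteq> m" "r (r m) = m" "m < r m" using less.prems(2)[OF mS] mless[OF True] by auto
      have IH: "pfs K ?S = (if r ` ?S \<subseteq> ?S then sgl r ?S else 0)"
      proof (rule less.hyps)
        show "card ?S < card S" using fin mS by (auto intro!: psubset_card_mono)
      qed (use fin less.prems in blast)+
      have "pfs K S = (\<Sum>k\<in>{r m}. (\<Prod>j\<in>S - {m,k}. sg j k) * K m k * pfs K (S - {m, k}))"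
        unfolding rec using fin True rm less.prems(3)[OF mS] mless by (intro sum.mono_neutral_right) auto
      also have "\<dots> = (\<Prod>j\<in>?S. sg j (r m)) * pfs K ?S"
        using less.prems(3)[OF mS True rm(3)] by simp
      finally have eq: "pfs K S = (\<Prod>j\<in>?S. sg j (r m)) * pfs K ?S" .
      have cl: "r ` ?S \<subseteq> ?S \<longleftrightarrow> r ` S \<subseteq> S"
      proof
        assume c: "r ` ?S \<subseteq> ?S"
        have "r i \<in> S" if "i \<in> S" for i
          using c that True mS rm by (cases "i = m"; cases "i = r m") auto
        then show "r ` S \<subseteq> S" by auto
      next
        assume c: "r ` S \<subseteq> S"
        have "r i \<in> ?S" if "i \<in> ?S" for i
        proof -
          have "r (r i) = i" using less.prems(2) that by blast
          then have "r i \<noteq> m" "r i \<noteq> r m" using that rm(2) by auto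
          then show ?thesis using c that by auto
        qed
        then show "r ` ?S \<subseteq> ?S" by auto
      qed
      show ?thesis
      proof (cases "r ` S \<subseteq> S")
        case closed: True
        let ?P = "\<lambda>S. {(c,d). c \<in> S \<and> d \<in> S \<and> c < r c \<and> d < r d \<and> c < d}"
        have "?P S = ?P ?S \<union> Pair m ` {d\<in>?S. d < r d}" (is "?l = ?r")
        proof -
          have "(c, d) \<in> ?l \<longleftrightarrow> (c, d) \<in> ?r" for c d
          proof -
            have up: "i \<noteq> r m" if "i < r i" for i using that rm by auto
            have lo: "d \<noteq> m" if "c \<in> S" "c < d" using that mless[of c] by (cases "c = m") auto
            have "(c, d) \<in> ?r \<longleftrightarrow> (c \<in> ?S \<or> c = m) \<and> d \<in> ?S \<and> c < r c \<and> d < r d \<and> c < d"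
              using rm(3) mless by auto
            also have "\<dots> \<longleftrightarrow> (c, d) \<in> ?l" using up[of c] up[of d] lo mS by auto
            finally show ?thesis ..
          qed
          then show ?thesis by (intro equalityI subrelI) (simp_all only:)
        qed
        moreover have "finite (?P ?S)"
          by (rule finite_subset[of _ "S \<times> S"]) (use fin in auto)
        ultimately have "sgl r S = sgl r ?S * (\<Prod>d\<in>{d\<in>?S. d < r d}. sinv {m, r m} {d, r d})"
          using fin unfolding sgl_def by (simp only:) (subst prod.union_disjoint, auto simp: prod.reindex inj_on_def)
        also have "(\<Prod>d\<in>{d\<in>?S. d < r d}. sinv {m, r m} {d, r d}) = (\<Prod>d\<in>{d\<in>?S. d < r d}. sg d (r m) * sg (r d) (r m))"
        proof (rule prod.cong[OF refl])
          fix d assume d: "d \<in> {d\<in>?S. d < r d}"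
          then have "r d \<in> ?S" using cl closed by blast
          then show "sinv {m, r m} {d, r d} = sg d (r m) * sg (r d) (r m)"
            using d rm mless[of d] mless[of "r d"] by (auto simp: sinv_def sg_def)
        qed
        also have "\<dots> = (\<Prod>j\<in>?S. sg j (r m))"
          by (rule prod_pairing[symmetric]) (use fin less.prems(2) cl closed in auto)
        finally show ?thesis using eq IH cl closed by simp
      next
        case False
        then show ?thesis using eq IH cl by simp
      qed
    qed
  qed
qed

section \<open>Crossings of straight segments\<close>

text \<open>Height order on the plane; horizontal ties are broken as if the picture were rotated slightly,
  so that upward edges are exactly those whose argument lies in $(0, \pi]$.\<close>

definition pos :: "complex \<Rightarrow> bool" where
  "pos z \<longleftrightarrow> Im z > 0 \<or> (Im z = 0 \<and> Re z < 0)"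

definition below :: "complex \<Rightarrow> complex \<Rightarrow> bool" where
  "below u v \<longleftrightarrow> pos (v - u)"

definition side :: "complex \<Rightarrow> complex \<Rightarrow> complex \<Rightarrow> real" where
  "side p q w = Im (cnj (q - p) * (w - p))"

lemma pos_add: "pos a \<Longrightarrow> pos b \<Longrightarrow> pos (a + b)"
  by (auto simp: pos_def)

lemma pos_scale: "pos a \<Longrightarrow> 0 < k \<Longrightarrow> pos (of_real k * a)"
  by (auto simp: pos_def mult_pos_neg)

lemma pos_scaleD: "pos a \<Longrightarrow> pos (of_real k * a) \<Longrightarrow> 0 < k"
  by (auto simp: pos_def zero_less_mult_iff mult_less_0_iff)

lemma pos_total: "z \<noteq> 0 \<Longrightarrow> pos z \<or> pos (- z)"
  by (auto simp: pos_def complex_eq_iff)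

lemma below_trans: "below u v \<Longrightarrow> below v w \<Longrightarrow> below u w"
  using pos_add[of "v - u" "w - v"] by (simp add: below_def)

lemma below_irrefl [simp]: "\<not> below u u"
  by (simp add: below_def pos_def)

lemma below_asym: "below u v \<Longrightarrow> \<not> below v u"
  using below_trans below_irrefl by blast

lemma below_total: "u \<noteq> v \<Longrightarrow> below u v \<or> below v u"
  using pos_total[of "v - u"] by (simp add: below_def)

lemma in_segmentE:
  assumes "X \<in> closed_segment p q"
  obtains t where "0 \<le> t" "t \<le> 1" "X = p + of_real t * (q - p)"
proof -
  obtain t where "0 \<le> t" "t \<le> 1" "X = (1 - t) *\<^sub>R p + t *\<^sub>R q"
    using assms by (auto simp: closed_segment_def)
  then show ?thesis using that[of t] by (simp add: scaleR_conv_of_real algebra_simps)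
qed

lemma in_segmentI: "0 \<le> t \<Longrightarrow> t \<le> 1 \<Longrightarrow> p + of_real t * (q - p) \<in> closed_segment p q"
  unfolding closed_segment_def by (rule CollectI, rule exI[of _ t]) (simp add: scaleR_conv_of_real algebra_simps)

lemma below_segment:
  assumes "below u p" "below u q" "X \<in> closed_segment p q"
  shows "below u X"
proof -
  obtain t where t: "0 \<le> t" "t \<le> 1" "X = p + of_real t * (q - p)"
    using assms(3) by (rule in_segmentE)
  have eq: "X - u = of_real (1 - t) * (p - u) + of_real t * (q - u)"
    by (simp add: t algebra_simps)
  consider "t = 0" | "t = 1" | "0 < t" "t < 1" using t by linarith
  then show ?thesis
    by cases (use assms t eq pos_add[OF pos_scale pos_scale, of "p - u" "1 - t" "q - u" t] in \<open>auto simp: below_def\<close>)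
qed

lemma segment_below:
  assumes "below p v" "below q v" "X \<in> closed_segment p q"
  shows "below X v"
proof -
  obtain t where t: "0 \<le> t" "t \<le> 1" "X = p + of_real t * (q - p)"
    using assms(3) by (rule in_segmentE)
  have eq: "v - X = of_real (1 - t) * (v - p) + of_real t * (v - q)"
    by (simp add: t algebra_simps)
  consider "t = 0" | "t = 1" | "0 < t" "t < 1" using t by linarith
  then show ?thesis
    by cases (use assms t eq pos_add[OF pos_scale pos_scale, of "v - p" "1 - t" "v - q" t] in \<open>auto simp: below_def\<close>)
qed

lemma collinear_multiple:
  assumes "Im (cnj z * y) = 0" "z \<noteq> 0"
  obtains t where "y = of_real t * z"
proof -
  have "of_real (Re (cnj z * y)) = cnj z * y"
    using assms(1) by (simp add: complex_eq_iff)
  then have "z * of_real (Re (cnj z * y)) = of_real ((cmod z)\<^sup>2) * y"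
    by (simp only: complex_norm_square mult.assoc)
  then have "y = of_real (Re (cnj z * y) / (cmod z)\<^sup>2) * z"
    using assms(2) by (simp add: field_simps)
  then show ?thesis using that by blast
qed

lemma side_zero_in_segment:
  assumes "below p w" "below w q" "side p q w = 0"
  shows "w \<in> closed_segment p q"
proof -
  have pq: "below p q" using assms below_trans by blast
  then have "q - p \<noteq> 0" by auto
  then obtain t where t: "w - p = of_real t * (q - p)"
    using assms(3) collinear_multiple unfolding side_def by blast
  have "0 < t" using pos_scaleD[of "q - p" t] assms pq t by (simp add: below_def)
  moreover have "q - w = of_real (1 - t) * (q - p)"
    using t by (simp add: algebra_simps)
  then have "0 < 1 - t" using pos_scaleD[of "q - p" "1 - t"] assms pq by (simp add: below_def)
  moreover have "w = p + of_real t * (q - p)" using t by (simp add: algebra_simps)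
  ultimately show ?thesis using in_segmentI[of t p q] by simp
qed

lemma side_affine: "side u v (p + of_real t * (q - p)) = (1 - t) * side u v p + t * side u v q"
  by (simp add: side_def algebra_simps)

lemma side_on_line: "side u v (u + of_real t * (v - u)) = 0"
  by (simp add: side_def algebra_simps)

lemma convex_combination_pos:
  fixes a b t :: real
  assumes "0 \<le> t" "t \<le> 1" "0 < a" "0 < b"
  shows "0 < (1 - t) * a + t * b"
  using assms by (cases "t = 0") (auto intro: add_nonneg_pos)

text \<open>Between the heights of its ends the segment from \<open>u\<close> to \<open>v\<close> is
  its whole line, so only the sides of \<open>p\<close> and \<open>q\<close> matter. For the
  converse, the zero of the affine function \<open>side u v\<close> along the inner segment is the
  meeting point.\<close>

lemma nested_segments_meet_iff:
  assumes "below u p" "below p q" "below q v"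
    and nz: "side u v p \<noteq> 0" "side u v q \<noteq> 0"
  shows "(\<exists>X. X \<in> closed_segment u v \<and> X \<in> closed_segment p q) \<longleftrightarrow> (side u v p < 0 \<longleftrightarrow> 0 < side u v q)"
proof
  assume "\<exists>X. X \<in> closed_segment u v \<and> X \<in> closed_segment p q"
  then obtain s t where st: "0 \<le> t" "t \<le> 1" "u + of_real s * (v - u) = p + of_real t * (q - p)"
    by (metis in_segmentE)
  then have z: "(1 - t) * side u v p + t * side u v q = 0"
    by (metis side_affine side_on_line)
  show "side u v p < 0 \<longleftrightarrow> 0 < side u v q"
  proof (rule ccontr)
    assume "\<not> ?thesis"
    then have "0 < side u v p \<and> 0 < side u v q \<or> side u v p < 0 \<and> side u v q < 0"
      using nz by linarith
    then show False
    proof (elim disjE conjE)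
      assume "0 < side u v p" "0 < side u v q"
      then have "0 < (1 - t) * side u v p + t * side u v q"
        using convex_combination_pos st by blast
      then show False using z by simp
    next
      assume "side u v p < 0" "side u v q < 0"
      then have "0 < (1 - t) * (- side u v p) + t * (- side u v q)"
        using convex_combination_pos[of t "- side u v p" "- side u v q"] st by simp
      then show False using z by simp
    qed
  qed
next
  assume opp: "side u v p < 0 \<longleftrightarrow> 0 < side u v q"
  define t where "t = side u v p / (side u v p - side u v q)"
  have t: "0 \<le> t" "t \<le> 1" and d: "side u v p - side u v q \<noteq> 0"
    using opp nz by (auto simp: t_def divide_simps)
  define X where "X = p + of_real t * (q - p)"
  have "side u v X = side u v p - t * (side u v p - side u v q)"
    unfolding X_def side_affine by (simp add: algebra_simps)
  then have X0: "side u v X = 0" using d by (simp add: t_def)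
  have Xpq: "X \<in> closed_segment p q" unfolding X_def using t by (rule in_segmentI)
  have "below u X" "below X v"
    using below_segment[OF assms(1) _ Xpq] segment_below[OF _ assms(3) Xpq] assms below_trans by blast+
  then have "X \<in> closed_segment u v" using X0 by (rule side_zero_in_segment)
  then show "\<exists>X. X \<in> closed_segment u v \<and> X \<in> closed_segment p q" using Xpq by blast
qed

text \<open>With $a = v - u$, $b = q - p$, $c = v - p$, the Pluecker relation
  $[a,b]\,c + [b,c]\,a + [c,a]\,b = 0$ gives the intersection point explicitly.\<close>

lemma interlaced_segments_meet_iff:
  assumes "below u p" "below p v" "below v q"
    and nz: "side u v p \<noteq> 0" "side p q v \<noteq> 0"
  shows "(\<exists>X. X \<in> closed_segment u v \<and> X \<in> closed_segment p q) \<longleftrightarrow> (side u v p < 0 \<longleftrightarrow> side p q v < 0)"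
proof -
  define a b c where "a = v - u" and "b = q - p" and "c = v - p"
  define D where "D = Im (cnj b * a)"
  let ?\<alpha> = "side u v p" and ?\<beta> = "side p q v"
  have p: "p = v - c" and u: "u = v - a" and q: "q = v - c + b" by (simp_all add: a_def b_def c_def)
  have al: "?\<alpha> = Im (cnj c * a)" by (simp add: side_def p u algebra_simps)
  have be: "?\<beta> = Im (cnj b * c)" by (simp add: side_def p q algebra_simps)
  have plucker: "of_real D * c = of_real ?\<beta> * a + of_real ?\<alpha> * b"
    unfolding al be D_def by (simp add: complex_eq_iff algebra_simps)
  show ?thesis
  proof
    assume "\<exists>X. X \<in> closed_segment u v \<and> X \<in> closed_segment p q"
    then obtain s t where st: "0 \<le> s" "s \<le> 1" "0 \<le> t" "t \<le> 1"
      and "u + of_real s * (v - u) = p + of_real t * (q - p)"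
      by (metis in_segmentE)
    then have c: "c = of_real (1 - s) * a + of_real t * b"
      by (simp add: a_def b_def c_def algebra_simps)
    have "?\<alpha> = t * D" "?\<beta> = (1 - s) * D"
      unfolding al be D_def c by (simp_all add: algebra_simps)
    then show "?\<alpha> < 0 \<longleftrightarrow> ?\<beta> < 0"
      using nz st by (auto simp: mult_less_0_iff)
  next
    assume same: "?\<alpha> < 0 \<longleftrightarrow> ?\<beta> < 0"
    have pc: "pos c" "pos (a - c)" "pos (b - c)"
      using assms by (auto simp: a_def b_def c_def below_def)
    \<comment> \<open>Here \<open>a - c = p - u\<close> and \<open>b - c = q - v\<close> point
      upwards, so the relation, with \<open>D * c\<close> on its left, forces \<open>D\<close>
      beyond \<open>?\<alpha> + ?\<beta>\<close>. The factor \<open>k\<close>, taken as 1 or -1,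
      treats both common signs at once; the bound places both segment parameters in
      \<open>[0, 1]\<close>.\<close>
    have key: "0 < k * D - k * ?\<alpha> - k * ?\<beta>" if k: "0 < k * ?\<alpha>" "0 < k * ?\<beta>" for k
    proof (rule pos_scaleD[OF pc(1)])
      have "of_real (k * D - k * ?\<alpha> - k * ?\<beta>) * c = of_real (k * ?\<beta>) * (a - c) + of_real (k * ?\<alpha>) * (b - c)"
        using arg_cong[OF plucker, of "\<lambda>z. of_real k * z"] by (simp add: algebra_simps)
      then show "pos (of_real (k * D - k * ?\<alpha> - k * ?\<beta>) * c)"
        using pos_add[OF pos_scale[OF pc(2) k(2)] pos_scale[OF pc(3) k(1)]] by simp
    qed
    have "0 < ?\<alpha> \<and> 0 < ?\<beta> \<and> ?\<alpha> + ?\<beta> < D \<or> ?\<alpha> < 0 \<and> ?\<beta> < 0 \<and> D < ?\<alpha> + ?\<beta>"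
      using key[of 1] key[of "-1"] same nz by auto
    then have D: "D \<noteq> 0" "0 \<le> ?\<alpha> / D" "?\<alpha> / D \<le> 1" "0 \<le> 1 - ?\<beta> / D" "1 - ?\<beta> / D \<le> 1"
      by (auto simp: divide_simps)
    have "of_real D * (p + of_real (?\<alpha> / D) * (q - p)) = of_real D * (u + of_real (1 - ?\<beta> / D) * (v - u))"
      using plucker D(1) by (simp add: p u q algebra_simps)
    then have "p + of_real (?\<alpha> / D) * (q - p) = u + of_real (1 - ?\<beta> / D) * (v - u)"
      using D(1) by simp
    then show "\<exists>X. X \<in> closed_segment u v \<and> X \<in> closed_segment p q"
      using in_segmentI[OF D(2,3), of p q] in_segmentI[OF D(4,5), of u v] by auto
  qed
qed

section \<open>Angles and the order of directed edges\<close>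

definition angle :: "complex \<times> complex \<Rightarrow> real" where
  "angle a = Arg (snd a - fst a)"

lemma Arg_pos: "pos z \<Longrightarrow> 0 < Arg z"
  using Arg_lt_pi[of z] Arg_eq_pi[of z] by (auto simp: pos_def)

lemma Arg_neg: "pos (- z) \<Longrightarrow> Arg z \<le> 0"
  using Arg_lt_pi[of z] Arg_eq_pi[of z] Arg_le_pi[of z] by (force simp: pos_def)

lemma sin_pos_iff:
  fixes d :: real
  assumes "\<bar>d\<bar> < pi"
  shows "0 < sin d \<longleftrightarrow> 0 < d"
  using assms sin_ge_zero[of "- d"] sin_gt_zero[of d] by (cases "0 < d") auto

text \<open>The cross product equals \<open>cmod a * cmod b * sin (Arg b - Arg a)\<close>, and the
  sine has the sign of its argument on \<open>(-pi, pi)\<close>. Two arguments may differ by more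
  than \<open>pi\<close>, so upward and downward vectors are treated separately afterwards.\<close>

lemma Arg_less_iff_cross:
  assumes "a \<noteq> 0" "b \<noteq> 0" "\<bar>Arg b - Arg a\<bar> < pi"
  shows "Arg a < Arg b \<longleftrightarrow> 0 < Im (cnj a * b)"
proof -
  let ?d = "Arg b - Arg a"
  have "cnj a * b = of_real (cmod a * cmod b) * cis ?d"
  proof -
    have a: "a = rcis (cmod a) (Arg a)" and b: "b = rcis (cmod b) (Arg b)" by (simp_all add: rcis_cmod_Arg)
    have "cnj a * b = cnj (rcis (cmod a) (Arg a)) * rcis (cmod b) (Arg b)" using a b by simp
    also have "\<dots> = of_real (cmod a * cmod b) * (cis (- Arg a) * cis (Arg b))"
      by (simp add: rcis_def cis_cnj)
    finally show ?thesis by (simp add: cis_mult)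
  qed
  then have im: "Im (cnj a * b) = cmod a * cmod b * sin ?d" by simp
  have "0 < cmod a * cmod b" using assms by simp
  then have "0 < Im (cnj a * b) \<longleftrightarrow> 0 < sin ?d"
    unfolding im using mult_less_cancel_left_pos[of "cmod a * cmod b" 0 "sin ?d"] by simp
  then show ?thesis using sin_pos_iff[OF assms(3)] by simp
qed

lemma Arg_less_iff_pos:
  assumes "pos a" "pos b"
  shows "Arg a < Arg b \<longleftrightarrow> 0 < Im (cnj a * b)"
  using Arg_pos[OF assms(1)] Arg_pos[OF assms(2)] Arg_le_pi[of a] Arg_le_pi[of b] assms
  by (intro Arg_less_iff_cross) (auto simp: pos_def)

lemma Arg_less_iff_neg:
  assumes "pos (- a)" "pos (- b)"
  shows "Arg a < Arg b \<longleftrightarrow> 0 < Im (cnj a * b)"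
  using Arg_neg[OF assms(1)] Arg_neg[OF assms(2)] mpi_less_Arg[of a] mpi_less_Arg[of b] assms
  by (intro Arg_less_iff_cross) (auto simp: pos_def)

text \<open>The branch cut of \<open>Arg\<close> matches the tie-breaking in \<open>pos\<close>:
  among edges with a common tail, those leading down precede those leading up.\<close>

definition dirless :: "complex \<times> complex \<Rightarrow> complex \<times> complex \<Rightarrow> bool" where
  "dirless a b \<longleftrightarrow> below (fst a) (fst b) \<or> (fst a = fst b \<and> angle a < angle b)"

definition dsign :: "complex \<times> complex \<Rightarrow> complex \<times> complex \<Rightarrow> complex" where
  "dsign a b = (if dirless a b then -1 else 1)"

definition dirs :: "complex set set \<Rightarrow> (complex \<times> complex) set" where
  "dirs E = {(u, v). {u, v} \<in> E}"

text \<open>The sign is $-1$ iff a horizontal ray from \<open>w\<close> to the left hits the upward edge \<open>f\<close>.\<close>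

definition rightsign :: "complex \<Rightarrow> complex \<times> complex \<Rightarrow> complex" where
  "rightsign w f = (if below (fst f) w \<and> below w (snd f) \<and> side (fst f) (snd f) w < 0 then -1 else 1)"

text \<open>An edge is viewed as the chord joining its two orientations. This is the geometric form
  of \<open>sinv\<close> on two chords, before the directed edges are enumerated.\<close>

definition chordsign :: "complex \<times> complex \<Rightarrow> complex \<times> complex \<Rightarrow> complex" where
  "chordsign e f = dsign e f * dsign e (prod.swap f) * dsign (prod.swap e) f * dsign (prod.swap e) (prod.swap f)"

locale plane_graph =
  fixes V :: "complex set" and E :: "complex set set"
  assumes finV: "finite V" and simple: "simple_edges V E" and nov: "no_vertex_on_edge V E"
begin

lemma dirsD:
  assumes "(u, v) \<in> dirs E"
  shows "u \<in> V" "v \<in> V" "u \<noteq> v" "{u, v} \<in> E" "(v, u) \<in> dirs E"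
proof -
  show e: "{u, v} \<in> E" using assms by (simp add: dirs_def)
  then show "(v, u) \<in> dirs E" by (simp add: dirs_def insert_commute)
  obtain a b where "{u, v} = {a, b}" "a \<in> V" "b \<in> V" "a \<noteq> b"
    using e simple unfolding simple_edges_def by blast
  then show "u \<in> V" "v \<in> V" "u \<noteq> v" by (auto simp: doubleton_eq_iff)
qed

lemma not_on_segment:
  assumes "(u, v) \<in> dirs E" "w \<in> V" "w \<noteq> u" "w \<noteq> v"
  shows "w \<notin> closed_segment u v"
  using assms nov dirsD(4)[OF assms(1)] by (auto simp: no_vertex_on_edge_def segment_convex_hull)

text \<open>Otherwise the nearer of the two end points would be a vertex lying on the longer edge.
  Hence edges leaving one vertex have distinct angles, which is what makes \<open>dirless\<close>
  total on the graph.\<close>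

lemma same_direction:
  assumes "(c, v) \<in> dirs E" "(c, q) \<in> dirs E" "v - c = of_real k * (q - c)" "0 < k"
  shows "v = q"
proof (rule ccontr)
  assume ne: "v \<noteq> q"
  show False
  proof (cases "k \<le> 1")
    case True
    have "v = c + of_real k * (q - c)" using assms(3) by (simp add: algebra_simps)
    then have "v \<in> closed_segment c q" using in_segmentI[of k c q] True assms(4) by simp
    then show False using not_on_segment[OF assms(2), of v] dirsD[OF assms(1)] ne by auto
  next
    case False
    have "of_real (1 / k) * (v - c) = of_real (1 / k) * of_real k * (q - c)"
      using assms(3) by (simp only: mult.assoc)
    then have "q = c + of_real (1 / k) * (v - c)" using assms(4) by (simp add: algebra_simps)
    then have "q \<in> closed_segment c v" using in_segmentI[of "1 / k" c v] False by simp
    then show False using not_on_segment[OF assms(1), of q] dirsD[OF assms(2)] ne by auto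
  qed
qed

lemma angle_inj:
  assumes "(c, v) \<in> dirs E" "(c, q) \<in> dirs E" "angle (c, v) = angle (c, q)"
  shows "v = q"
proof -
  have nz: "v - c \<noteq> 0" "q - c \<noteq> 0" using dirsD[OF assms(1)] dirsD[OF assms(2)] by auto
  have v: "v - c = of_real (cmod (v - c)) * cis (Arg (v - c))"
    and q: "q - c = of_real (cmod (q - c)) * cis (Arg (v - c))"
    using assms(3) rcis_cmod_Arg[of "v - c"] rcis_cmod_Arg[of "q - c"] by (simp_all add: rcis_def angle_def)
  let ?k = "cmod (v - c) / cmod (q - c)"
  have "of_real ?k * (q - c) = of_real (?k * cmod (q - c)) * cis (Arg (v - c))"
    by (subst q) (simp only: of_real_mult mult.assoc)
  also have "?k * cmod (q - c) = cmod (v - c)" using nz by simp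
  finally have "v - c = of_real ?k * (q - c)" using v by simp
  moreover have "0 < ?k" using nz by simp
  ultimately show ?thesis using same_direction[OF assms(1,2)] by blast
qed

lemma dirless_total:
  assumes "a \<in> dirs E" "b \<in> dirs E" "a \<noteq> b"
  shows "dirless a b \<longleftrightarrow> \<not> dirless b a"
proof (cases "fst a = fst b")
  case True
  then have "angle a \<noteq> angle b"
    using angle_inj[of "fst a" "snd a" "snd b"] assms by (metis prod.collapse)
  then show ?thesis using True by (auto simp: dirless_def)
next
  case False
  then show ?thesis
    using below_total[OF False] below_asym[of "fst a" "fst b"] below_asym[of "fst b" "fst a"]
    by (auto simp: dirless_def)
qed

lemma dsign_swap: "a \<in> dirs E \<Longrightarrow> b \<in> dirs E \<Longrightarrow> a \<noteq> b \<Longrightarrow> dsign b a = - dsign a b"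
  using dirless_total[of a b] by (auto simp: dsign_def)

lemma chordsign_commute:
  assumes "(u, v) \<in> dirs E" "(p, q) \<in> dirs E" "{u, v} \<noteq> {p, q}"
  shows "chordsign (p, q) (u, v) = chordsign (u, v) (p, q)"
proof -
  have ne: "(u, v) \<noteq> (p, q)" "(u, v) \<noteq> (q, p)" "(v, u) \<noteq> (p, q)" "(v, u) \<noteq> (q, p)"
    using assms(3) by auto
  show ?thesis
    using dsign_swap[OF assms(1,2) ne(1)] dsign_swap[OF assms(1) dirsD(5)[OF assms(2)] ne(2)]
      dsign_swap[OF dirsD(5)[OF assms(1)] assms(2) ne(3)] dsign_swap[OF dirsD(5)[OF assms(1)] dirsD(5)[OF assms(2)] ne(4)]
    by (simp add: chordsign_def mult_ac)
qed

lemma crosses_commute: "crosses V e f = crosses V f e"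
  by (auto simp: crosses_def)

lemma not_crosses_shared:
  assumes "(c, v) \<in> dirs E" "(c, q) \<in> dirs E"
  shows "\<not> crosses V {c, v} {c, q}"
proof
  assume cr: "crosses V {c, v} {c, q}"
  then obtain X where X: "X \<in> closed_segment c v" "X \<in> closed_segment c q" "X \<notin> V" and ne: "v \<noteq> q"
    by (auto simp: crosses_def segment_convex_hull)
  obtain s where s: "0 \<le> s" "X = c + of_real s * (v - c)" using X(1) by (rule in_segmentE)
  obtain t where t: "0 \<le> t" "X = c + of_real t * (q - c)" using X(2) by (rule in_segmentE)
  have "s \<noteq> 0" "t \<noteq> 0" using s t X(3) dirsD[OF assms(1)] by auto
  then have st: "0 < s" "0 < t" using s t by auto
  have "of_real s * (v - c) = of_real t * (q - c)" using s(2) t(2) by simp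
  then have "v - c = of_real (t / s) * (q - c)" using st by (simp add: field_simps)
  then show False using same_direction[OF assms _ divide_pos_pos[OF st(2,1)]] ne by blast
qed

lemma crosses_iff_meet:
  assumes "(u, v) \<in> dirs E" "(p, q) \<in> dirs E" "{u, v} \<inter> {p, q} = {}"
  shows "crosses V {u, v} {p, q} \<longleftrightarrow> (\<exists>X. X \<in> closed_segment u v \<and> X \<in> closed_segment p q)"
proof -
  have "{u, v} \<noteq> {p, q}" using assms(3) by auto
  moreover have "X \<notin> V" if "X \<in> closed_segment u v" "X \<in> closed_segment p q" for X
    using not_on_segment[OF assms(1), of X] not_on_segment[OF assms(2), of X] that assms(3) by auto
  ultimately show ?thesis by (auto simp: crosses_def segment_convex_hull)
qed

lemma side_nonzero:
  assumes "(p, q) \<in> dirs E" "w \<in> V" "below p w" "below w q"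
  shows "side p q w \<noteq> 0"
  using side_zero_in_segment[of p w q] not_on_segment[OF assms(1,2)] assms(3,4) by (metis below_irrefl)

text \<open>Six relative positions in the height order. Separated edges and edges with a common end
  do not cross; for a common lower or upper end, the angle order reproduces the side test. If one
  edge spans the heights of the other, the chords are nested and crossing means that
  \<open>p\<close> and \<open>q\<close> lie on different sides. If the heights alternate, the chords
  interlace and crossing means that the two side tests agree.\<close>

lemma chord_crossing_parity_aux:
  assumes e: "(u, v) \<in> dirs E" and f: "(p, q) \<in> dirs E" and ne: "{u, v} \<noteq> {p, q}"
    and uv: "below u v" and pq: "below p q"
    and wlog: "below u p \<or> u = p \<and> below v q"
  shows "chordsign (u, v) (p, q) * (if crosses V {u, v} {p, q} then -1 else 1) =
    rightsign u (p, q) * rightsign v (p, q) * rightsign p (u, v) * rightsign q (u, v)"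
proof -
  note asym = below_asym[OF uv] below_asym[OF pq]
  have uq: "below u q" using wlog pq below_trans by blast
  note V = dirsD[OF e] dirsD[OF f]
  consider (same) "u = p" "below v q" | (below) "below u p" "below v p" | (touch) "below u p" "v = p"
    | (top) "below u p" "below p v" "v = q" | (nested) "below u p" "below q v" | (inter) "below u p" "below p v" "below v q"
    using wlog below_total by metis
  then show ?thesis
  proof cases
    case same
    have "dsign (u, v) (p, q) = (if 0 < Im (cnj (v - u) * (q - u)) then -1 else 1)"
      using same uv pq by (simp add: dsign_def dirless_def angle_def below_def Arg_less_iff_pos)
    moreover have "side u q v = - Im (cnj (v - u) * (q - u))" by (simp add: side_def algebra_simps)
    moreover have "\<not> crosses V {u, v} {p, q}" using not_crosses_shared e f same by simp
    ultimately show ?thesis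
      using same uv uq below_asym[OF same(2)] asym pq below_asym[OF uq]
      by (auto simp: chordsign_def rightsign_def dsign_def dirless_def)
  next
    case below
    have "\<not> (\<exists>X. X \<in> closed_segment u v \<and> X \<in> closed_segment p q)"
    proof
      assume "\<exists>X. X \<in> closed_segment u v \<and> X \<in> closed_segment p q"
      then obtain X where X: "X \<in> closed_segment u v" "X \<in> closed_segment p q" by blast
      have "below X p" using segment_below[OF below(1,2) X(1)] .
      moreover have "below v X" using below_segment[OF below(2) _ X(2)] below(2) pq below_trans by blast
      moreover have "below X p" using segment_below[OF below(1,2) X(1)] .
      moreover have "X = p \<or> below p X"
      proof -
        obtain t where t: "0 \<le> t" "X = p + of_real t * (q - p)" using X(2) by (rule in_segmentE)
        then show ?thesis using pq pos_scale[of "q - p" t] by (cases "t = 0") (auto simp: below_def)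
      qed
      ultimately show False using below_asym by auto
    qed
    moreover have "{u, v} \<inter> {p, q} = {}" using below uv pq uq below_trans[OF below(2) pq] by auto
    ultimately have "\<not> crosses V {u, v} {p, q}" using crosses_iff_meet[OF e f] by simp
    moreover have vq: "below v q" using below pq below_trans by blast
    ultimately show ?thesis
      using below uv pq uq asym below_asym[OF below(1)] below_asym[OF below(2)] below_asym[OF uq] below_asym[OF vq]
      by (simp add: chordsign_def rightsign_def dsign_def dirless_def)
  next
    case touch
    have "\<not> crosses V {v, u} {v, q}" using not_crosses_shared[of v u q] V f touch by simp
    then have "\<not> crosses V {u, v} {p, q}" using touch by (simp add: insert_commute)
    moreover have "angle (v, u) < angle (v, q)"
      using Arg_pos[of "q - v"] Arg_neg[of "u - v"] pq uv touch by (simp add: below_def angle_def)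
    ultimately show ?thesis
      using touch uv pq uq asym below_asym[OF uq]
      by (simp add: chordsign_def rightsign_def dsign_def dirless_def)
  next
    case top
    have "\<not> crosses V {v, u} {v, p}" using not_crosses_shared[of v u p] V top by simp
    then have "\<not> crosses V {u, v} {p, q}" using top by (simp add: insert_commute)
    moreover have "dsign (v, u) (v, p) = (if 0 < Im (cnj (u - v) * (p - v)) then -1 else 1)"
      using top uv pq by (simp add: dsign_def dirless_def angle_def below_def Arg_less_iff_neg)
    moreover have "side u v p = - Im (cnj (u - v) * (p - v))" by (simp add: side_def algebra_simps)
    ultimately show ?thesis
      using top uv pq uq asym below_asym[OF uq] below_asym[OF top(1)] below_asym[OF top(2)]
      by (auto simp: chordsign_def rightsign_def dsign_def dirless_def)
  next
    case nested
    have pv: "below p v" using nested pq below_trans by blast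
    have disj: "{u, v} \<inter> {p, q} = {}" using nested uv pq uq pv by auto
    have nz: "side u v p \<noteq> 0" "side u v q \<noteq> 0"
      using side_nonzero[OF e] V nested pv uq by auto
    show ?thesis
      using nested uv pq uq asym below_asym[OF uq] below_asym[OF nested(1)] below_asym[OF nested(2)] pv below_asym[OF pv] nz disj
      by (auto simp: chordsign_def rightsign_def dsign_def dirless_def crosses_iff_meet[OF e f disj]
          nested_segments_meet_iff[OF nested(1) pq nested(2) nz])
  next
    case inter
    have disj: "{u, v} \<inter> {p, q} = {}" using inter uv pq uq by auto
    have nz: "side u v p \<noteq> 0" "side p q v \<noteq> 0"
      using side_nonzero[OF e] side_nonzero[OF f] V inter by auto
    show ?thesis
      using inter uv pq uq asym below_asym[OF uq] below_asym[OF inter(1)] below_asym[OF inter(2)] below_asym[OF inter(3)] nz disj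
      by (auto simp: chordsign_def rightsign_def dsign_def dirless_def crosses_iff_meet[OF e f disj]
          interlaced_segments_meet_iff[OF inter nz])
  qed
qed

text \<open>Every factor on the right depends on one end point of one edge and on the other edge. In the
  product over all pairs of edges of an even set each factor therefore occurs an even number of times.\<close>

lemma chord_crossing_parity:
  assumes e: "(u, v) \<in> dirs E" and f: "(p, q) \<in> dirs E" and ne: "{u, v} \<noteq> {p, q}"
    and uv: "below u v" and pq: "below p q"
  shows "chordsign (u, v) (p, q) * (if crosses V {u, v} {p, q} then -1 else 1) =
    rightsign u (p, q) * rightsign v (p, q) * rightsign p (u, v) * rightsign q (u, v)"
proof (cases "below u p \<or> u = p \<and> below v q")
  case True
  then show ?thesis using assms chord_crossing_parity_aux by blast
next
  case False
  then have "below p u \<or> p = u \<and> below q v" using ne below_total by metis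
  then show ?thesis
    using chord_crossing_parity_aux[OF f e ne[symmetric] pq uv] chordsign_commute[OF e f ne]
      crosses_commute[of "{u, v}" "{p, q}"] by (simp add: mult_ac)
qed

end

section \<open>Crossing parity of even sets\<close>

lemma sg_swap: "i \<noteq> j \<Longrightarrow> sg j i = - sg i j"
  by (auto simp: sg_def)

text \<open>Pairs of chords inside \<open>U\<close> or inside \<open>W\<close> give the first two
  factors. Mixed pairs can be listed with the chord of \<open>U\<close> first, because exchanging
  the chords flips four signs; their comparisons then exhaust the product of \<open>U\<close> and
  \<open>W\<close>.\<close>

lemma sgl_union:
  assumes fin: "finite U" "finite W" and disj: "U \<inter> W = {}"
    and U: "\<And>i. i \<in> U \<Longrightarrow> r i \<in> U \<and> r (r i) = i \<and> r i \<noteq> i"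
    and W: "\<And>i. i \<in> W \<Longrightarrow> r i \<in> W \<and> r (r i) = i \<and> r i \<noteq> i"
  shows "sgl r (U \<union> W) = sgl r U * sgl r W * sinv U W"
proof -
  let ?P = "\<lambda>A B. {(c,d). c \<in> A \<and> d \<in> B \<and> c < r c \<and> d < r d \<and> c < d}"
  let ?g = "\<lambda>(c,d). sinv {c, r c} {d, r d}"
  let ?LU = "{c\<in>U. c < r c}" and ?LW = "{d\<in>W. d < r d}"
  have finP: "finite (?P A B)" if "finite A" "finite B" for A B
    by (rule finite_subset[of _ "A \<times> B"]) (use that in auto)
  have "?P (U \<union> W) (U \<union> W) = ?P U U \<union> ?P W W \<union> (?P U W \<union> ?P W U)" by auto
  then have "sgl r (U \<union> W) = (\<Prod>p\<in>?P U U \<union> ?P W W \<union> (?P U W \<union> ?P W U). ?g p)"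
    by (simp only: sgl_def)
  also have "\<dots> = sgl r U * sgl r W * ((\<Prod>p\<in>?P U W. ?g p) * (\<Prod>p\<in>?P W U. ?g p))"
  proof -
    have "(\<Prod>p\<in>?P U U \<union> ?P W W \<union> (?P U W \<union> ?P W U). ?g p) = (\<Prod>p\<in>?P U U \<union> ?P W W. ?g p) * (\<Prod>p\<in>?P U W \<union> ?P W U. ?g p)"
      using fin disj by (intro prod.union_disjoint finite_UnI finP) auto
    moreover have "(\<Prod>p\<in>?P U U \<union> ?P W W. ?g p) = (\<Prod>p\<in>?P U U. ?g p) * (\<Prod>p\<in>?P W W. ?g p)"
      using fin disj by (intro prod.union_disjoint finite_UnI finP) auto
    moreover have "(\<Prod>p\<in>?P U W \<union> ?P W U. ?g p) = (\<Prod>p\<in>?P U W. ?g p) * (\<Prod>p\<in>?P W U. ?g p)"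
      using fin disj by (intro prod.union_disjoint finite_UnI finP) auto
    ultimately show ?thesis by (simp only: sgl_def)
  qed
  also have "(\<Prod>p\<in>?P W U. ?g p) = (\<Prod>p\<in>{(c,d). c \<in> U \<and> d \<in> W \<and> c < r c \<and> d < r d \<and> d < c}. ?g p)"
  proof (rule prod.reindex_bij_witness[of _ prod.swap prod.swap])
    fix p assume "p \<in> ?P W U"
    then obtain c d where p: "p = (d, c)" and cd: "c \<in> U" "d \<in> W" by auto
    have m: "r c \<in> U" "r d \<in> W" "r c \<noteq> c" "r d \<noteq> d" using U[OF cd(1)] W[OF cd(2)] by blast+
    have ne: "c \<noteq> d" "c \<noteq> r d" "r c \<noteq> d" "r c \<noteq> r d" using cd m disj by (metis disjoint_iff)+
    show "?g (prod.swap p) = ?g p"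
      using ne m by (simp add: p sinv_def sg_swap[of d c] sg_swap[of d "r c"] sg_swap[of "r d" c] sg_swap[of "r d" "r c"])
  qed auto
  also have "(\<Prod>p\<in>?P U W. ?g p) * \<dots> = (\<Prod>p\<in>?LU \<times> ?LW. ?g p)"
  proof -
    let ?Q = "{(c,d). c \<in> U \<and> d \<in> W \<and> c < r c \<and> d < r d \<and> d < c}"
    have eq: "?LU \<times> ?LW = ?P U W \<union> ?Q" using disj by (auto simp: neq_iff)
    have fQ: "finite ?Q" by (rule finite_subset[of _ "U \<times> W"]) (use fin in auto)
    have "?P U W \<inter> ?Q = {}" by auto
    then show ?thesis unfolding eq by (rule prod.union_disjoint[OF finP[OF fin] fQ, symmetric])
  qed
  also have "\<dots> = (\<Prod>c\<in>?LU. \<Prod>d\<in>?LW. ?g (c, d))"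
    by (simp add: prod.cartesian_product)
  also have "\<dots> = (\<Prod>c\<in>?LU. (\<Prod>j\<in>W. sg c j) * (\<Prod>j\<in>W. sg (r c) j))"
  proof (rule prod.cong[OF refl])
    fix c assume c: "c \<in> ?LU"
    have "(\<Prod>d\<in>?LW. ?g (c, d)) = (\<Prod>d\<in>?LW. (sg c d * sg c (r d)) * (sg (r c) d * sg (r c) (r d)))"
      by (rule prod.cong[OF refl]) (use c in \<open>auto simp: sinv_def\<close>)
    also have "\<dots> = (\<Prod>d\<in>?LW. sg c d * sg c (r d)) * (\<Prod>d\<in>?LW. sg (r c) d * sg (r c) (r d))"
      by (rule prod.distrib)
    also have "\<dots> = (\<Prod>j\<in>W. sg c j) * (\<Prod>j\<in>W. sg (r c) j)"
      using prod_pairing[OF fin(2), of r "sg c"] prod_pairing[OF fin(2), of r "sg (r c)"] W by simp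
    finally show "(\<Prod>d\<in>?LW. ?g (c, d)) = (\<Prod>j\<in>W. sg c j) * (\<Prod>j\<in>W. sg (r c) j)" .
  qed
  also have "\<dots> = sinv U W"
    unfolding sinv_def by (rule prod_pairing[symmetric]) (use fin U in auto)
  finally show ?thesis .
qed

lemma sinv_square: "sinv U W * sinv U W = 1"
  by (simp add: sinv_def prod.distrib[symmetric])

lemma sgl_square: "sgl r S * sgl r S = 1"
  by (simp add: sgl_def prod.distrib[symmetric] case_prod_unfold sinv_square)

text \<open>The order properties are asked for on \<open>S\<close> alone because
  \<open>dirless\<close> is total only on the directed edges of the graph. The new element is
  inserted between the entries related to it and the others.\<close>

lemma ex_sorted_wrt_list:
  assumes "finite S"
    and tr: "\<And>a b c. a \<in> S \<Longrightarrow> b \<in> S \<Longrightarrow> c \<in> S \<Longrightarrow> R a b \<Longrightarrow> R b c \<Longrightarrow> R a c"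
    and tot: "\<And>a b. a \<in> S \<Longrightarrow> b \<in> S \<Longrightarrow> a \<noteq> b \<Longrightarrow> R a b \<or> R b a"
  shows "\<exists>L. distinct L \<and> set L = S \<and> sorted_wrt R L"
  using assms
proof (induction S rule: finite_induct)
  case (insert x S)
  have "\<exists>L. distinct L \<and> set L = S \<and> sorted_wrt R L"
  proof (rule insert.IH)
    show "R a c" if "a \<in> S" "b \<in> S" "c \<in> S" "R a b" "R b c" for a b c
      using insert.prems(1)[of a b c] that by simp
    show "R a b \<or> R b a" if "a \<in> S" "b \<in> S" "a \<noteq> b" for a b
      using insert.prems(2)[of a b] that by simp
  qed
  then obtain L where L: "distinct L" "set L = S" "sorted_wrt R L" by blast
  let ?l = "filter (\<lambda>y. R y x) L" and ?u = "filter (\<lambda>y. \<not> R y x) L"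
  have x: "x \<notin> set L" using L(2) insert.hyps by simp
  have h1: "R x y" if "y \<in> set ?u" for y
    using that insert.prems(2)[of x y] L(2) x by (cases "x = y") auto
  have h2: "R y z" if "y \<in> set ?l" "z \<in> set ?u" for y z
    using that insert.prems(1)[of y x z] h1[of z] L(2) by simp
  have h3: "R y z" if "y \<in> set ?l" "z \<in> set (x # ?u)" for y z
    using that h2[of y z] by (cases "z = x") auto
  have "sorted_wrt R ?l" "sorted_wrt R ?u" using L(3) by (rule sorted_wrt_filter)+
  then have "sorted_wrt R (?l @ x # ?u)"
    unfolding sorted_wrt_append sorted_wrt.simps by (intro conjI ballI h1 h3)
  moreover have "distinct (?l @ x # ?u)" "set (?l @ x # ?u) = insert x S"
    using L x by auto
  ultimately show ?case by blast
qed simp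

context plane_graph
begin

lemma finite_E: "finite E"
  using simple finV unfolding simple_edges_def
  by (rule_tac finite_subset[of _ "(\<lambda>(u,v). {u,v}) ` (V \<times> V)"]) auto

lemma finite_dirs: "finite (dirs E)"
  by (rule finite_subset[of _ "V \<times> V"]) (use finV dirsD in auto)

lemma dirless_trans: "dirless a b \<Longrightarrow> dirless b c \<Longrightarrow> dirless a c"
  using below_trans[of "fst a" "fst b" "fst c"] by (auto simp: dirless_def)

lemma dirless_irrefl: "\<not> dirless a a"
  by (simp add: dirless_def)

lemma ex_sorted_dirs: "\<exists>L. distinct L \<and> set L = dirs E \<and> sorted_wrt dirless L"
  by (rule ex_sorted_wrt_list[OF finite_dirs]) (use dirless_trans dirless_total in blast)+

end

section \<open>Indices of directed edges and the parity of crossings\<close>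

locale sorted_plane_graph = plane_graph +
  fixes L :: "(complex \<times> complex) list"
  assumes distL: "distinct L" and setL: "set L = dirs E" and sortL: "sorted_wrt dirless L"
begin

abbreviation "n \<equiv> length L"

definition ix :: "complex \<times> complex \<Rightarrow> nat" where
  "ix a = (THE i. i < n \<and> L ! i = a)"

lemma ix_nth [simp]: "i < n \<Longrightarrow> ix (L ! i) = i"
  unfolding ix_def by (rule the_equality) (use distL nth_eq_iff_index_eq in auto)

lemma nth_ix: "a \<in> dirs E \<Longrightarrow> L ! ix a = a" and ix_less: "a \<in> dirs E \<Longrightarrow> ix a < n"
  by (metis setL in_set_conv_nth ix_nth)+

text \<open>The matching whose chords are the edges of the graph: each orientation is paired with
  the reverse one. The smaller index of a pair belongs to the upward orientation.\<close>

definition r :: "nat \<Rightarrow> nat" where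
  "r i = ix (prod.swap (L ! i))"

definition ed :: "nat \<Rightarrow> complex set" where
  "ed i = {fst (L ! i), snd (L ! i)}"

lemma nth_dirs: "i < n \<Longrightarrow> L ! i \<in> dirs E"
  using setL nth_mem by blast

lemma swap_dirs: "a \<in> dirs E \<Longrightarrow> prod.swap a \<in> dirs E"
  using dirsD(5) by (cases a) auto

lemma nth_neq: "i < n \<Longrightarrow> fst (L ! i) \<noteq> snd (L ! i)"
  using nth_dirs dirsD(3) by (metis prod.collapse)

lemma nth_r: "i < n \<Longrightarrow> L ! r i = prod.swap (L ! i)" and r_less: "i < n \<Longrightarrow> r i < n"
  unfolding r_def using nth_dirs swap_dirs nth_ix ix_less by blast+

lemma r_r: "i < n \<Longrightarrow> r (r i) = i"
  by (simp add: r_def[of "r i"] nth_r)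

lemma r_neq: "i < n \<Longrightarrow> r i \<noteq> i"
  using nth_r[of i] dirsD(3)[of "fst (L ! i)" "snd (L ! i)"] nth_dirs[of i] by (metis fst_swap prod.collapse)

lemma ed_r: "i < n \<Longrightarrow> ed (r i) = ed i"
  by (simp add: ed_def nth_r insert_commute)

lemma ed_in: "i < n \<Longrightarrow> ed i \<in> E"
  using dirsD(4)[of "fst (L ! i)" "snd (L ! i)"] nth_dirs[of i] by (simp add: ed_def)

lemma ed_eq_iff: "i < n \<Longrightarrow> j < n \<Longrightarrow> ed i = ed j \<longleftrightarrow> j = i \<or> j = r i"
proof
  assume ij: "i < n" "j < n" and "ed i = ed j"
  then have "L ! j = L ! i \<or> L ! j = L ! r i"
    by (auto simp: ed_def nth_r doubleton_eq_iff prod_eq_iff)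
  then show "j = i \<or> j = r i" using ij r_less distL by (metis nth_eq_iff_index_eq)
qed (auto simp: ed_r)

lemma ed_surj: assumes "e \<in> E" obtains i where "i < n" "ed i = e" "i < r i"
proof -
  obtain u v where e: "e = {u, v}" using assms simple by (auto simp: simple_edges_def)
  then have uv: "(u, v) \<in> dirs E" using assms by (simp add: dirs_def)
  define i where "i = ix (u, v)"
  have i: "i < n" "L ! i = (u, v)" using ix_less[OF uv] nth_ix[OF uv] by (simp_all add: i_def)
  then have "ed i = e" "ed (r i) = e" by (simp_all add: ed_r) (simp_all add: ed_def e)
  then show ?thesis using that[of i] that[of "r i"] i r_less r_r r_neq by (metis linorder_neqE_nat)
qed

lemma less_iff_dirless: "i < n \<Longrightarrow> j < n \<Longrightarrow> i < j \<longleftrightarrow> dirless (L ! i) (L ! j)"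
  using sortL dirless_irrefl dirless_trans by (metis linorder_neqE_nat sorted_wrt_iff_nth_less)

lemma sg_eq_dsign: "i < n \<Longrightarrow> j < n \<Longrightarrow> sg i j = dsign (L ! i) (L ! j)"
  by (simp add: sg_def dsign_def less_iff_dirless)

lemma lower_below: "i < n \<Longrightarrow> i < r i \<Longrightarrow> below (fst (L ! i)) (snd (L ! i))"
  using less_iff_dirless[of i "r i"] r_less nth_r dirsD(3)[of "fst (L ! i)" "snd (L ! i)"] nth_dirs[of i]
  by (auto simp: dirless_def)

lemma sinv_eq_chordsign:
  assumes "c < n" "d < n"
  shows "sinv {c, r c} {d, r d} = chordsign (L ! c) (L ! d)"
  using assms r_neq[of c] r_neq[of d] r_less
  by (simp add: sinv_def chordsign_def sg_eq_dsign nth_r mult.assoc)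

definition terminals :: "complex set set \<Rightarrow> nat set" where
  "terminals F = {i. i < n \<and> ed i \<in> F}"

lemma T_finite [simp]: "finite (terminals F)"
  by (simp add: terminals_def)

lemma T_closed: "i \<in> terminals F \<Longrightarrow> r i \<in> terminals F \<and> r (r i) = i \<and> r i \<noteq> i"
  by (simp add: terminals_def ed_r r_less r_r r_neq)

lemma bij_lower_edges: "F \<subseteq> E \<Longrightarrow> bij_betw ed {i\<in>terminals F. i < r i} F"
proof (rule bij_betw_imageI)
  show "inj_on ed {i\<in>terminals F. i < r i}"
    by (rule inj_onI) (auto simp: terminals_def ed_eq_iff r_r)
  show "ed ` {i\<in>terminals F. i < r i} = F" if "F \<subseteq> E"
    using that by (auto simp: terminals_def image_iff) (metis ed_surj subsetD)
qed

text \<open>Every edge at \<open>v\<close> has exactly one orientation with tail \<open>v\<close>,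
  so the block sizes in \<open>pfs_blocks\<close> are vertex degrees.\<close>

lemma degree_eq: 
  assumes "F \<subseteq> E"
  shows "card {i\<in>terminals F. fst (L ! i) = v} = card {e\<in>F. v \<in> e}"
proof (rule bij_betw_same_card[of ed], rule bij_betw_imageI)
  show "inj_on ed {i\<in>terminals F. fst (L ! i) = v}"
  proof (rule inj_onI)
    fix i j assume ij: "i \<in> {i\<in>terminals F. fst (L ! i) = v}" "j \<in> {i\<in>terminals F. fst (L ! i) = v}" "ed i = ed j"
    have "fst (L ! r i) \<noteq> fst (L ! i)"
      using ij nth_r[of i] nth_neq[of i] by (simp add: terminals_def)
    then have "j \<noteq> r i" using ij by auto
    then show "i = j" using ij ed_eq_iff[of i j] by (auto simp: terminals_def)
  qed
  have "e \<in> ed ` {i\<in>terminals F. fst (L ! i) = v}" if e: "e \<in> F" "v \<in> e" for e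
  proof -
    obtain i where i: "i < n" "ed i = e" using e assms ed_surj by (metis subsetD)
    then have "v = fst (L ! i) \<or> v = fst (L ! r i)" using e by (auto simp: ed_def nth_r)
    then show ?thesis
    proof
      assume "v = fst (L ! i)"
      then show ?thesis using i e by (intro image_eqI[of _ _ i]) (auto simp: terminals_def)
    next
      assume "v = fst (L ! r i)"
      then show ?thesis using i e ed_r[of i] r_less[of i] by (intro image_eqI[of _ _ "r i"]) (auto simp: terminals_def)
    qed
  qed
  moreover have "ed i \<in> F \<and> v \<in> ed i" if "i \<in> terminals F" "fst (L ! i) = v" for i
    using that by (auto simp: terminals_def ed_def)
  ultimately show "ed ` {i\<in>terminals F. fst (L ! i) = v} = {e\<in>F. v \<in> e}" by blast
qed

lemma even_set_iff:
  assumes "F \<subseteq> E"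
  shows "even_set V E F \<longleftrightarrow> (\<forall>v. even (card {i\<in>terminals F. fst (L ! i) = v}))"
proof -
  have "{e\<in>F. v \<in> e} = {}" if "v \<notin> V" for v
    using that assms simple unfolding simple_edges_def by fastforce
  then have "even (card {e\<in>F. v \<in> e})" if "v \<notin> V" for v using that by (metis card.empty even_zero)
  then show ?thesis using assms unfolding even_set_def degree_eq[OF assms] by blast
qed

abbreviation chords :: "complex set set \<Rightarrow> (nat \<times> nat) set" where
  "chords F \<equiv> {(c,d). c \<in> terminals F \<and> d \<in> terminals F \<and> c < r c \<and> d < r d \<and> c < d}"

lemma finite_chords: "finite (chords F)"
  by (rule finite_subset[of _ "terminals F \<times> terminals F"]) auto

lemma crossings_eq:
  assumes "F \<subseteq> E"
  shows "crossings V F = card {(c,d)\<in>chords F. crosses V (ed c) (ed d)}"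
  unfolding crossings_def
proof (rule bij_betw_same_card[symmetric, of "\<lambda>(c,d). {ed c, ed d}"], rule bij_betw_imageI)
  let ?X = "{(c,d)\<in>chords F. crosses V (ed c) (ed d)}"
  have inj: "inj_on ed {i\<in>terminals F. i < r i}" using bij_lower_edges[OF assms] by (rule bij_betw_imp_inj_on)
  show "inj_on (\<lambda>(c,d). {ed c, ed d}) ?X"
  proof (rule inj_onI, clarsimp simp: doubleton_eq_iff)
    fix c d c' d'
    assume *: "c \<in> terminals F" "d \<in> terminals F" "c < r c" "d < r d" "c < d" "c' \<in> terminals F" "d' \<in> terminals F" "c' < r c'" "d' < r d'" "c' < d'"
      and "ed c = ed c' \<and> ed d = ed d' \<or> ed c = ed d' \<and> ed d = ed c'"
    then have "c = c' \<and> d = d' \<or> c = d' \<and> d = c'"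
      using inj by (auto dest: inj_onD)
    then show "c = c' \<and> d = d'" using * by auto
  qed
  show "(\<lambda>(c,d). {ed c, ed d}) ` ?X = {{e, f} |e f. e \<in> F \<and> f \<in> F \<and> crosses V e f}"
  proof (intro equalityI subsetI)
    fix s assume "s \<in> {{e, f} |e f. e \<in> F \<and> f \<in> F \<and> crosses V e f}"
    then obtain e f where s: "s = {e, f}" "e \<in> F" "f \<in> F" "crosses V e f" by auto
    obtain c d where c: "c < n" "ed c = e" "c < r c" and d: "d < n" "ed d = f" "d < r d"
      using s assms ed_surj by (metis subsetD)
    have "c \<noteq> d" using s c d by (auto simp: crosses_def)
    then consider "c < d" | "d < c" by linarith
    then show "s \<in> (\<lambda>(c,d). {ed c, ed d}) ` ?X"
    proof cases
      case 1
      then have "(c, d) \<in> ?X" using s c d by (auto simp: terminals_def)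
      then show ?thesis using s c d by (intro image_eqI[of _ _ "(c, d)"]) auto
    next
      case 2
      then have "(d, c) \<in> ?X" using s c d crosses_commute by (auto simp: terminals_def)
      then show ?thesis using s c d by (intro image_eqI[of _ _ "(d, c)"]) auto
    qed
  qed (auto simp: terminals_def)
qed

text \<open>By \<open>chord_crossing_parity\<close>, interlacing sign times crossing sign is
  \<open>G c d * G d c\<close>. For a fixed edge \<open>d\<close>, the product over all other edges
  evaluates \<open>rightsign\<close> at each vertex as often as its degree, hence is 1.\<close>

lemma sgl_eq_crossings:
  assumes "even_set V E F"
  shows "sgl r (terminals F) = (-1) ^ crossings V F"
proof -
  have FE: "F \<subseteq> E" using assms by (simp add: even_set_def)
  let ?cs = "\<lambda>(c,d). if crosses V (ed c) (ed d) then -1 else (1::complex)"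
  let ?LF = "{i\<in>terminals F. i < r i}"
  define G where "G = (\<lambda>c d. rightsign (fst (L ! c)) (L ! d) * rightsign (fst (L ! r c)) (L ! d))"
  have "(\<Prod>p\<in>chords F. ?cs p) = (-1) ^ crossings V F"
    unfolding crossings_eq[OF FE] using finite_chords[of F]
    by (simp add: case_prod_unfold prod.If_cases Int_def)
  moreover have "sgl r (terminals F) * (\<Prod>p\<in>chords F. ?cs p) = 1"
  proof -
    have "sgl r (terminals F) * (\<Prod>p\<in>chords F. ?cs p) = (\<Prod>(c,d)\<in>chords F. sinv {c, r c} {d, r d} * ?cs (c, d))"
      by (simp add: sgl_def case_prod_unfold prod.distrib)
    also have "\<dots> = (\<Prod>(c,d)\<in>chords F. G c d * G d c)"
    proof (rule prod.cong[OF refl], clarify)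
      fix c d assume cd: "c \<in> terminals F" "d \<in> terminals F" "c < r c" "d < r d" "c < d"
      have n: "c < n" "d < n" using cd by (auto simp: terminals_def)
      obtain u v where c: "L ! c = (u, v)" by fastforce
      obtain p q where d: "L ! d = (p, q)" by fastforce
      have "ed c \<noteq> ed d" using n cd by (auto simp: ed_eq_iff r_r)
      then have ne: "{u, v} \<noteq> {p, q}" by (simp add: ed_def c d)
      have dd: "(u, v) \<in> dirs E" "(p, q) \<in> dirs E" using nth_dirs n c d by metis+
      have bb: "below u v" "below p q" using lower_below n cd c d by fastforce+
      show "sinv {c, r c} {d, r d} * (if crosses V (ed c) (ed d) then -1 else 1) = G c d * G d c"
        using chord_crossing_parity[OF dd ne bb]
        by (simp add: sinv_eq_chordsign n c d G_def nth_r ed_def mult.assoc)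
    qed
    also have "\<dots> = (\<Prod>(c,d)\<in>chords F. G c d) * (\<Prod>(c,d)\<in>chords F. G d c)"
      by (simp add: case_prod_unfold prod.distrib)
    also have "(\<Prod>(c,d)\<in>chords F. G d c) = (\<Prod>(d,c)\<in>prod.swap ` chords F. G d c)"
      by (subst prod.reindex) (auto simp: inj_on_def case_prod_unfold)
    also have "(\<Prod>(c,d)\<in>chords F. G c d) * \<dots> = (\<Prod>(c,d)\<in>chords F \<union> prod.swap ` chords F. G c d)"
      by (rule prod.union_disjoint[symmetric]) (auto simp: finite_chords)
    \<comment> \<open>Diagonal pairs may be added: the ends of an edge are not strictly between its
      ends in height, so \<open>G c c = 1\<close>.\<close>
    also have "\<dots> = (\<Prod>(c,d)\<in>?LF \<times> ?LF. G c d)"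
    proof (rule prod.mono_neutral_left)
      show "\<forall>i\<in>?LF \<times> ?LF - (chords F \<union> prod.swap ` chords F). (case i of (c, d) \<Rightarrow> G c d) = 1"
      proof
        fix p assume p: "p \<in> ?LF \<times> ?LF - (chords F \<union> prod.swap ` chords F)"
        obtain c d where cd: "p = (c, d)" by fastforce
        have "(c, d) \<notin> prod.swap ` chords F" using p cd by blast
        then have "(d, c) \<notin> chords F" using imageI[of "(d, c)" "chords F" prod.swap] by auto
        then have "c = d" using p cd by auto
        then show "(case p of (c, d) \<Rightarrow> G c d) = 1" using p cd by (simp add: G_def rightsign_def nth_r terminals_def)
      qed
    qed auto
    also have "\<dots> = (\<Prod>c\<in>?LF. \<Prod>d\<in>?LF. G c d)"
      by (simp add: prod.cartesian_product)
    also have "\<dots> = (\<Prod>d\<in>?LF. \<Prod>c\<in>?LF. G c d)"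
      by (rule prod.swap)
    also have "\<dots> = (\<Prod>d\<in>?LF. \<Prod>i\<in>terminals F. rightsign (fst (L ! i)) (L ! d))"
      unfolding G_def by (intro prod.cong refl prod_pairing[symmetric]) (auto simp: T_closed)
    also have "\<dots> = 1"
    proof (rule prod.neutral, rule ballI)
      fix d
      let ?h = "\<lambda>v. rightsign v (L ! d)"
      have "(\<Prod>i\<in>terminals F. ?h (fst (L ! i))) = (\<Prod>v\<in>(\<lambda>i. fst (L ! i)) ` terminals F. \<Prod>i\<in>{i\<in>terminals F. fst (L ! i) = v}. ?h (fst (L ! i)))"
        by (rule prod.image_gen) simp
      also have "\<dots> = (\<Prod>v\<in>(\<lambda>i. fst (L ! i)) ` terminals F. ?h v ^ card {i\<in>terminals F. fst (L ! i) = v})"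
        by (intro prod.cong refl) simp
      also have "\<dots> = 1"
        using assms unfolding even_set_iff[OF FE] by (intro prod.neutral ballI) (auto simp: rightsign_def)
      finally show "(\<Prod>i\<in>terminals F. ?h (fst (L ! i))) = 1" .
    qed
    finally show ?thesis .
  qed
  ultimately have "sgl r (terminals F) * (-1) ^ crossings V F = 1" by simp
  then show ?thesis
    by (metis minus_one_power_iff mult.commute mult_1 mult_minus1 minus_mult_minus minus_minus)
qed

end

section \<open>The Kac-Ward formula\<close>

lemma det_gram_mset:
  fixes w :: "'a \<Rightarrow> 'a \<Rightarrow> complex"
  assumes "mset xs = mset ys"
  shows "det (gram w (ps @ xs)) = det (gram w (ps @ ys))"
  using assms
proof (induction xs arbitrary: ps ys)
  case (Cons x xs)
  have mv: "det (gram w (ps @ us @ x # vs)) = det (gram w (ps @ x # us @ vs))" for us vs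
  proof (induction us arbitrary: vs rule: rev_induct)
    case (snoc u us)
    then show ?case using det_gram_swap[of w "ps @ us" u x vs] by simp
  qed simp
  have "x \<in> set ys" using Cons.prems by (metis list.set_intros(1) mset_eq_setD)
  then obtain us vs where ys: "ys = us @ x # vs" by (meson split_list)
  have "mset xs = mset (us @ vs)" using Cons.prems ys by simp
  then have "det (gram w ((ps @ [x]) @ xs)) = det (gram w ((ps @ [x]) @ us @ vs))" by (rule Cons.IH)
  then show ?case using mv[of us vs] ys by simp
qed simp

lemma det_gram_set:
  fixes w :: "'a \<Rightarrow> 'a \<Rightarrow> complex"
  assumes "distinct xs" "distinct ys" "set xs = set ys"
  shows "det (gram w xs) = det (gram w ys)"
  using det_gram_mset[of xs ys w "[]"] assms set_eq_iff_mset_eq_distinct[of xs ys] by simp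

definition one_minus :: "('a \<Rightarrow> 'a \<Rightarrow> complex) \<Rightarrow> 'a \<Rightarrow> 'a \<Rightarrow> complex" where
  "one_minus w a b = (if a = b then 1 else 0) - w a b"

text \<open>The entries of the matrix \<open>T\<close> of the overview, indexed by all directed
  edges, representative or additional. The weight is that of the edge being left.\<close>

definition step :: "(complex set \<Rightarrow> complex) \<Rightarrow> complex \<times> complex \<Rightarrow> complex \<times> complex \<Rightarrow> complex" where
  "step x a b = (if snd a = fst b \<and> fst a \<noteq> snd b
     then x {fst a, snd a} * exp (\<i> * of_real (turn (snd a - fst a) (snd b - fst b)) / 2) else 0)"

lemma det_diagonal_conjugate:
  fixes f :: "nat \<Rightarrow> nat \<Rightarrow> complex"
  assumes "\<And>i. i < n \<Longrightarrow> d i \<noteq> 0"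
  shows "det (mat n n (\<lambda>(i, j). f i j * d j / d i)) = det (mat n n (\<lambda>(i, j). f i j))"
proof -
  have "(\<Prod>i = 0..<n. f i (p i) * d (p i) / d i) = (\<Prod>i = 0..<n. f i (p i))" if p: "p permutes {0..<n}" for p
  proof -
    have "(\<Prod>i = 0..<n. d (p i)) = (\<Prod>i = 0..<n. d i)"
      using prod.permute[OF p, of d] by (simp add: comp_def)
    moreover have "(\<Prod>i = 0..<n. d i) \<noteq> 0" using assms by simp
    ultimately show ?thesis by (simp add: prod.distrib prod_dividef)
  qed
  moreover have "p i < n" if "p permutes {0..<n}" "i < n" for p i
    using that by (metis atLeastLessThan_iff permutes_in_image zero_le)
  ultimately show ?thesis
    by (subst (1 2) det_def'[where n = n]) (auto intro!: sum.cong)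
qed

text \<open>If all \<open>y i\<close> were nonzero this would be a diagonal conjugation. Comparing
  the Leibniz terms also covers zeros: a permutation maps its moved points to themselves, so
  \<open>y i\<close> and \<open>y (p i)\<close> have the same product over them, and at fixed points
  the factors coincide.\<close>

lemma det_one_minus_symmetrize:
  fixes f :: "nat \<Rightarrow> nat \<Rightarrow> complex"
  shows "det (mat n n (\<lambda>(i, j). (if i = j then 1 else 0) - y i * y i * f i j)) =
    det (mat n n (\<lambda>(i, j). (if i = j then 1 else 0) - y i * f i j * y j))"
proof -
  have "(\<Prod>i = 0..<n. (if i = p i then 1 else 0) - y i * y i * f i (p i)) =
      (\<Prod>i = 0..<n. (if i = p i then 1 else 0) - y i * f i (p i) * y (p i))" if p: "p permutes {0..<n}" for p
  proof -
    let ?M = "{i\<in>{0..<n}. p i \<noteq> i}" and ?F = "{i\<in>{0..<n}. p i = i}"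
    have split: "(\<Prod>i = 0..<n. g i) = (\<Prod>i\<in>?F. g i) * (\<Prod>i\<in>?M. g i)" for g :: "nat \<Rightarrow> complex"
      by (subst prod.union_disjoint[symmetric]) (auto intro: prod.cong)
    have "inj p" using p by (rule permutes_inj)
    have "p ` ?M \<subseteq> ?M" using permutes_in_image[OF p] \<open>inj p\<close> by (auto dest: injD)
    moreover have "inj_on p ?M" using \<open>inj p\<close> inj_on_subset by blast
    ultimately have "bij_betw p ?M ?M" by (simp add: bij_betw_def endo_inj_surj)
    then have yp: "(\<Prod>i\<in>?M. y (p i)) = (\<Prod>i\<in>?M. y i)" by (rule prod.reindex_bij_betw)
    have "(\<Prod>i\<in>?M. (if i = p i then 1 else 0) - y i * y i * f i (p i)) = (\<Prod>i\<in>?M. - f i (p i) * y i * y i)"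
      by (rule prod.cong) auto
    also have "\<dots> = (\<Prod>i\<in>?M. - f i (p i) * y i * y (p i))"
      by (simp only: prod.distrib yp)
    also have "\<dots> = (\<Prod>i\<in>?M. (if i = p i then 1 else 0) - y i * f i (p i) * y (p i))"
      by (rule prod.cong) auto
    finally show ?thesis unfolding split by (simp add: mult_ac)
  qed
  moreover have "p i < n" if "p permutes {0..<n}" "i < n" for p i
    using that by (metis atLeastLessThan_iff permutes_in_image zero_le)
  ultimately show ?thesis
    by (subst (1 2) det_def'[where n = n]) (auto intro!: sum.cong)
qed

context sorted_plane_graph
begin

text \<open>\<open>kap\<close> is 1 on upward orientations, and \<open>nu\<close> compares two edges
  with a common tail by angle. Above the diagonal both take only the values 0 and 1 required by
  \<open>pfs_pairing\<close> and \<open>pfs_blocks\<close> once \<open>kap i\<close> is restricted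
  to \<open>j = r i\<close>.\<close>

definition kap :: "nat \<Rightarrow> complex" where
  "kap i = (if i < r i then 1 else - 1)"

definition nu :: "nat \<Rightarrow> nat \<Rightarrow> complex" where
  "nu i j = (if fst (L ! i) = fst (L ! j) \<and> i \<noteq> j then if i < j then 1 else - 1 else 0)"

lemma kap_r: "i < n \<Longrightarrow> kap (r i) = - kap i"
  using r_neq[of i] by (auto simp: kap_def r_r)

lemma kap_square [simp]: "kap i * kap i = 1" "kap i * (kap i * z) = z"
  by (auto simp: kap_def)

lemma nu_skew: "nu i j = - nu j i"
  by (auto simp: nu_def)

text \<open>After conjugation by the half angles of the edge directions only signs remain of the phases
  in the transition matrix.\<close>

lemma step_gauge:
  assumes i: "i < n" and j: "j < n"
  defines "d \<equiv> \<lambda>i. exp (\<i> * of_real (angle (L ! i)) / 2)"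
  shows "step x (L ! i) (L ! j) = x (ed i) * (kap i * nu (r i) j) * d j / d i"
proof -
  obtain u v where a: "L ! i = (u, v)" by fastforce
  obtain v' z where b: "L ! j = (v', z)" by fastforce
  have c: "L ! r i = (v, u)" using nth_r[OF i] a by simp
  have uv: "u \<noteq> v" using nth_neq[OF i] a by simp
  have vz: "v' \<noteq> z" using nth_neq[OF j] b by simp
  show ?thesis
  proof (cases "v = v' \<and> u \<noteq> z")
    case False
    have "r i = j" if "v = v'"
      using False that b c nth_eq_iff_index_eq[OF distL r_less[OF i] j] by auto
    then have "nu (r i) j = 0" by (auto simp: nu_def b c)
    then show ?thesis using False by (auto simp: step_def a b)
  next
    case True
    then have v': "v' = v" and uz: "u \<noteq> z" by auto
    \<comment> \<open>The index order compares \<open>r i\<close> with \<open>j\<close>, both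
      leaving \<open>v\<close>, so it sees the reversed direction \<open>\<gamma>\<close> and not
      \<open>\<theta>\<close>.\<close>
    define \<theta> \<eta> \<gamma> where "\<theta> = Arg (v - u)" and "\<eta> = Arg (z - v)" and "\<gamma> = Arg (u - v)"
    have ang: "angle (L ! i) = \<theta>" "angle (L ! j) = \<eta>" "angle (L ! r i) = \<gamma>"
      by (simp_all add: angle_def a b c v' \<theta>_def \<eta>_def \<gamma>_def)
    have rij: "r i \<noteq> j" using b c uz by auto
    then have \<gamma>\<eta>: "\<gamma> \<noteq> \<eta>"
      using angle_inj[of v u z] nth_dirs[OF r_less[OF i]] nth_dirs[OF j] b c v' uz
      by (auto simp: angle_def \<eta>_def \<gamma>_def)
    have bounds: "- pi < \<gamma>" "\<gamma> \<le> pi" "- pi < \<eta>" "\<eta> \<le> pi"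
      by (auto simp: \<gamma>_def \<eta>_def mpi_less_Arg Arg_le_pi)
    have kap: "kap i = (if \<gamma> = \<theta> - pi then 1 else -1)" "\<gamma> = (if \<gamma> = \<theta> - pi then \<theta> - pi else \<theta> + pi)"
    proof -
      have \<gamma>: "\<gamma> = (if \<theta> \<le> 0 then \<theta> + pi else \<theta> - pi)"
        using Arg_minus[of "v - u"] uv by (auto simp: \<gamma>_def \<theta>_def)
      have "i < r i \<longleftrightarrow> below u v"
        using below_asym[of u v] below_total[OF uv] less_iff_dirless[OF i r_less[OF i]] uv
        by (auto simp: a c dirless_def)
      also have "\<dots> \<longleftrightarrow> 0 < \<theta>"
        using Arg_pos[of "v - u"] Arg_neg[of "v - u"] below_total[OF uv] below_asym
        by (auto simp: below_def \<theta>_def) 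
      finally have "i < r i \<longleftrightarrow> 0 < \<theta>" .
      then show "kap i = (if \<gamma> = \<theta> - pi then 1 else -1)" "\<gamma> = (if \<gamma> = \<theta> - pi then \<theta> - pi else \<theta> + pi)"
        using \<gamma> by (auto simp: kap_def)
    qed
    have "r i < j \<longleftrightarrow> \<gamma> < \<eta>"
      using less_iff_dirless[OF r_less[OF i] j] ang by (simp add: dirless_def b c v')
    then have nu: "nu (r i) j = (if \<gamma> < \<eta> then 1 else -1)"
      using rij b c v' by (simp add: nu_def)
    \<comment> \<open>The difference \<open>\<eta> - \<gamma>\<close> is nonzero and within
      \<open>2 * pi\<close> of 0; shifting it by \<open>pi\<close> towards 0 undoes the reversal and
      lands in the range of \<open>Arg\<close>.\<close>
    define \<delta> where "\<delta> = (if \<gamma> < \<eta> then \<eta> - \<gamma> - pi else \<eta> - \<gamma> + pi)"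
    have \<delta>: "- pi < \<delta>" "\<delta> \<le> pi" using bounds \<gamma>\<eta> by (auto simp: \<delta>_def)
    have e: "exp (\<i> * of_real \<delta> / 2) = kap i * nu (r i) j * d j / d i \<and>
       exp (\<i> * of_real \<delta>) = exp (\<i> * of_real \<eta>) / exp (\<i> * of_real \<theta>)"
    proof -
      \<comment> \<open>The turning angle differs from \<open>\<eta> - \<theta>\<close> by at most
        one full turn. A full turn changes the half-angle phase by -1, and it occurs exactly when
        \<open>kap\<close> and \<open>nu\<close> have opposite signs.\<close>
      consider "\<delta> = \<eta> - \<theta>" "kap i * nu (r i) j = 1" | "\<delta> = \<eta> - \<theta> + 2 * pi" "kap i * nu (r i) j = -1"
        | "\<delta> = \<eta> - \<theta> - 2 * pi" "kap i * nu (r i) j = -1"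
        using kap nu by (cases "\<gamma> < \<eta>"; cases "\<gamma> = \<theta> - pi") (auto simp: \<delta>_def)
      then show ?thesis
      proof cases
        case 1
        show ?thesis by (simp add: 1 d_def ang exp_diff[symmetric] algebra_simps diff_divide_distrib)
      next
        case 2
        have "\<i> * of_real \<delta> / 2 = \<i> * of_real \<eta> / 2 - \<i> * of_real \<theta> / 2 + \<i> * of_real pi"
          and "\<i> * of_real \<delta> = \<i> * of_real \<eta> - \<i> * of_real \<theta> + 2 * of_real pi * \<i>"
          by (simp_all add: 2(1) field_simps)
        then have "exp (\<i> * of_real \<delta> / 2) = - (exp (\<i> * of_real \<eta> / 2) / exp (\<i> * of_real \<theta> / 2))"
          "exp (\<i> * of_real \<delta>) = exp (\<i> * of_real \<eta>) / exp (\<i> * of_real \<theta>)"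
          by (simp_all only:) (simp_all add: exp_diff exp_add exp_two_pi_i)
        then show ?thesis using 2(2) by (simp add: d_def ang)
      next
        case 3
        have "\<i> * of_real \<delta> / 2 = \<i> * of_real \<eta> / 2 - \<i> * of_real \<theta> / 2 - \<i> * of_real pi"
          and "\<i> * of_real \<delta> = \<i> * of_real \<eta> - \<i> * of_real \<theta> - 2 * of_real pi * \<i>"
          by (simp_all add: 3(1) field_simps)
        then have "exp (\<i> * of_real \<delta> / 2) = - (exp (\<i> * of_real \<eta> / 2) / exp (\<i> * of_real \<theta> / 2))"
          "exp (\<i> * of_real \<delta>) = exp (\<i> * of_real \<eta>) / exp (\<i> * of_real \<theta>)"
          by (simp_all only:) (simp_all add: exp_diff exp_add exp_two_pi_i)
        then show ?thesis using 3(2) by (simp add: d_def ang)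
      qed
    qed
    have "Arg ((z - v) / (v - u)) = \<delta>"
    proof (rule Arg_unique)
      have "z - v = of_real (cmod (z - v)) * exp (\<i> * of_real \<eta>)" "v - u = of_real (cmod (v - u)) * exp (\<i> * of_real \<theta>)"
        using Arg_eq[of "z - v"] Arg_eq[of "v - u"] uv vz v' by (simp_all add: \<eta>_def \<theta>_def)
      then have "(z - v) / (v - u) = (of_real (cmod (z - v)) * exp (\<i> * of_real \<eta>)) / (of_real (cmod (v - u)) * exp (\<i> * of_real \<theta>))"
        by simp
      also have "\<dots> = of_real (cmod (z - v) / cmod (v - u)) * exp (\<i> * of_real \<delta>)"
        by (simp add: e)
      finally show "of_real (cmod (z - v) / cmod (v - u)) * exp (\<i> * of_real \<delta>) = (z - v) / (v - u)" ..
    qed (use \<delta> uv vz v' in auto)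
    then show ?thesis
      using uz e by (simp add: step_def a b v' turn_def ed_def mult.assoc)
  qed
qed

lemma UNIV_split: "{..<n} - terminals F = terminals (E - F)"
  by (auto simp: terminals_def ed_in)

text \<open>In \<open>pfs_add\<close> the pairing part needs a set closed under reversal, hence all
  terminals of some \<open>E - F\<close>, and the block part then needs \<open>F\<close> even. Each
  edge of \<open>F\<close> contributes its square root once per orientation. The common sign in
  front squares to 1 and disappears from the determinant.\<close>

lemma pf_eq_Zfun:
  fixes x :: "complex set \<Rightarrow> complex"
  defines "y \<equiv> \<lambda>i. csqrt (x (ed i))"
  defines "A \<equiv> \<lambda>i j. kap i * (if j = r i then 1 else 0) + nu i j * y i * y j"
  shows "pf A [0..<n] = sgl r {..<n} * Zfun V E x"
proof -
  let ?K = "\<lambda>i j. kap i * (if j = r i then 1 else 0)" and ?B = "\<lambda>i j. nu i j * y i * y j"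
  let ?ev = "\<lambda>W. \<forall>v. even (card {i\<in>W. fst (L ! i) = v})"
  have K: "pfs ?K U = (if r ` U \<subseteq> U then sgl r U else 0)" if "U \<subseteq> {..<n}" for U
  proof (rule pfs_pairing)
    show "finite U" using that finite_subset by blast
    show "r (r i) = i \<and> r i \<noteq> i" if "i \<in> U" for i using that \<open>U \<subseteq> _\<close> r_r r_neq by blast
  qed (auto simp: kap_def)
  have B: "pfs ?B W = (if ?ev W then \<Prod>i\<in>W. y i else 0)" if "W \<subseteq> {..<n}" for W
  proof (rule pfs_blocks)
    show "finite W" using that finite_subset by blast
    fix i j assume ij: "i \<in> W" "j \<in> W" "i < j"
    show "?B i j = (if fst (L ! i) = fst (L ! j) then y i * y j else 0)" using ij by (simp add: nu_def)
    fix k assume k: "k \<in> W" "j < k" "fst (L ! i) = fst (L ! k)"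
    have lt: "i < n" "j < n" "k < n" using ij k that by auto
    have "dirless (L ! i) (L ! j)" "dirless (L ! j) (L ! k)"
      using ij(3) k(2) less_iff_dirless lt by blast+
    then show "fst (L ! j) = fst (L ! i)"
      using k(3) below_asym by (auto simp: dirless_def)
  qed
  have Tn: "terminals F \<subseteq> {..<n}" for F by (auto simp: terminals_def)
  have Tcl: "r ` terminals F \<subseteq> terminals F" for F using T_closed by blast
  have full: "{..<n} = terminals F \<union> terminals (E - F)" for F by (auto simp: terminals_def ed_in)
  \<comment> \<open>Trades the sign of the matching on the edges outside the even set for the sign
    on the even set itself, which counts crossings, at the cost of a sign independent of the set. It
    is used below with \<open>E - F\<close> in place of \<open>F\<close>.\<close>
  have sgl: "sinv (terminals F) (terminals (E - F)) * sgl r (terminals F) = sgl r {..<n} * sgl r (terminals (E - F))" for F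
  proof -
    have "sgl r {..<n} = sgl r (terminals F) * sgl r (terminals (E - F)) * sinv (terminals F) (terminals (E - F))"
      unfolding full[of F]
    proof (rule sgl_union)
      show "terminals F \<inter> terminals (E - F) = {}" by (auto simp: terminals_def)
    qed (simp_all add: T_closed)
    then have "sgl r {..<n} * sgl r (terminals (E - F)) = (sgl r (terminals (E - F)) * sgl r (terminals (E - F))) * (sinv (terminals F) (terminals (E - F)) * sgl r (terminals F))"
      by (simp only: mult_ac)
    then show ?thesis by (simp add: sgl_square)
  qed
  have "pf A [0..<n] = pfs (\<lambda>i j. ?K i j + ?B i j) {..<n}"
    by (simp add: pfs_def A_def lessThan_atLeast0)
  also have "\<dots> = (\<Sum>U\<in>Pow {..<n}. sinv U ({..<n} - U) * pfs ?K U * pfs ?B ({..<n} - U))"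
    by (rule pfs_add) simp
  also have "\<dots> = (\<Sum>U\<in>Pow {..<n}. sinv U ({..<n} - U) * (if r ` U \<subseteq> U then sgl r U else 0) * (if ?ev ({..<n} - U) then \<Prod>i\<in>{..<n} - U. y i else 0))"
    by (intro sum.cong refl) (simp add: K B)
  also have "\<dots> = (\<Sum>U\<in>(\<lambda>F. terminals (E - F)) ` Pow E. sinv U ({..<n} - U) * (if r ` U \<subseteq> U then sgl r U else 0) * (if ?ev ({..<n} - U) then \<Prod>i\<in>{..<n} - U. y i else 0))"
  proof (rule sum.mono_neutral_right)
    show "(\<lambda>F. terminals (E - F)) ` Pow E \<subseteq> Pow {..<n}" using Tn by auto
    have "U \<in> (\<lambda>F. terminals (E - F)) ` Pow E" if U: "U \<subseteq> {..<n}" "r ` U \<subseteq> U" for U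
    proof
      have "ed i \<in> ed ` U \<longleftrightarrow> i \<in> U" if "i < n" for i
        using U that ed_eq_iff by (auto simp: image_iff) (metis image_subset_iff r_r lessThan_iff subsetD)+
      then show "U = terminals (E - (E - ed ` U))" using U by (auto simp: terminals_def ed_in)
    qed auto
    then show "\<forall>U\<in>Pow {..<n} - (\<lambda>F. terminals (E - F)) ` Pow E. sinv U ({..<n} - U) * (if r ` U \<subseteq> U then sgl r U else 0) * (if ?ev ({..<n} - U) then \<Prod>i\<in>{..<n} - U. y i else 0) = 0"
      by auto
  qed simp
  also have "\<dots> = (\<Sum>F\<in>Pow E. sinv (terminals (E - F)) ({..<n} - terminals (E - F)) * (if r ` terminals (E - F) \<subseteq> terminals (E - F) then sgl r (terminals (E - F)) else 0) * (if ?ev ({..<n} - terminals (E - F)) then \<Prod>i\<in>{..<n} - terminals (E - F). y i else 0))"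
  proof (rule sum.reindex[unfolded comp_def])
    show "inj_on (\<lambda>F. terminals (E - F)) (Pow E)"
    proof (rule inj_onI)
      fix F G assume FG: "F \<in> Pow E" "G \<in> Pow E" and eq: "terminals (E - F) = terminals (E - G)"
      have "e \<in> F \<longleftrightarrow> e \<in> G" if e: "e \<in> E" for e
      proof -
        obtain i where "i < n" "ed i = e" using e ed_surj by metis
        moreover have "i \<in> terminals (E - F) \<longleftrightarrow> i \<in> terminals (E - G)" using eq by simp
        ultimately show ?thesis using e by (simp add: terminals_def)
      qed
      then show "F = G" using FG by auto
    qed
  qed
  also have "\<dots> = (\<Sum>F\<in>Pow E. sgl r {..<n} * (if even_set V E F then (-1) ^ crossings V F * (\<Prod>e\<in>F. x e) else 0))"
  proof (rule sum.cong[OF refl])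
    fix F assume "F \<in> Pow E"
    then have F: "F \<subseteq> E" by simp
    then have comp: "{..<n} - terminals (E - F) = terminals F" and EF: "E - (E - F) = F"
      using UNIV_split[of "E - F"] by (auto simp: double_diff)
    have "(\<Prod>i\<in>terminals F. y i) = (\<Prod>i\<in>{i\<in>terminals F. i < r i}. y i * y (r i))"
      by (rule prod_pairing) (auto simp: T_closed)
    also have "\<dots> = (\<Prod>i\<in>{i\<in>terminals F. i < r i}. x (ed i))"
      by (rule prod.cong[OF refl]) (auto simp: y_def terminals_def ed_r power2_eq_square[symmetric])
    also have "\<dots> = (\<Prod>e\<in>F. x e)"
      by (rule prod.reindex_bij_betw[OF bij_lower_edges[OF F]])
    finally show "sinv (terminals (E - F)) ({..<n} - terminals (E - F)) * (if r ` terminals (E - F) \<subseteq> terminals (E - F) then sgl r (terminals (E - F)) else 0) * (if ?ev ({..<n} - terminals (E - F)) then \<Prod>i\<in>{..<n} - terminals (E - F). y i else 0)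
      = sgl r {..<n} * (if even_set V E F then (-1) ^ crossings V F * (\<Prod>e\<in>F. x e) else 0)"
      using sgl[of "E - F"] Tcl[of "E - F"] sgl_eq_crossings[of F]
      by (simp add: comp EF even_set_iff[OF F] mult.assoc)
  qed
  also have "\<dots> = sgl r {..<n} * (\<Sum>F\<in>{F\<in>Pow E. even_set V E F}. (-1) ^ crossings V F * (\<Prod>e\<in>F. x e))"
  proof -
    have "finite (Pow E)" using finite_E by simp
    then show ?thesis
      unfolding sum_distrib_left[symmetric] by (subst sum.inter_filter) auto
  qed
  also have "{F\<in>Pow E. even_set V E F} = {F. even_set V E F}"
    by (auto simp: even_set_def)
  finally show ?thesis by (simp only: Zfun_def)
qed

lemma Zfun_zero: "Zfun V E (\<lambda>_. 0) = 1"
proof -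
  have fin: "finite F" if "even_set V E F" for F
    using that finite_E finite_subset by (auto simp: even_set_def)
  have "finite {F. even_set V E F}"
    by (rule finite_subset[of _ "Pow E"]) (use finite_E in \<open>auto simp: even_set_def\<close>)
  moreover have "even_set V E {}" by (simp add: even_set_def)
  moreover have "(-1) ^ crossings V F * (\<Prod>e\<in>F. 0 :: complex) = 0" if "even_set V E F" "F \<noteq> {}" for F
    using that fin[of F] by auto
  ultimately have "Zfun V E (\<lambda>_. 0) = (\<Sum>F\<in>{{}}. (-1) ^ crossings V F * (\<Prod>e\<in>F. 0))"
    unfolding Zfun_def by (intro sum.mono_neutral_right) auto
  then show ?thesis by (simp add: crossings_def)
qed

lemma det_eq_Zfun_square:
  fixes x :: "complex set \<Rightarrow> complex"
  defines "y \<equiv> \<lambda>i. csqrt (x (ed i))"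
  shows "det (mat n n (\<lambda>(i, j). kap i * (if j = r i then 1 else 0) + nu i j * y i * y j)) = (Zfun V E x)\<^sup>2"
proof -
  let ?A = "\<lambda>i j. kap i * (if j = r i then 1 else 0) + nu i j * y i * y j"
  have "det (mat n n (\<lambda>(i, j). ?A i j)) = (pf ?A [0..<n])\<^sup>2"
  proof (rule det_eq_pf_square)
    fix i j assume ij: "i < n" "j < n"
    have "kap i * (if j = r i then 1 else 0) = - (kap j * (if i = r j then 1 else 0))"
      using ij kap_r r_r by auto
    moreover have "nu i j * y i * y j = - (nu j i * y j * y i)" using nu_skew[of i j] by simp
    ultimately show "?A i j = - ?A j i" by (simp only: minus_add_distrib)
  qed
  also have "\<dots> = (Zfun V E x)\<^sup>2"
    unfolding y_def pf_eq_Zfun by (simp add: power2_eq_square) (metis mult.assoc mult.left_commute mult_1 sgl_square)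
  finally show ?thesis .
qed

text \<open>Normalising by the case $x = 0$ avoids computing the determinant of the pairing matrix.\<close>

lemma det_one_minus_step: "det (gram (one_minus (step x)) L) = (Zfun V E x)\<^sup>2"
proof -
  define y where "y = (\<lambda>i. csqrt (x (ed i)))"
  define d where "d = (\<lambda>i. exp (\<i> * of_real (angle (L ! i)) / 2))"
  let ?f = "\<lambda>i j. kap i * nu (r i) j"
  let ?A = "\<lambda>y i j. kap i * (if j = r i then 1 else 0) + nu i j * y i * y j"
  \<comment> \<open>The negative of the pairing part of \<open>?A\<close>. It is the inverse of that
    part because \<open>kap (r i) = - kap i\<close>, so multiplying by it turns the pairing part
    into the identity.\<close>
  let ?K = "mat n n (\<lambda>(i, j). - kap i * (if j = r i then 1 else 0))"
  have KA: "mat n n (\<lambda>(i, j). (if i = j then 1 else 0) - y i * ?f i j * y j) = ?K * mat n n (\<lambda>(i, j). ?A y i j)"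
    if yr: "\<And>i. i < n \<Longrightarrow> y (r i) = y i" for y
  proof (rule eq_matI)
    fix i j assume "i < dim_row (?K * mat n n (\<lambda>(i, j). ?A y i j))" "j < dim_col (?K * mat n n (\<lambda>(i, j). ?A y i j))"
    then have ij: "i < n" "j < n" by auto
    have "(?K * mat n n (\<lambda>(i, j). ?A y i j)) $$ (i, j) = (\<Sum>k = 0..<n. (- kap i * (if k = r i then 1 else 0)) * ?A y k j)"
      using ij by (simp add: scalar_prod_def)
    also have "\<dots> = (\<Sum>k = 0..<n. (if k = r i then - kap i * ?A y k j else 0))"
      by (rule sum.cong) auto
    also have "\<dots> = - kap i * ?A y (r i) j" using r_less[OF ij(1)] by simp
    also have "\<dots> = (if i = j then 1 else 0) - y i * ?f i j * y j"
      using ij by (auto simp: kap_r r_r yr algebra_simps)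
    finally show "mat n n (\<lambda>(i, j). (if i = j then 1 else 0) - y i * ?f i j * y j) $$ (i, j) = (?K * mat n n (\<lambda>(i, j). ?A y i j)) $$ (i, j)"
      using ij by simp
  qed auto
  have detKA: "det (mat n n (\<lambda>(i, j). (if i = j then 1 else 0) - y i * ?f i j * y j)) = det ?K * det (mat n n (\<lambda>(i, j). ?A y i j))"
    if yr: "\<And>i. i < n \<Longrightarrow> y (r i) = y i" for y
    by (rule trans[OF arg_cong[where f = det, OF KA[of y]] det_mult[where n = n]]) (use yr in auto)
  have "mat n n (\<lambda>(i, j). (if i = j then 1 else 0) - 0 * ?f i j * 0) = 1\<^sub>m n"
    by (rule eq_matI) auto
  then have "det ?K * det (mat n n (\<lambda>(i, j). ?A (\<lambda>_. 0) i j)) = 1"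
    using detKA[of "\<lambda>_. 0"] by simp
  then have detK: "det ?K = 1"
    using det_eq_Zfun_square[of "\<lambda>_. 0"] by (simp add: Zfun_zero)
  have yr: "y (r i) = y i" if "i < n" for i using that by (simp add: y_def ed_r)
  have "gram (one_minus (step x)) L = mat n n (\<lambda>(i, j). ((if i = j then 1 else 0) - x (ed i) * ?f i j) * d j / d i)"
    by (rule eq_matI)
      (auto simp: gram_def one_minus_def d_def step_gauge nth_eq_iff_index_eq[OF distL] algebra_simps diff_divide_distrib)
  also have "det \<dots> = det (mat n n (\<lambda>(i, j). (if i = j then 1 else 0) - x (ed i) * ?f i j))"
    by (rule det_diagonal_conjugate) (simp add: d_def)
  also have "\<dots> = det (mat n n (\<lambda>(i, j). (if i = j then 1 else 0) - y i * y i * ?f i j))"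
    by (simp add: y_def power2_eq_square[symmetric])
  also have "\<dots> = det (mat n n (\<lambda>(i, j). (if i = j then 1 else 0) - y i * ?f i j * y j))"
    by (rule det_one_minus_symmetrize)
  also have "\<dots> = det ?K * det (mat n n (\<lambda>(i, j). ?A y i j))"
    by (rule detKA[of y, OF yr])
  also have "\<dots> = (Zfun V E x)\<^sup>2"
    unfolding detK y_def det_eq_Zfun_square by simp
  finally show ?thesis .
qed

end

lemma (in plane_graph) Kac_Ward:
  assumes "distinct ds" "set ds = dirs E"
  shows "det (gram (one_minus (step x)) ds) = (Zfun V E x)\<^sup>2"
proof -
  obtain L where L: "distinct L" "set L = dirs E" "sorted_wrt dirless L"
    using ex_sorted_dirs by blast
  interpret sorted_plane_graph V E L by unfold_locales (use L in auto)
  show ?thesis using det_one_minus_step det_gram_set[of ds L] assms L by metis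
qed

section \<open>Elimination of the additional edges\<close>

definition nobt :: "complex \<times> complex \<Rightarrow> complex \<times> complex \<Rightarrow> bool" where
  "nobt a b \<longleftrightarrow> snd a = fst b \<and> fst a \<noteq> snd b"

lemma step_eq_0: "\<not> nobt a b \<Longrightarrow> step x a b = 0"
  by (auto simp: step_def nobt_def)

text \<open>Non-backtracking walks as vertex lists. A single vertex is a walk, so that the direct
  transition without additional edges is covered too.\<close>

fun walk :: "complex set set \<Rightarrow> complex list \<Rightarrow> bool" where
  "walk F (u # v # w # p) \<longleftrightarrow> {u, v} \<in> F \<and> u \<noteq> w \<and> walk F (v # w # p)"
| "walk F [u, v] \<longleftrightarrow> {u, v} \<in> F"
| "walk F _ \<longleftrightarrow> True"

lemma walk_Cons: "walk F (u # v # p) \<longleftrightarrow> {u, v} \<in> F \<and> (p \<noteq> [] \<longrightarrow> u \<noteq> hd p) \<and> walk F (v # p)"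
  by (cases p) auto

lemma walk_nth:
  assumes "walk F p"
  shows "Suc i < length p \<Longrightarrow> {p ! i, p ! Suc i} \<in> F"
    and "Suc (Suc i) < length p \<Longrightarrow> p ! i \<noteq> p ! Suc (Suc i)"
  using assms
proof (induction F p arbitrary: i rule: walk.induct)
  case (1 F u v w p)
  { case 1 then show ?case using "1.IH"(1)[of "i - 1"] by (cases i) auto }
  { case 2 then show ?case using "1.IH"(2)[of "i - 1"] by (cases i) auto }
qed auto

lemma walkI:
  assumes "\<And>i. Suc i < length p \<Longrightarrow> {p ! i, p ! Suc i} \<in> F"
    and "\<And>i. Suc (Suc i) < length p \<Longrightarrow> p ! i \<noteq> p ! Suc (Suc i)"
  shows "walk F p"
  using assms
proof (induction F p rule: walk.induct)
  case (1 F u v w p)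
  have "walk F (v # w # p)"
  proof (rule "1.IH")
    show "{(v # w # p) ! i, (v # w # p) ! Suc i} \<in> F" if "Suc i < length (v # w # p)" for i
      using "1.prems"(1)[of "Suc i"] that by simp
    show "(v # w # p) ! i \<noteq> (v # w # p) ! Suc (Suc i)" if "Suc (Suc i) < length (v # w # p)" for i
      using "1.prems"(2)[of "Suc i"] that by simp
  qed
  then show ?case using "1.prems"(1)[of 0] "1.prems"(2)[of 0] by simp
next
  case (2 F u v)
  then show ?case using "2.prems"(1)[of 0] by simp
qed auto

lemma walk_rev_append:
  "walk F (v # p) \<Longrightarrow> walk F (v # q) \<Longrightarrow> (p \<noteq> [] \<Longrightarrow> q \<noteq> [] \<Longrightarrow> hd p \<noteq> hd q) \<Longrightarrow> walk F (rev p @ v # q)"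
proof (induction p arbitrary: v q)
  case (Cons a p)
  have "walk F (rev p @ a # (v # q))"
  proof (rule Cons.IH)
    show "walk F (a # p)" using Cons.prems(1) by (simp add: walk_Cons)
    show "walk F (a # v # q)" using Cons.prems by (auto simp: walk_Cons insert_commute)
    show "p \<noteq> [] \<Longrightarrow> v # q \<noteq> [] \<Longrightarrow> hd p \<noteq> hd (v # q)" using Cons.prems(1) by (auto simp: walk_Cons)
  qed
  then show ?case by simp
qed simp

section \<open>Uniqueness of walks in the forest\<close>

locale forest_graph = plane_graph +
  fixes EA :: "complex set set"
  assumes EAE: "EA \<subseteq> E" and acyc: "acyclic_edges EA"
begin

lemma EA_ne: "{u, v} \<in> EA \<Longrightarrow> u \<noteq> v"
  using EAE dirsD(3)[of u v] by (auto simp: dirs_def)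

lemma dirs_EA: "dirs EA \<subseteq> dirs E"
  using EAE by (auto simp: dirs_def)

text \<open>The shortest distance \<open>d\<close> between equal vertices gives a simple cycle. The
  values 1 and 2 are excluded because edges have distinct ends and the walk does not backtrack, so
  \<open>d\<close> meets the bound 3 in \<open>acyclic_edges\<close>.\<close>

lemma walk_distinct:
  assumes w: "walk EA p"
  shows "distinct p"
proof (rule ccontr)
  let ?Q = "\<lambda>d. \<exists>i. 0 < d \<and> i + d < length p \<and> p ! i = p ! (i + d)"
  assume "\<not> distinct p"
  then obtain i j where ij: "i < length p" "j < length p" "i \<noteq> j" "p ! i = p ! j"
    unfolding distinct_conv_nth by blast
  have "\<exists>d. ?Q d"
  proof (cases "i < j")
    case True
    then show ?thesis using ij by (intro exI[of _ "j - i"] exI[of _ i]) simp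
  next
    case False
    then show ?thesis using ij by (intro exI[of _ "i - j"] exI[of _ j]) simp
  qed
  define d where "d = (LEAST d. ?Q d)"
  have "?Q d" unfolding d_def using \<open>\<exists>d. ?Q d\<close> by (rule LeastI_ex)
  then obtain k where k: "0 < d" "k + d < length p" "p ! k = p ! (k + d)" by blast
  have min: "\<not> ?Q d'" if "d' < d" for d' using that not_less_Least unfolding d_def by blast
  have "d \<noteq> 1" using walk_nth(1)[OF w, of k] k EA_ne[of "p ! k" "p ! Suc k"] by auto
  moreover have "d \<noteq> 2" using walk_nth(2)[OF w, of k] k by auto
  ultimately have d3: "3 \<le> d" using k(1) by linarith
  define cs where "cs = take d (drop k p)"
  have len: "length cs = d" using k by (simp add: cs_def)
  have nth: "cs ! i = p ! (k + i)" if "i < d" for i using that k by (simp add: cs_def)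
  have "distinct cs"
    unfolding distinct_conv_nth len
  proof (intro allI impI)
    fix i j assume ij: "i < d" "j < d" "i \<noteq> j"
    have less: "p ! (k + i) \<noteq> p ! (k + j)" if "i < j" "j < d" for i j
    proof
      assume "p ! (k + i) = p ! (k + j)"
      then have "?Q (j - i)" using that k(2) by (intro exI[of _ "k + i"]) simp
      moreover have "j - i < d" using that by simp
      ultimately show False using min by blast
    qed
    have "p ! (k + i) \<noteq> p ! (k + j)"
      using less[of i j] less[of j i] ij by (cases "i < j") auto
    then show "cs ! i \<noteq> cs ! j" using nth ij by simp
  qed
  moreover have "{cs ! i, cs ! ((i + 1) mod length cs)} \<in> EA" if "i < length cs" for i
  proof (cases "i + 1 = d")
    case True
    then have "cs ! i = p ! (k + i)" "cs ! ((i + 1) mod length cs) = p ! Suc (k + i)"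
      using nth[of 0] nth[of i] k len by auto
    then show ?thesis using walk_nth(1)[OF w, of "k + i"] k True by simp
  next
    case False
    then have "cs ! i = p ! (k + i)" "cs ! ((i + 1) mod length cs) = p ! Suc (k + i)"
      using nth[of "i + 1"] nth[of i] that len by auto
    then show ?thesis using walk_nth(1)[OF w, of "k + i"] k that len by simp
  qed
  ultimately show False using acyc d3 len unfolding acyclic_edges_def by blast
qed

text \<open>At the first divergence, one remaining walk reversed and followed by the other is again
  non-backtracking, yet begins and ends at the same vertex.\<close>

lemma walk_unique:
  assumes "walk EA p" "walk EA q" "p \<noteq> []" "q \<noteq> []" "hd p = hd q" "last p = last q"
  shows "p = q"
  using assms
proof (induction p arbitrary: q)
  case (Cons v p)
  obtain q' where q: "q = v # q'" using Cons.prems by (cases q) auto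
  have dp: "distinct (v # p)" and dq: "distinct (v # q')" using walk_distinct Cons.prems q by blast+
  show ?case
  proof (cases "p = [] \<or> q' = []")
    case True
    then have "p = [] \<and> q' = []"
      using dp dq Cons.prems(6) q by (metis distinct.simps(2) last.simps last_in_set)
    then show ?thesis using q by simp
  next
    case False
    show ?thesis
    proof (cases "hd p = hd q'")
      case True
      have "walk EA p" "walk EA q'" using Cons.prems(1,2) q False by (cases p; cases q'; simp add: walk_Cons)+
      then have "p = q'" using Cons.IH[of q'] True False Cons.prems(6) q by simp
      then show ?thesis using q by simp
    next
      case ne: False
      have "walk EA (rev p @ v # q')"
        using walk_rev_append[of EA v p q'] Cons.prems(1,2) q ne by blast
      then have "distinct (rev p @ v # q')" by (rule walk_distinct)
      moreover have "last p \<in> set p" "last q' \<in> set q'" using False by simp_all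
      moreover have "last p = last q'" using False Cons.prems(6) q by simp
      ultimately show ?thesis by auto
    qed
  qed
qed simp

text \<open>Backtracking would repeat an edge at once. Conversely, in a forest a non-backtracking
  walk has distinct vertices and therefore distinct edges.\<close>

lemma linkpath_iff: "linkpath EA v w p \<longleftrightarrow> 2 \<le> length p \<and> hd p = v \<and> last p = w \<and> walk EA p"
proof
  assume l: "linkpath EA v w p"
  then have e: "{p ! i, p ! Suc i} \<in> EA" if "Suc i < length p" for i
    using that by (auto simp: linkpath_def)
  have "p ! i \<noteq> p ! Suc (Suc i)" if i: "Suc (Suc i) < length p" for i
  proof
    let ?f = "\<lambda>i. {p ! i, p ! (i+1)}"
    assume "p ! i = p ! Suc (Suc i)"
    moreover have i': "i < length p - 1" "Suc i < length p - 1" using i by simp_all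
    ultimately have "map ?f [0..<length p - 1] ! i = map ?f [0..<length p - 1] ! Suc i"
      using i i' by (simp add: insert_commute)
    moreover have "distinct (map ?f [0..<length p - 1])" using l by (simp add: linkpath_def)
    ultimately show False using i by (subst (asm) nth_eq_iff_index_eq) auto
  qed
  then show "2 \<le> length p \<and> hd p = v \<and> last p = w \<and> walk EA p"
    using l e walkI[of p EA] by (auto simp: linkpath_def)
next
  assume r: "2 \<le> length p \<and> hd p = v \<and> last p = w \<and> walk EA p"
  then have d: "distinct p" using walk_distinct by blast
  have "inj_on (\<lambda>i. {p ! i, p ! (i+1)}) {0..<length p - 1}"
  proof (rule inj_onI)
    fix i j assume ij: "i \<in> {0..<length p - 1}" "j \<in> {0..<length p - 1}" "{p ! i, p ! (i+1)} = {p ! j, p ! (j+1)}"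
    then show "i = j"
      by (auto simp: doubleton_eq_iff nth_eq_iff_index_eq[OF d])
  qed
  then have "distinct (map (\<lambda>i. {p ! i, p ! (i+1)}) [0..<length p - 1])"
    by (simp add: distinct_map)
  then show "linkpath EA v w p"
    using r walk_nth(1)[of EA p] by (auto simp: linkpath_def)
qed

lemma nobt_list_walk:
  "set ds \<subseteq> dirs EA \<Longrightarrow> successively nobt ds \<Longrightarrow> ds \<noteq> [] \<Longrightarrow> walk EA (map fst ds @ [snd (last ds)])"
proof (induction ds)
  case (Cons a ds)
  have a: "{fst a, snd a} \<in> EA" using Cons.prems by (auto simp: dirs_def)
  show ?case
  proof (cases ds)
    case Nil
    then show ?thesis using a by simp
  next
    case (Cons b bs)
    have w: "walk EA (map fst ds @ [snd (last ds)])"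
      using Cons.IH Cons.prems Cons by auto
    have ab: "snd a = fst b" "fst a \<noteq> snd b" using Cons.prems(2) Cons by (auto simp: nobt_def)
    show ?thesis
    proof (cases bs)
      case Nil
      then show ?thesis using a ab w Cons by simp
    next
      case (Cons c cs)
      then have "snd b = fst c" using Cons.prems(2) \<open>ds = b # bs\<close> by (auto simp: nobt_def)
      then show ?thesis using a ab w Cons \<open>ds = b # bs\<close> by simp
    qed
  qed
qed simp

lemma nobt_list_distinct:
  assumes "set ds \<subseteq> dirs EA" "successively nobt ds"
  shows "distinct (map fst ds)"
proof (cases "ds = []")
  case False
  then show ?thesis using walk_distinct[OF nobt_list_walk[OF assms False]] by simp
qed simp

text \<open>The target \<open>b\<close> constrains the last transition but is not listed, so such
  lists concatenate without overlap.\<close>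

definition Pth :: "complex \<times> complex \<Rightarrow> complex \<times> complex \<Rightarrow> (complex \<times> complex) list set" where
  "Pth a b = {es. \<exists>ds. es = a # ds \<and> set ds \<subseteq> dirs EA \<and> successively nobt (es @ [b])}"

fun wt :: "(complex set \<Rightarrow> complex) \<Rightarrow> (complex \<times> complex) list \<Rightarrow> complex \<times> complex \<Rightarrow> complex" where
  "wt x [] b = 1"
| "wt x (e # es) b = step x e (hd (es @ [b])) * wt x es b"

lemma finite_dirs_subset: "F \<subseteq> E \<Longrightarrow> finite (dirs F)"
  by (rule finite_subset[OF _ finite_dirs]) (auto simp: dirs_def)

lemma successively_appendD1: "successively P (xs @ ys) \<Longrightarrow> successively P xs"
  by (simp add: successively_append_iff)

lemma finite_Pth: "finite (Pth a b)"
proof (rule finite_subset)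
  show "Pth a b \<subseteq> (\<lambda>ds. a # ds) ` {ds. set ds \<subseteq> dirs EA \<and> distinct ds}"
  proof
    fix es assume "es \<in> Pth a b"
    then obtain ds where ds: "es = a # ds" "set ds \<subseteq> dirs EA" "successively nobt (a # ds @ [b])"
      by (auto simp: Pth_def)
    have "successively nobt ds"
      using ds(3) successively_appendD1[of nobt ds "[b]"] by (auto simp: successively_Cons)
    then have "distinct ds" using nobt_list_distinct[OF ds(2)] by (simp add: distinct_map)
    then show "es \<in> (\<lambda>ds. a # ds) ` {ds. set ds \<subseteq> dirs EA \<and> distinct ds}" using ds by auto
  qed
  show "finite ((\<lambda>ds. a # ds) ` {ds. set ds \<subseteq> dirs EA \<and> distinct ds})"
    using finite_dirs_subset[OF EAE] finite_subset_distinct[of "dirs EA"] by (simp add: conj_commute)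
qed

text \<open>Defined for all directed edges, not only representative ones: on representative edges it
  is \<open>\<Lambda>\<close>, and with additional \<open>a\<close> it is the solution
  \<open>(1 - T_A)^{-1} T_{AR}\<close>, where \<open>A\<close> and \<open>R\<close> stand for
  additional and representative edges, that block elimination needs.\<close>

definition link_weight :: "(complex set \<Rightarrow> complex) \<Rightarrow> complex \<times> complex \<Rightarrow> complex \<times> complex \<Rightarrow> complex" where
  "link_weight x a b = (\<Sum>es\<in>Pth a b. wt x es b)"

lemma link_weight_rec: "link_weight x a b = step x a b + (\<Sum>e\<in>dirs EA. step x a e * link_weight x e b)"
proof -
  let ?N = "{e\<in>dirs EA. nobt a e}"
  let ?S = "SIGMA e:?N. Pth e b"
  have fin: "finite ?N" using finite_dirs_subset[OF EAE] by simp
  have eq: "Pth a b = (if nobt a b then {[a]} else {}) \<union> (\<lambda>(e, es). a # es) ` ?S"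
  proof (intro equalityI subsetI)
    fix es assume "es \<in> Pth a b"
    then obtain ds where ds: "es = a # ds" "set ds \<subseteq> dirs EA" "successively nobt (a # ds @ [b])"
      by (auto simp: Pth_def)
    show "es \<in> (if nobt a b then {[a]} else {}) \<union> (\<lambda>(e, es). a # es) ` ?S"
    proof (cases ds)
      case Nil
      then show ?thesis using ds by simp
    next
      case (Cons e ds')
      then have "(e, ds) \<in> ?S" using ds by (auto simp: Pth_def)
      then have "es \<in> (\<lambda>(e, es). a # es) ` ?S" using ds by (intro image_eqI[of _ _ "(e, ds)"]) auto
      then show ?thesis by blast
    qed
  next
    fix es assume "es \<in> (if nobt a b then {[a]} else {}) \<union> (\<lambda>(e, es). a # es) ` ?S"
    then show "es \<in> Pth a b" by (auto simp: Pth_def split: if_splits)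
  qed
  have "link_weight x a b = (\<Sum>es\<in>(if nobt a b then {[a]} else {}). wt x es b) + (\<Sum>es\<in>(\<lambda>(e, es). a # es) ` ?S. wt x es b)"
    unfolding link_weight_def eq
  proof (rule sum.union_disjoint)
    show "finite ((\<lambda>(e, es). a # es) ` ?S)" using fin finite_Pth by simp
    show "(if nobt a b then {[a]} else {}) \<inter> (\<lambda>(e, es). a # es) ` ?S = {}" by (auto simp: Pth_def)
  qed simp
  also have "(\<Sum>es\<in>(if nobt a b then {[a]} else {}). wt x es b) = step x a b"
    by (auto simp: step_eq_0)
  also have "(\<Sum>es\<in>(\<lambda>(e, es). a # es) ` ?S. wt x es b) = (\<Sum>(e, es)\<in>?S. wt x (a # es) b)"
    by (subst sum.reindex) (auto simp: inj_on_def Pth_def case_prod_unfold)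
  also have "\<dots> = (\<Sum>(e, es)\<in>?S. step x a e * wt x es b)"
    by (rule sum.cong) (auto simp: Pth_def)
  also have "\<dots> = (\<Sum>e\<in>?N. step x a e * link_weight x e b)"
    unfolding link_weight_def sum_distrib_left by (rule sum.Sigma[symmetric]) (auto simp: fin finite_Pth)
  also have "\<dots> = (\<Sum>e\<in>dirs EA. step x a e * link_weight x e b)"
    by (rule sum.mono_neutral_left) (auto simp: finite_dirs_subset[OF EAE] step_eq_0)
  finally show ?thesis .
qed

lemma turnsum_Cons: "turnsum (u # v # w # p) = turn (v - u) (w - v) + turnsum (v # w # p)"
  by (simp add: turnsum_def sum.lessThan_Suc_shift del: sum.lessThan_Suc)

lemma wt_vertex_list:
  assumes "p \<noteq> []" "hd p = v" "last p = w" "successively nobt ((u, v) # zip p (tl p) @ [(w, z)])"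
  shows "wt x ((u, v) # zip p (tl p)) (w, z) =
    x {u, v} * (\<Prod>i < length p - 1. x {p ! i, p ! (i+1)}) * exp (\<i> * of_real (turnsum (u # p @ [z])) / 2)"
  using assms
proof (induction p arbitrary: u v)
  case (Cons v0 p)
  show ?case
  proof (cases p)
    case Nil
    then show ?thesis using Cons.prems by (simp add: step_def turnsum_def nobt_def)
  next
    case (Cons v' p')
    have vv: "v0 = v" using Cons.prems by simp
    have IH: "wt x ((v, v') # zip p (tl p)) (w, z) =
        x {v, v'} * (\<Prod>i < length p - 1. x {p ! i, p ! (i+1)}) * exp (\<i> * of_real (turnsum (v # p @ [z])) / 2)"
      by (rule Cons.IH) (use Cons.prems Cons in \<open>auto simp: successively_Cons\<close>)
    have nb: "u \<noteq> v'" using Cons.prems Cons by (auto simp: nobt_def)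
    have "wt x ((u, v) # zip (v0 # p) (tl (v0 # p))) (w, z) = step x (u, v) (v, v') * wt x ((v, v') # zip p (tl p)) (w, z)"
      using Cons vv by simp
    also have "step x (u, v) (v, v') = x {u, v} * exp (\<i> * of_real (turn (v - u) (v' - v)) / 2)"
      using nb by (simp add: step_def)
    also have "x {u, v} * exp (\<i> * of_real (turn (v - u) (v' - v)) / 2) * wt x ((v, v') # zip p (tl p)) (w, z)
       = x {u, v} * (x {v, v'} * (\<Prod>i < length p - 1. x {p ! i, p ! (i+1)})) *
         exp (\<i> * of_real (turn (v - u) (v' - v) + turnsum (v # p @ [z])) / 2)"
      unfolding IH by (simp add: exp_add[symmetric] ring_distribs add_divide_distrib mult_ac)
    also have "x {v, v'} * (\<Prod>i < length p - 1. x {p ! i, p ! (i+1)}) = (\<Prod>i < length (v0 # p) - 1. x {(v0 # p) ! i, (v0 # p) ! (i+1)})"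
      using Cons vv by (simp add: prod.lessThan_Suc_shift del: prod.lessThan_Suc)
    also have "turn (v - u) (v' - v) + turnsum (v # p @ [z]) = turnsum (u # (v0 # p) @ [z])"
      using Cons vv by (simp add: turnsum_Cons)
    finally show ?thesis .
  qed
qed simp

lemma zip_map_fst:
  assumes "successively nobt (ds @ [(w, z)])"
  shows "zip (map fst ds @ [w]) (tl (map fst ds @ [w])) = ds"
  using assms
proof (induction ds)
  case (Cons a ds)
  then show ?case by (cases ds) (auto simp: nobt_def)
qed simp

lemma Pth_vertex_list:
  assumes "es \<in> Pth (u, v) (w, z)"
  obtains p where "es = (u, v) # zip p (tl p)" "walk EA p" "p \<noteq> []" "hd p = v" "last p = w"
proof -
  obtain ds where ds: "es = (u, v) # ds" "set ds \<subseteq> dirs EA" "successively nobt ((u, v) # ds @ [(w, z)])"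
    using assms by (auto simp: Pth_def)
  let ?p = "map fst ds @ [w]"
  have s: "successively nobt (ds @ [(w, z)])" using ds(3) by (auto simp: successively_Cons)
  have "walk EA ?p"
  proof (cases "ds = []")
    case False
    have "snd (last ds) = w"
      using s False by (auto simp: successively_append_iff nobt_def)
    then show ?thesis
      using nobt_list_walk[OF ds(2) successively_appendD1[OF s] False] by simp
  qed simp
  moreover have "hd ?p = v" using ds(3) by (cases ds) (auto simp: nobt_def)
  ultimately show ?thesis using that[of ?p] ds(1) zip_map_fst[OF s] by simp
qed

text \<open>Inside \<open>p\<close> backtracking is excluded by \<open>walk\<close>. At the far end,
  returning along the last additional edge would put \<open>{w, z}\<close> into
  \<open>EA\<close>.\<close>

lemma walk_nobt:
  assumes "walk EA p" "p \<noteq> []" "hd p = v" "last p = w" "u \<noteq> hd (tl (p @ [z]))" 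
    "2 \<le> length p \<Longrightarrow> {w, z} \<notin> EA"
  shows "successively nobt ((u, v) # zip p (tl p) @ [(w, z)])"
  using assms
proof (induction p arbitrary: u v)
  case (Cons v0 p)
  show ?case
  proof (cases p)
    case Nil
    then show ?thesis using Cons.prems by (simp add: nobt_def)
  next
    case (Cons v' p')
    have "v \<noteq> hd (tl (p @ [z]))"
    proof (cases p')
      case Nil
      then have "{v, w} \<in> EA" using Cons Cons.prems by auto
      moreover have "{w, z} \<notin> EA" using Cons.prems(6) Cons by simp
      ultimately show ?thesis using Nil Cons by (auto simp: insert_commute)
    next
      case (Cons v'' p'')
      then show ?thesis using Cons.prems \<open>p = v' # p'\<close> by auto
    qed
    then have "successively nobt ((v, v') # zip p (tl p) @ [(w, z)])"
      by (intro Cons.IH) (use Cons.prems Cons in \<open>auto simp: walk_Cons\<close>)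
    then show ?thesis using Cons Cons.prems by (simp add: nobt_def)
  qed
qed simp

lemma set_zip_walk: "walk EA p \<Longrightarrow> set (zip p (tl p)) \<subseteq> dirs EA"
proof (induction p)
  case (Cons a p)
  then show ?case by (cases p) (auto simp: walk_Cons dirs_def)
qed simp

text \<open>The sum over paths has at most one term by \<open>walk_unique\<close>; for
  \<open>v = w\<close> only the direct transition remains. Through additional edges no test for
  backtracking is needed at either end, since one of the two edges meeting there is representative
  and the other is not.\<close>

lemma Lam_entry_eq_G:
  assumes a: "a \<in> dirs (E - EA)" and b: "b \<in> dirs (E - EA)"
  shows "Lam_entry EA x a b = link_weight x a b"
proof -
  obtain u v w z where ab: "a = (u, v)" "b = (w, z)" by (cases a; cases b)
  have uv: "{u, v} \<notin> EA" and wz: "{w, z} \<notin> EA" using a b ab by (auto simp: dirs_def)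
  show ?thesis
  proof (cases "v = w")
    case True
    have "Pth a b \<subseteq> {[a]}"
    proof
      fix es assume "es \<in> Pth a b"
      then obtain p where p: "es = (u, v) # zip p (tl p)" "walk EA p" "p \<noteq> []" "hd p = v" "last p = w"
        using Pth_vertex_list unfolding ab by metis
      then have "p = [v]" using walk_unique[of p "[v]"] True by simp
      then show "es \<in> {[a]}" using p ab by simp
    qed
    moreover have "[a] \<in> Pth a b \<longleftrightarrow> u \<noteq> z" by (simp add: Pth_def nobt_def ab True)
    ultimately have "Pth a b = (if u \<noteq> z then {[a]} else {})" by auto
    then show ?thesis using True ab by (simp add: link_weight_def Lam_entry_def step_def turnsum_def)
  next
    case False
    have uniq: "es = (u, v) # zip p (tl p)" if "es \<in> Pth a b" "linkpath EA v w p" for es p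
      using Pth_vertex_list[of es u v w z] that walk_unique[of _ p] unfolding ab linkpath_iff
      by (metis length_0_conv not_numeral_le_zero)
    show ?thesis
    proof (cases "\<exists>p. linkpath EA v w p")
      case True
      define p where "p = (SOME p. linkpath EA v w p)"
      have lp: "linkpath EA v w p" unfolding p_def using True by (rule someI_ex)
      then have p: "walk EA p" "p \<noteq> []" "hd p = v" "last p = w" "2 \<le> length p"
        by (auto simp: linkpath_iff)
      obtain v' p' where p': "p = v # v' # p'"
        using p by (cases p; cases "tl p") auto
      have "{v, v'} \<in> EA" using p(1) p' by (simp add: walk_Cons)
      then have "u \<noteq> v'" using uv by (auto simp: insert_commute)
      then have s: "successively nobt ((u, v) # zip p (tl p) @ [(w, z)])"
        by (intro walk_nobt) (use p wz p' in auto)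
      then have "(u, v) # zip p (tl p) \<in> Pth a b"
        using set_zip_walk[OF p(1)] ab by (simp add: Pth_def)
      then have "Pth a b = {(u, v) # zip p (tl p)}" using uniq lp by blast
      then have "link_weight x a b = wt x ((u, v) # zip p (tl p)) (w, z)" by (simp add: link_weight_def ab)
      also have "\<dots> = x {u, v} * (\<Prod>i < length p - 1. x {p ! i, p ! (i+1)}) * exp (\<i> * of_real (turnsum (u # p @ [z])) / 2)"
        using p s by (intro wt_vertex_list) auto
      finally show ?thesis using False True ab by (simp add: Lam_entry_def Let_def p_def)
    next
      case nolink: False
      have "es \<notin> Pth a b" for es
      proof
        assume "es \<in> Pth a b"
        then obtain p where p: "es = (u, v) # zip p (tl p)" "walk EA p" "p \<noteq> []" "hd p = v" "last p = w"
          using Pth_vertex_list unfolding ab by metis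
        then have "2 \<le> length p" using False by (cases p; cases "tl p") auto
        then show False using nolink p linkpath_iff by blast
      qed
      then have "Pth a b = {}" by blast
      then show ?thesis using False nolink ab by (auto simp: Lam_entry_def link_weight_def)
    qed
  qed
qed

text \<open>A permutation contributing to the determinant and moving some edge would yield arbitrarily long
  non-backtracking walks in the forest.\<close>

lemma det_forest_block:
  assumes D: "distinct D" "set D = dirs EA"
  shows "det (gram (one_minus (step x)) D) = 1"
proof -
  let ?n = "length D" and ?A = "gram (one_minus (step x)) D"
  have diag: "?A $$ (i, i) = 1" if "i < ?n" for i
  proof -
    have "fst (D ! i) \<noteq> snd (D ! i)"
      using that D nth_mem[OF that] EA_ne by (cases "D ! i") (auto simp: dirs_def)
    then show ?thesis using that by (auto simp: gram_def one_minus_def step_def)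
  qed
  have zero: "(\<Prod>i = 0..<?n. ?A $$ (i, p i)) = 0" if p: "p permutes {0..<?n}" and pid: "p \<noteq> id" for p
  proof (rule ccontr)
    assume nz: "(\<Prod>i = 0..<?n. ?A $$ (i, p i)) \<noteq> 0"
    obtain i0 where i0: "p i0 \<noteq> i0" using pid by fastforce
    have pn: "p i < ?n \<longleftrightarrow> i < ?n" for i using permutes_in_image[OF p, of i] by simp
    have "i0 < ?n" using i0 p by (metis atLeastLessThan_iff permutes_not_in zero_le)
    have orb: "(p ^^ k) i0 < ?n \<and> p ((p ^^ k) i0) \<noteq> (p ^^ k) i0" for k
    proof (induction k)
      case (Suc k)
      then show ?case using pn permutes_inj[OF p] by (auto dest: injD)
    qed (use i0 \<open>i0 < ?n\<close> in auto)
    let ?e = "\<lambda>k. D ! ((p ^^ k) i0)"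
    have nb: "nobt (?e k) (?e (Suc k))" for k
    proof (rule ccontr)
      assume "\<not> ?thesis"
      then have "?A $$ ((p ^^ k) i0, p ((p ^^ k) i0)) = 0"
        using orb[of k] pn[of "(p ^^ k) i0"] D(1) by (simp add: gram_def one_minus_def step_eq_0 nth_eq_iff_index_eq)
      then have "(\<Prod>i = 0..<?n. ?A $$ (i, p i)) = 0" using orb[of k] by auto
      then show False using nz by simp
    qed
    \<comment> \<open>One edge more than there are vertices: the tails would have to be
      distinct.\<close>
    let ?l = "map ?e [0..<Suc (card V)]"
    have "set ?l \<subseteq> dirs EA" using orb D(2) nth_mem by fastforce
    moreover have "successively nobt ?l"
      unfolding successively_conv_nth using nb by (simp del: upt_Suc funpow.simps)
    ultimately have "distinct (map fst ?l)" by (rule nobt_list_distinct)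
    then have "card (set (map fst ?l)) = length (map fst ?l)" by (rule distinct_card)
    moreover have "fst e \<in> V" if "e \<in> dirs EA" for e
      using that dirs_EA dirsD(1) by (metis prod.collapse subsetD)
    then have "set (map fst ?l) \<subseteq> V"
      using \<open>set ?l \<subseteq> dirs EA\<close> unfolding set_map[of fst] by blast
    then have "card (set (map fst ?l)) \<le> card V" by (rule card_mono[OF finV])
    ultimately show False by (simp only: length_map length_upt)
  qed
  have "det ?A = (\<Sum>p\<in>{p. p permutes {0..<?n}}. signof p * (\<Prod>i = 0..<?n. ?A $$ (i, p i)))"
    by (rule det_def') (simp add: gram_def)
  also have "\<dots> = (\<Sum>p\<in>{id}. signof p * (\<Prod>i = 0..<?n. ?A $$ (i, p i)))"
    by (rule sum.mono_neutral_right) (auto simp: zero permutes_id finite_permutations)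
  also have "\<dots> = 1" using diag by simp
  finally show ?thesis .
qed

text \<open>The Schur complement is taken by right multiplication with the unipotent matrix
  \<open>?P\<close>. By \<open>link_weight_rec\<close> its block \<open>?Y\<close> clears the lower
  left corner and turns the upper left one into \<open>1 - \<Lambda>\<close>, without inverting the
  forest block, whose determinant is 1.\<close>

theorem det_one_minus_G:
  assumes R: "distinct R" "set R = dirs (E - EA)"
  shows "det (gram (one_minus (link_weight x)) R) = (Zfun V E x)\<^sup>2"
proof -
  obtain D where D: "set D = dirs EA" "distinct D"
    using finite_distinct_list[OF finite_dirs_subset[OF EAE]] by blast
  let ?m = "length R" and ?k = "length D" and ?w = "one_minus (step x)"
  have RD: "set R \<inter> set D = {}" using R D by (auto simp: dirs_def)
  have all: "distinct (R @ D)" "set (R @ D) = dirs E"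
    using R D RD EAE by (auto simp: dirs_def)
  let ?A = "gram ?w R" and ?D = "gram ?w D"
  let ?B = "mat ?m ?k (\<lambda>(i, j). ?w (R ! i) (D ! j))" and ?C = "mat ?k ?m (\<lambda>(i, j). ?w (D ! i) (R ! j))"
  let ?Y = "mat ?k ?m (\<lambda>(i, j). link_weight x (D ! i) (R ! j))"
  have sumD: "(\<Sum>k = 0..<?k. f (D ! k)) = (\<Sum>e\<in>dirs EA. f e)" for f :: "_ \<Rightarrow> complex"
    using sum_nth_distinct[OF D(2), of f] D(1) by (simp add: lessThan_atLeast0)
  have ne: "R ! i \<noteq> D ! j" if "i < ?m" "j < ?k" for i j
    using that RD nth_mem[of i R] nth_mem[of j D] by (metis disjoint_iff)
  have full: "gram ?w (R @ D) = four_block_mat ?A ?B ?C ?D"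
    by (rule eq_matI) (auto simp: gram_def nth_append)
  have CD: "?C * 1\<^sub>m ?m + ?D * ?Y = 0\<^sub>m ?k ?m"
  proof (rule eq_matI)
    fix i j assume "i < dim_row (0\<^sub>m ?k ?m)" "j < dim_col (0\<^sub>m ?k ?m)"
    then have ij: "i < ?k" "j < ?m" by auto
    have "(?D * ?Y) $$ (i, j) = (\<Sum>k = 0..<?k. ?w (D ! i) (D ! k) * link_weight x (D ! k) (R ! j))"
      using ij by (simp add: scalar_prod_def gram_def)
    also have "\<dots> = (\<Sum>e\<in>dirs EA. ?w (D ! i) e * link_weight x e (R ! j))" by (rule sumD)
    also have "\<dots> = (\<Sum>e\<in>dirs EA. (if e = D ! i then link_weight x e (R ! j) else 0) - step x (D ! i) e * link_weight x e (R ! j))"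
      by (rule sum.cong) (auto simp: one_minus_def algebra_simps)
    also have "\<dots> = link_weight x (D ! i) (R ! j) - (\<Sum>e\<in>dirs EA. step x (D ! i) e * link_weight x e (R ! j))"
      using ij D(1) nth_mem[of i D] finite_dirs_subset[OF EAE] by (simp add: sum_subtractf)
    also have "\<dots> = step x (D ! i) (R ! j)" using link_weight_rec[of x "D ! i" "R ! j"] by simp
    finally show "(?C * 1\<^sub>m ?m + ?D * ?Y) $$ (i, j) = 0\<^sub>m ?k ?m $$ (i, j)"
      using ij ne[OF ij(2,1)] by (simp add: one_minus_def gram_def)
  qed (auto simp: gram_def)
  have AB: "?A * 1\<^sub>m ?m + ?B * ?Y = gram (one_minus (link_weight x)) R"
  proof (rule eq_matI)
    fix i j assume "i < dim_row (gram (one_minus (link_weight x)) R)" "j < dim_col (gram (one_minus (link_weight x)) R)"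
    then have ij: "i < ?m" "j < ?m" by (auto simp: gram_def)
    have "(?B * ?Y) $$ (i, j) = (\<Sum>k = 0..<?k. - step x (R ! i) (D ! k) * link_weight x (D ! k) (R ! j))"
      using ij ne[OF ij(1)] by (simp add: scalar_prod_def one_minus_def)
    also have "\<dots> = - (\<Sum>e\<in>dirs EA. step x (R ! i) e * link_weight x e (R ! j))"
      using sumD[of "\<lambda>e. - step x (R ! i) e * link_weight x e (R ! j)"] by (simp add: sum_negf)
    also have "\<dots> = step x (R ! i) (R ! j) - link_weight x (R ! i) (R ! j)"
      using link_weight_rec[of x "R ! i" "R ! j"] by simp
    finally show "(?A * 1\<^sub>m ?m + ?B * ?Y) $$ (i, j) = gram (one_minus (link_weight x)) R $$ (i, j)"
      using ij by (simp add: one_minus_def gram_def)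
  qed (auto simp: gram_def)
  have car: "?A \<in> carrier_mat ?m ?m" "?B \<in> carrier_mat ?m ?k" "?C \<in> carrier_mat ?k ?m" "?D \<in> carrier_mat ?k ?k" "?Y \<in> carrier_mat ?k ?m"
    by (auto simp: gram_def)
  let ?P = "four_block_mat (1\<^sub>m ?m) (0\<^sub>m ?m ?k) ?Y (1\<^sub>m ?k)"
  have mul: "four_block_mat ?A ?B ?C ?D * ?P = four_block_mat (gram (one_minus (link_weight x)) R) ?B (0\<^sub>m ?k ?m) ?D"
    unfolding CD[symmetric] AB[symmetric]
    by (subst mult_four_block_mat[OF car(1-4) one_carrier_mat zero_carrier_mat car(5) one_carrier_mat])
      (simp add: right_mult_zero_mat[OF car(1)] left_add_zero_mat[OF car(2)] left_add_zero_mat[OF car(4)] right_mult_one_mat[OF car(4)])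
  have "det (four_block_mat ?A ?B ?C ?D) * det ?P = det (four_block_mat (gram (one_minus (link_weight x)) R) ?B (0\<^sub>m ?k ?m) ?D)"
    unfolding mul[symmetric]
    by (rule det_mult[where n = "?m + ?k", symmetric]) (use car in auto)
  moreover have "det ?P = 1"
    by (subst det_four_block_mat_upper_right_zero[where n = ?m and m = ?k]) (use car in auto)
  moreover have "det (four_block_mat (gram (one_minus (link_weight x)) R) ?B (0\<^sub>m ?k ?m) ?D) = det (gram (one_minus (link_weight x)) R) * det ?D"
    by (rule det_four_block_mat_lower_left_zero[where n = ?m and m = ?k]) (use car in \<open>auto simp: gram_def\<close>)
  moreover have "det ?D = 1" by (rule det_forest_block[OF D(2,1)])
  ultimately show ?thesis using Kac_Ward[OF all, of x, unfolded full] by simp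
qed

end

section \<open>Traces and cyclic paths\<close>

lemma successively_glue:
  "fs \<noteq> [] \<Longrightarrow> successively P (es @ fs @ [b]) \<longleftrightarrow> successively P (es @ [hd fs]) \<and> successively P (fs @ [b])"
  by (auto simp: successively_append_iff)

lemma pow_mat_Suc_left:
  assumes "A \<in> carrier_mat n n"
  shows "A ^\<^sub>m Suc k = A * A ^\<^sub>m k"
proof (induction k)
  case (Suc k)
  have "A ^\<^sub>m Suc (Suc k) = (A * A ^\<^sub>m k) * A" using Suc by simp
  also have "\<dots> = A * (A ^\<^sub>m k * A)"
    by (rule assoc_mult_mat[of _ n n _ n _ n]) (use assms in auto)
  finally show ?case by simp
qed (use assms in simp)

context forest_graph
begin

lemma wt_append: "wt x (es @ fs) b = wt x es (hd (fs @ [b])) * wt x fs b"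
proof (induction es)
  case (Cons e es)
  then show ?case by (cases es) (auto simp: mult.assoc)
qed simp

lemma wt_eq_prod: "wt x es b = (\<Prod>i<length es. step x (es ! i) ((es @ [b]) ! Suc i))"
proof (induction es)
  case (Cons e es)
  have "hd (es @ [b]) = (es @ [b]) ! 0" by (simp add: hd_conv_nth)
  then show ?case using Cons by (simp add: prod.lessThan_Suc_shift nth_append del: prod.lessThan_Suc)
qed simp

abbreviation rep :: "complex \<times> complex \<Rightarrow> bool" where
  "rep e \<equiv> e \<in> dirs (E - EA)"

lemma rep_iff: "e \<in> dirs E \<Longrightarrow> rep e \<longleftrightarrow> e \<notin> dirs EA"
  by (auto simp: dirs_def)

text \<open>As \<open>b\<close> is not listed, it is not counted in \<open>r\<close>; with
  \<open>b = a\<close> these are cyclic lists.\<close>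

definition Paths :: "nat \<Rightarrow> complex \<times> complex \<Rightarrow> complex \<times> complex \<Rightarrow> (complex \<times> complex) list set" where
  "Paths r a b = {es. es \<noteq> [] \<and> hd es = a \<and> set es \<subseteq> dirs E \<and> successively nobt (es @ [b]) \<and> length (filter rep es) = r}"

lemma filter_rep_EA: "set ds \<subseteq> dirs EA \<Longrightarrow> filter rep ds = []"
  by (auto simp: filter_empty_conv dirs_def)

lemma Paths_1:
  assumes "rep a"
  shows "Paths (Suc 0) a b = Pth a b"
proof (intro equalityI subsetI)
  fix es assume "es \<in> Paths (Suc 0) a b"
  then obtain ds where es: "es = a # ds" "set ds \<subseteq> dirs E" "successively nobt (es @ [b])" "length (filter rep es) = Suc 0"
    by (cases es) (auto simp: Paths_def)
  then have "filter rep ds = []" using assms by simp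
  then have "set ds \<subseteq> dirs EA" using es(2) rep_iff by (auto simp: filter_empty_conv)
  then show "es \<in> Pth a b" using es by (auto simp: Pth_def)
next
  fix es assume "es \<in> Pth a b"
  then obtain ds where es: "es = a # ds" "set ds \<subseteq> dirs EA" "successively nobt (es @ [b])"
    by (auto simp: Pth_def)
  have "a \<in> dirs E" using assms by (auto simp: dirs_def)
  then show "es \<in> Paths (Suc 0) a b"
    using es assms dirs_EA filter_rep_EA[OF es(2)] by (auto simp: Paths_def)
qed

text \<open>Cuts before the second representative edge, which exists because \<open>r\<close> is
  positive. The cut is determined by the list, and this gives injectivity of the
  concatenation.\<close>

lemma Paths_Suc:
  assumes a: "rep a" and r: "0 < r"
  shows "Paths (Suc r) a b = (\<lambda>(c, es, fs). es @ fs) ` (SIGMA c:dirs (E - EA). Pth a c \<times> Paths r c b)" (is "_ = ?f ` ?S")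
proof (intro equalityI subsetI)
  fix gs assume "gs \<in> Paths (Suc r) a b"
  then obtain ds where gs: "gs = a # ds" "set ds \<subseteq> dirs E" "successively nobt (gs @ [b])" "length (filter rep gs) = Suc r"
    by (cases gs) (auto simp: Paths_def)
  obtain t fs where tf: "ds = t @ fs" "\<And>e. e \<in> set t \<Longrightarrow> \<not> rep e" "fs \<noteq> [] \<Longrightarrow> rep (hd fs)"
  proof (rule that)
    show "ds = takeWhile (\<lambda>e. \<not> rep e) ds @ dropWhile (\<lambda>e. \<not> rep e) ds" by simp
    show "\<not> rep e" if "e \<in> set (takeWhile (\<lambda>e. \<not> rep e) ds)" for e using set_takeWhileD[OF that] by blast
    show "rep (hd (dropWhile (\<lambda>e. \<not> rep e) ds))" if "dropWhile (\<lambda>e. \<not> rep e) ds \<noteq> []" using hd_dropWhile[OF that] by blast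
  qed
  have nr: "set t \<subseteq> dirs EA" using gs(2) tf(1,2) rep_iff by fastforce
  have len: "length (filter rep fs) = r"
    using gs(1,4) a tf(1) filter_rep_EA[OF nr] by simp
  then have ne: "fs \<noteq> []" using r by auto
  have "successively nobt ((a # t) @ fs @ [b])" using gs(1,3) tf(1) by simp
  then have s: "successively nobt ((a # t) @ [hd fs])" "successively nobt (fs @ [b])"
    using successively_glue[OF ne] by blast+
  have "a # t \<in> Pth a (hd fs)" using nr s(1) by (auto simp: Pth_def)
  moreover have "fs \<in> Paths r (hd fs) b" using gs(2) tf(1) ne len s(2) by (simp add: Paths_def)
  ultimately have "(hd fs, a # t, fs) \<in> ?S" using tf(3)[OF ne] by simp
  then show "gs \<in> ?f ` ?S" using gs(1) tf(1) by (intro image_eqI[of _ _ "(hd fs, a # t, fs)"]) simp_all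
next
  fix gs assume "gs \<in> ?f ` ?S"
  then obtain c es fs where gs: "gs = es @ fs" "rep c" "es \<in> Pth a c" "fs \<in> Paths r c b" by auto
  obtain ds where es: "es = a # ds" "set ds \<subseteq> dirs EA" "successively nobt (es @ [c])"
    using gs by (auto simp: Pth_def)
  have fs: "fs \<noteq> []" "hd fs = c" "set fs \<subseteq> dirs E" "successively nobt (fs @ [b])" "length (filter rep fs) = r"
    using gs by (auto simp: Paths_def)
  have "successively nobt (es @ fs @ [b])"
    using es(3) fs successively_glue[OF fs(1)] by blast
  moreover have "a \<in> dirs E" using a by (auto simp: dirs_def)
  ultimately show "gs \<in> Paths (Suc r) a b"
    using gs es fs a dirs_EA filter_rep_EA[OF es(2)] by (auto simp: Paths_def)
qed

lemma Paths_Suc_inj: "inj_on (\<lambda>(c, es, fs). es @ fs) (SIGMA c:dirs (E - EA). Pth a c \<times> Paths r c b)"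
proof (rule inj_onI)
  fix p q
  assume p: "p \<in> (SIGMA c:dirs (E - EA). Pth a c \<times> Paths r c b)" and q: "q \<in> (SIGMA c:dirs (E - EA). Pth a c \<times> Paths r c b)"
    and pq: "(case p of (c, es, fs) \<Rightarrow> es @ fs) = (case q of (c, es, fs) \<Rightarrow> es @ fs)"
  obtain c es fs c' es' fs' where pq': "p = (c, es, fs)" "q = (c', es', fs')" by (cases p; cases q) blast
  have *: "rep c" "es \<in> Pth a c" "fs \<in> Paths r c b" "rep c'" "es' \<in> Pth a c'" "fs' \<in> Paths r c' b"
    and eq: "es @ fs = es' @ fs'"
    using p q pq pq' by auto
  have tw: "takeWhile (\<lambda>e. \<not> rep e) (ds @ fs) = ds" "dropWhile (\<lambda>e. \<not> rep e) (ds @ fs) = fs"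
    if "set ds \<subseteq> dirs EA" "fs \<noteq> []" "rep (hd fs)" for ds fs
  proof -
    have "\<not> rep e" if "e \<in> set ds" for e using that \<open>set ds \<subseteq> _\<close> by (auto simp: dirs_def)
    then show "takeWhile (\<lambda>e. \<not> rep e) (ds @ fs) = ds" "dropWhile (\<lambda>e. \<not> rep e) (ds @ fs) = fs"
      using that(2,3) by (cases fs; simp)+
  qed
  obtain ds where es: "es = a # ds" "set ds \<subseteq> dirs EA" using * by (auto simp: Pth_def)
  obtain ds' where es': "es' = a # ds'" "set ds' \<subseteq> dirs EA" using * by (auto simp: Pth_def)
  have fs: "fs \<noteq> []" "rep (hd fs)" "hd fs = c" and fs': "fs' \<noteq> []" "rep (hd fs')" "hd fs' = c'"
    using * by (auto simp: Paths_def)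
  have "ds @ fs = ds' @ fs'" using eq es es' by simp
  then have "ds = ds'" "fs = fs'"
    using tw[OF es(2) fs(1,2)] tw[OF es'(2) fs'(1,2)] by metis+
  then show "p = q" using es es' fs fs' pq' by simp
qed

lemma finite_Paths:
  assumes "0 < r" "rep a"
  shows "finite (Paths r a b)"
  using assms
proof (induction r arbitrary: a)
  case (Suc r)
  show ?case
  proof (cases "r = 0")
    case True
    then show ?thesis using Suc.prems Paths_1 finite_Pth by simp
  next
    case False
    then show ?thesis
      using Suc finite_dirs_subset[of "E - EA"] finite_Pth Paths_Suc[OF Suc.prems(2), of r b] by auto
  qed
qed simp

lemma pow_gram_G:
  assumes R: "distinct ds" "set ds = dirs (E - EA)" and r: "0 < r" and ij: "i < length ds" "j < length ds"
  shows "(gram (link_weight x) ds ^\<^sub>m r) $$ (i, j) = (\<Sum>es\<in>Paths r (ds ! i) (ds ! j). wt x es (ds ! j))"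
  using r ij
proof (induction r arbitrary: i)
  case (Suc r)
  let ?m = "length ds" and ?A = "gram (link_weight x) ds" and ?b = "ds ! j" and ?a = "ds ! i"
  have A: "?A \<in> carrier_mat ?m ?m" by simp
  have a: "rep ?a" using Suc.prems R nth_mem by blast
  show ?case
  proof (cases "r = 0")
    case True
    have "?A ^\<^sub>m Suc 0 = ?A" using A by simp
    then show ?thesis using True Suc.prems Paths_1[OF a] by (simp add: gram_def link_weight_def)
  next
    case False
    let ?S = "SIGMA c:dirs (E - EA). Pth ?a c \<times> Paths r c ?b"
    have finR: "finite (dirs (E - EA))" using finite_dirs_subset by blast
    have "(?A ^\<^sub>m Suc r) $$ (i, j) = (?A * ?A ^\<^sub>m r) $$ (i, j)"
      by (simp only: pow_mat_Suc_left[OF A])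
    also have "\<dots> = (\<Sum>k = 0..<?m. ?A $$ (i, k) * (?A ^\<^sub>m r) $$ (k, j))"
      using Suc.prems carrier_matD[OF A] carrier_matD[OF pow_carrier_mat[OF A, of r]] by (simp add: scalar_prod_def)
    also have "\<dots> = (\<Sum>k = 0..<?m. link_weight x ?a (ds ! k) * (\<Sum>fs\<in>Paths r (ds ! k) ?b. wt x fs ?b))"
      by (rule sum.cong[OF refl]) (use Suc False in \<open>simp add: gram_def\<close>)
    also have "\<dots> = (\<Sum>c\<in>dirs (E - EA). link_weight x ?a c * (\<Sum>fs\<in>Paths r c ?b. wt x fs ?b))"
      using sum_nth_distinct[OF R(1), of "\<lambda>c. link_weight x ?a c * (\<Sum>fs\<in>Paths r c ?b. wt x fs ?b)"] R(2)
      by (simp add: lessThan_atLeast0)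
    also have "\<dots> = (\<Sum>c\<in>dirs (E - EA). \<Sum>(es, fs)\<in>Pth ?a c \<times> Paths r c ?b. wt x es c * wt x fs ?b)"
      by (simp add: link_weight_def sum_product sum.cartesian_product)
    also have "\<dots> = (\<Sum>(c, es, fs)\<in>?S. wt x es c * wt x fs ?b)"
      using finR finite_Pth finite_Paths False by (subst sum.Sigma) (auto simp: case_prod_unfold)
    also have "\<dots> = (\<Sum>(c, es, fs)\<in>?S. wt x (es @ fs) ?b)"
      by (rule sum.cong[OF refl]) (auto simp: wt_append Paths_def)
    also have "\<dots> = (\<Sum>gs\<in>(\<lambda>(c, es, fs). es @ fs) ` ?S. wt x gs ?b)"
      by (subst sum.reindex[OF Paths_Suc_inj]) (simp add: case_prod_unfold comp_def)
    finally show ?thesis using Paths_Suc[OF a, of r ?b] False by simp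
  qed
qed simp

definition Cyc :: "nat \<Rightarrow> (complex \<times> complex) list set" where
  "Cyc r = (\<Union>a\<in>dirs (E - EA). Paths r a a)"

lemma finite_Cyc: "0 < r \<Longrightarrow> finite (Cyc r)"
  unfolding Cyc_def using finite_Paths finite_dirs_subset by blast

lemma trace_pow_gram_G:
  assumes R: "distinct ds" "set ds = dirs (E - EA)" and r: "0 < r"
  shows "(\<Sum>i = 0..<length ds. (gram (link_weight x) ds ^\<^sub>m r) $$ (i, i)) = (\<Sum>es\<in>Cyc r. wt x es (hd es))"
proof -
  have "(\<Sum>i = 0..<length ds. (gram (link_weight x) ds ^\<^sub>m r) $$ (i, i)) = (\<Sum>i = 0..<length ds. \<Sum>es\<in>Paths r (ds ! i) (ds ! i). wt x es (hd es))"
  proof (rule sum.cong[OF refl])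
    fix i assume "i \<in> {0..<length ds}"
    then have "(gram (link_weight x) ds ^\<^sub>m r) $$ (i, i) = (\<Sum>es\<in>Paths r (ds ! i) (ds ! i). wt x es (ds ! i))"
      using pow_gram_G[OF R r] by simp
    also have "\<dots> = (\<Sum>es\<in>Paths r (ds ! i) (ds ! i). wt x es (hd es))"
      by (rule sum.cong) (auto simp: Paths_def)
    finally show "(gram (link_weight x) ds ^\<^sub>m r) $$ (i, i) = (\<Sum>es\<in>Paths r (ds ! i) (ds ! i). wt x es (hd es))" .
  qed
  also have "\<dots> = (\<Sum>a\<in>dirs (E - EA). \<Sum>es\<in>Paths r a a. wt x es (hd es))"
    using sum_nth_distinct[OF R(1), of "\<lambda>a. \<Sum>es\<in>Paths r a a. wt x es (hd es)"] R(2)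
    by (simp add: lessThan_atLeast0)
  also have "\<dots> = (\<Sum>es\<in>Cyc r. wt x es (hd es))"
    unfolding Cyc_def
    by (rule sum.UNION_disjoint[symmetric]) (use finite_dirs_subset finite_Paths r in \<open>auto simp: Paths_def\<close>)
  finally show ?thesis .
qed

end

section \<open>Loops\<close>

text \<open>Integer indices modulo the length, so that reversal becomes the reflection
  \<open>i -> -1 - i\<close> next to the shifts.\<close>

definition nx :: "complex list \<Rightarrow> int \<Rightarrow> complex" where
  "nx l i = l ! nat (i mod int (length l))"

lemma nxt_eq_nx: "nxt l i = nx l (int i)"
  by (simp add: nxt_def nx_def zmod_int[symmetric])

lemma nx_cong: "i mod int (length l) = j mod int (length l) \<Longrightarrow> nx l i = nx l j"
  by (simp add: nx_def)

lemma nx_mod_add: "nx l (i mod int (length l) + c) = nx l (i + c)"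
  by (rule nx_cong) (simp add: mod_simps)

lemma nx_nth: "i < length l \<Longrightarrow> nx l (int i) = l ! i"
  by (simp add: nx_def)

lemma nx_rotate:
  assumes "l \<noteq> []"
  shows "nx (rotate k l) i = nx l (i + int k)"
proof -
  let ?n = "length l"
  define j where "j = nat (i mod int ?n)"
  have j: "j < ?n" "int j = i mod int ?n" using assms by (simp_all add: j_def nat_less_iff)
  have "nx (rotate k l) i = l ! ((k + j) mod ?n)" using j by (simp add: nx_def nth_rotate j_def[symmetric])
  also have "\<dots> = nx l (int (k + j))" by (simp only: nx_def zmod_int[symmetric] nat_int)
  also have "\<dots> = nx l (i + int k)" by (rule nx_cong) (simp add: j mod_simps add.commute)
  finally show ?thesis .
qed

lemma nx_rev:
  assumes "l \<noteq> []"
  shows "nx (rev l) i = nx l (- 1 - i)"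
proof -
  let ?n = "length l"
  define j where "j = nat (i mod int ?n)"
  have j: "j < ?n" "int j = i mod int ?n" using assms by (simp_all add: j_def nat_less_iff)
  have "nx (rev l) i = l ! (?n - Suc j)" using j by (simp add: nx_def rev_nth j_def[symmetric])
  also have "\<dots> = nx l (int (?n - Suc j))" by (rule nx_nth[symmetric]) (use j in simp)
  also have "\<dots> = nx l (- 1 - i)"
  proof (rule nx_cong)
    have "int (?n - Suc j) = int ?n + (- 1 - i mod int ?n)" using j by (simp add: of_nat_diff)
    then have "int (?n - Suc j) mod int ?n = (- 1 - i mod int ?n) mod int ?n" by (simp only: mod_add_self1)
    then show "int (?n - Suc j) mod int ?n = (- 1 - i) mod int ?n" by (simp only: mod_diff_right_eq)
  qed
  finally show ?thesis .
qed

lemma nx_ext: "length l = length l' \<Longrightarrow> (\<And>i. nx l i = nx l' i) \<Longrightarrow> l = l'"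
  by (rule nth_equalityI) (metis nx_nth)+

lemma bij_betw_shift_mod: "0 < n \<Longrightarrow> bij_betw (\<lambda>i. (i + c) mod n) {0..<n} {0..<n :: int}"
  by (rule bij_betw_byWitness[where f' = "\<lambda>i. (i - c) mod n"]) (auto simp: mod_simps)

lemma bij_betw_reflect_mod: "0 < n \<Longrightarrow> bij_betw (\<lambda>i. (c - i) mod n) {0..<n} {0..<n :: int}"
  by (rule bij_betw_byWitness[where f' = "\<lambda>i. (c - i) mod n"]) (auto simp: mod_simps)

lemma prod_shift_periodic:
  assumes "0 < n" "\<And>i. g (i mod n) = g i"
  shows "(\<Prod>i\<in>{0..<n :: int}. g (i + c)) = (\<Prod>i\<in>{0..<n}. g i)"
  using prod.reindex_bij_betw[OF bij_betw_shift_mod[OF assms(1)], of g c] by (simp add: assms(2))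

lemma prod_reflect_periodic:
  assumes "0 < n" "\<And>i. g (i mod n) = g i"
  shows "(\<Prod>i\<in>{0..<n :: int}. g (c - i)) = (\<Prod>i\<in>{0..<n}. g i)"
  using prod.reindex_bij_betw[OF bij_betw_reflect_mod[OF assms(1)], of g c] by (simp add: assms(2))

lemma sum_shift_periodic:
  assumes "0 < n" "\<And>i. g (i mod n) = g i"
  shows "(\<Sum>i\<in>{0..<n :: int}. g (i + c)) = (\<Sum>i\<in>{0..<n}. g i)"
  using sum.reindex_bij_betw[OF bij_betw_shift_mod[OF assms(1)], of g c] by (simp add: assms(2))

lemma sum_reflect_periodic:
  assumes "0 < n" "\<And>i. g (i mod n) = g i"
  shows "(\<Sum>i\<in>{0..<n :: int}. g (c - i)) = (\<Sum>i\<in>{0..<n}. g i)"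
  using sum.reindex_bij_betw[OF bij_betw_reflect_mod[OF assms(1)], of g c] by (simp add: assms(2))

lemma image_int_lessThan: "int ` {..<n} = {0..<int n}"
  by (auto simp: image_iff) (metis nonneg_int_cases of_nat_less_iff lessThan_iff)

lemma prod_int: "(\<Prod>i<n. f (int i)) = (\<Prod>i\<in>{0..<int n}. f i)"
  unfolding image_int_lessThan[symmetric] by (simp add: prod.reindex)

lemma sum_int: "(\<Sum>i<n. f (int i)) = (\<Sum>i\<in>{0..<int n}. f i)"
  unfolding image_int_lessThan[symmetric] by (simp add: sum.reindex)

definition eg :: "complex list \<Rightarrow> int \<Rightarrow> complex \<times> complex" where
  "eg l i = (nx l i, nx l (i + 1))"

lemma eg_mod: "eg l (i mod int (length l)) = eg l i" "eg l (i mod int (length l) + c) = eg l (i + c)"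
  using nx_mod_add[of l i 0] nx_mod_add[of l i 1] nx_mod_add[of l i c] nx_mod_add[of l i "c + 1"]
  by (simp_all add: eg_def add.assoc)

text \<open>The dihedral orbit described by the index maps \<open>i + c\<close> and
  \<open>c - i\<close>; their closure under composition and inverse makes it an equivalence
  class.\<close>

definition orb :: "complex list \<Rightarrow> complex list set" where
  "orb l = {l'. length l' = length l \<and> (\<exists>c. (\<forall>i. nx l' i = nx l (i + c)) \<or> (\<forall>i. nx l' i = nx l (c - i)))}"

lemma dihedral_orbit_eq_orb:
  assumes l: "l \<noteq> []"
  shows "dihedral_orbit l = orb l"
proof (intro equalityI subsetI)
  fix l' assume "l' \<in> dihedral_orbit l"
  then consider k where "l' = rotate k l" | k where "l' = rotate k (rev l)"
    by (auto simp: dihedral_orbit_def)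
  then show "l' \<in> orb l"
  proof cases
    case 1
    then show ?thesis using nx_rotate[OF l] by (auto simp: orb_def)
  next
    case 2
    then have "nx l' i = nx l ((- 1 - int k) - i)" for i
      using nx_rotate[of "rev l"] nx_rev[OF l] l by (simp add: algebra_simps)
    then show ?thesis using 2 by (auto simp: orb_def)
  qed
next
  fix l' assume "l' \<in> orb l"
  then have len: "length l' = length l" and "\<exists>c. (\<forall>i. nx l' i = nx l (i + c)) \<or> (\<forall>i. nx l' i = nx l (c - i))"
    by (auto simp: orb_def)
  then obtain c where "(\<forall>i. nx l' i = nx l (i + c)) \<or> (\<forall>i. nx l' i = nx l (c - i))" by blast
  then show "l' \<in> dihedral_orbit l"
  proof
    assume c: "\<forall>i. nx l' i = nx l (i + c)"
    define k where "k = nat (c mod int (length l))"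
    have k: "k < length l" "int k = c mod int (length l)" using l by (simp_all add: k_def nat_less_iff)
    have "l' = rotate k l"
      by (rule nx_ext) (simp_all add: len c nx_rotate[OF l] k, metis add.commute nx_mod_add)
    then show ?thesis using k by (auto simp: dihedral_orbit_def)
  next
    assume c: "\<forall>i. nx l' i = nx l (c - i)"
    define k where "k = nat ((- 1 - c) mod int (length l))"
    have k: "k < length l" "int k = (- 1 - c) mod int (length l)" using l by (simp_all add: k_def nat_less_iff)
    have "l' = rotate k (rev l)"
    proof (rule nx_ext)
      fix i
      have "nx (rotate k (rev l)) i = nx (rev l) ((- 1 - c) + i)"
        using nx_rotate[of "rev l" k i] nx_mod_add[of "rev l" "- 1 - c" i] l k by (simp add: add.commute)
      then show "nx l' i = nx (rotate k (rev l)) i" using c nx_rev[OF l] by simp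
    qed (simp add: len)
    then show ?thesis using k by (auto simp: dihedral_orbit_def)
  qed
qed

lemma orb_refl: "l \<in> orb l"
  by (auto simp: orb_def intro: exI[of _ 0])

lemma orb_sym:
  assumes "l' \<in> orb l"
  shows "l \<in> orb l'"
proof -
  have len: "length l' = length l" using assms by (simp add: orb_def)
  obtain c where "(\<forall>i. nx l' i = nx l (i + c)) \<or> (\<forall>i. nx l' i = nx l (c - i))"
    using assms by (auto simp: orb_def)
  then show ?thesis
  proof
    assume "\<forall>i. nx l' i = nx l (i + c)"
    then have "\<forall>i. nx l i = nx l' (i + (- c))" by simp
    then show ?thesis using len[symmetric] unfolding orb_def by blast
  next
    assume "\<forall>i. nx l' i = nx l (c - i)"
    then have "\<forall>i. nx l i = nx l' (c - i)" by simp
    then show ?thesis using len[symmetric] unfolding orb_def by blast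
  qed
qed

lemma orb_trans:
  assumes "l'' \<in> orb l'" "l' \<in> orb l"
  shows "l'' \<in> orb l"
proof -
  have len: "length l'' = length l" using assms by (simp add: orb_def)
  obtain c where c: "(\<forall>i. nx l' i = nx l (i + c)) \<or> (\<forall>i. nx l' i = nx l (c - i))"
    using assms(2) by (auto simp: orb_def)
  obtain d where d: "(\<forall>i. nx l'' i = nx l' (i + d)) \<or> (\<forall>i. nx l'' i = nx l' (d - i))"
    using assms(1) by (auto simp: orb_def)
  have "(\<forall>i. nx l'' i = nx l (i + (d + c))) \<or> (\<forall>i. nx l'' i = nx l ((c - d) - i)) \<or>
      (\<forall>i. nx l'' i = nx l ((d + c) - i)) \<or> (\<forall>i. nx l'' i = nx l (i + (c - d)))"
    using c d by (elim disjE) (simp_all add: algebra_simps)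
  then show ?thesis using len unfolding orb_def by blast
qed

lemma orb_eq: "l' \<in> orb l \<Longrightarrow> orb l' = orb l"
  using orb_sym orb_trans by blast

abbreviation vless_rel :: "(complex \<times> complex) set" where
  "vless_rel \<equiv> {(a, b). vless a b}"

lemma lexord_vless_trans: "(a, b) \<in> lexord vless_rel \<Longrightarrow> (b, c) \<in> lexord vless_rel \<Longrightarrow> (a, c) \<in> lexord vless_rel"
  by (rule lexord_trans) (auto simp: trans_def vless_def)

lemma lexord_vless_irrefl: "(a, a) \<notin> lexord vless_rel"
  by (rule lexord_irreflexive) (auto simp: vless_def)

lemma lexord_vless_total: "(a, b) \<in> lexord vless_rel \<or> a = b \<or> (b, a) \<in> lexord vless_rel"
  by (rule lexord_linear) (auto simp: vless_def complex_eq_iff)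

lemma lexle_antisym: "lexle a b \<Longrightarrow> lexle b a \<Longrightarrow> a = b"
  using lexord_vless_trans lexord_vless_irrefl by (auto simp: lexle_def)

lemma ex_lexle_min:
  assumes "finite S" "S \<noteq> {}"
  shows "\<exists>m\<in>S. \<forall>l\<in>S. lexle m l"
proof -
  have "\<exists>L. distinct L \<and> set L = S \<and> sorted_wrt (\<lambda>a b. (a, b) \<in> lexord vless_rel) L"
    by (rule ex_sorted_wrt_list[OF assms(1)]) (use lexord_vless_trans lexord_vless_total in blast)+
  then obtain L where L: "set L = S" "sorted_wrt (\<lambda>a b. (a, b) \<in> lexord vless_rel) L" by blast
  then obtain m L' where "L = m # L'" using assms(2) by (cases L) auto
  then show ?thesis using L by (intro bexI[of _ m]) (auto simp: lexle_def)
qed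

context plane_graph
begin

lemma closed_path_iff:
  "closed_path E l \<longleftrightarrow> l \<noteq> [] \<and> (\<forall>i. eg l i \<in> dirs E \<and> nobt (eg l i) (eg l (i + 1)))"
proof
  assume l: "closed_path E l"
  then have ne: "l \<noteq> []" by (auto simp: closed_path_def)
  have "{nx l i, nx l (i + 1)} \<in> E \<and> nx l (i + 2) \<noteq> nx l i" for i
  proof -
    define j where "j = nat (i mod int (length l))"
    have j: "j < length l" "int j = i mod int (length l)" using ne by (simp_all add: j_def nat_less_iff)
    have "{nxt l j, nxt l (j + 1)} \<in> E \<and> nxt l (j + 2) \<noteq> nxt l j"
      using l j(1) by (simp add: closed_path_def)
    then have "{nx l (int j), nx l (int j + 1)} \<in> E \<and> nx l (int j + 2) \<noteq> nx l (int j)"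
      unfolding nxt_eq_nx of_nat_add of_nat_1 of_nat_numeral .
    moreover have "nx l (int j) = nx l i" "nx l (int j + 1) = nx l (i + 1)" "nx l (int j + 2) = nx l (i + 2)"
      using nx_mod_add[of l i 0] nx_mod_add[of l i 1] nx_mod_add[of l i 2] by (simp_all add: j(2))
    ultimately show ?thesis by simp
  qed
  then show "l \<noteq> [] \<and> (\<forall>i. eg l i \<in> dirs E \<and> nobt (eg l i) (eg l (i + 1)))"
    using ne by (auto simp: eg_def dirs_def nobt_def add.assoc dest: sym)
next
  assume r: "l \<noteq> [] \<and> (\<forall>i. eg l i \<in> dirs E \<and> nobt (eg l i) (eg l (i + 1)))"
  then have "{nx l i, nx l (i + 1)} \<in> E \<and> nx l (i + 2) \<noteq> nx l i" for i
    by (auto simp: eg_def dirs_def nobt_def add.assoc) (metis)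
  then show "closed_path E l" using r
    by (auto simp: closed_path_def nxt_eq_nx Suc_le_eq) (metis add.commute of_nat_Suc)+
qed

end

context sorted_plane_graph
begin

text \<open>The half-angle factors of \<open>step_gauge\<close> telescope around a cycle, leaving
  edge weights and signs only.\<close>

lemma cyclic_step_prod:
  fixes x :: "complex set \<Rightarrow> complex" and a :: "int \<Rightarrow> nat"
  assumes n: "0 < m" and per: "\<And>i. a (i mod m) = a i" and an: "\<And>i. a i < n"
  shows "(\<Prod>i\<in>{0..<m}. step x (L ! a i) (L ! a (i + 1))) =
    (\<Prod>i\<in>{0..<m}. x (ed (a i)) * kap (a i)) * (\<Prod>i\<in>{0..<m}. nu (r (a i)) (a (i + 1)))"
proof -
  define d where "d = (\<lambda>i. exp (\<i> * of_real (angle (L ! i)) / 2))"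
  have "(\<Prod>i\<in>{0..<m}. step x (L ! a i) (L ! a (i + 1))) =
      (\<Prod>i\<in>{0..<m}. (x (ed (a i)) * kap (a i)) * nu (r (a i)) (a (i + 1)) * (d (a (i + 1)) / d (a i)))"
    by (rule prod.cong) (simp_all add: step_gauge[OF an an] d_def)
  also have "\<dots> = (\<Prod>i\<in>{0..<m}. x (ed (a i)) * kap (a i)) * (\<Prod>i\<in>{0..<m}. nu (r (a i)) (a (i + 1))) *
      ((\<Prod>i\<in>{0..<m}. d (a (i + 1))) / (\<Prod>i\<in>{0..<m}. d (a i)))"
    by (simp only: prod.distrib prod_dividef)
  also have "(\<Prod>i\<in>{0..<m}. d (a (i + 1))) = (\<Prod>i\<in>{0..<m}. d (a i))"
    by (rule prod_shift_periodic[OF n]) (simp add: per)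
  finally show ?thesis by (simp add: d_def)
qed

text \<open>Reversing a cycle flips both \<open>kap\<close> and \<open>nu\<close> in every factor.\<close>

lemma cyclic_step_prod_reverse:
  fixes x :: "complex set \<Rightarrow> complex" and a :: "int \<Rightarrow> nat"
  assumes m: "0 < m" and per: "\<And>i. a (i mod m) = a i" and an: "\<And>i. a i < n"
  shows "(\<Prod>i\<in>{0..<m}. step x (L ! r (a (c - i))) (L ! r (a (c - (i + 1))))) = (\<Prod>i\<in>{0..<m}. step x (L ! a i) (L ! a (i + 1)))"
proof -
  have per': "a (i mod m + k) = a (i + k)" for i k
    using per[of "i mod m + k"] per[of "i + k"] by (simp add: mod_simps)
  have per2: "a (c - i mod m) = a (c - i)" for i
    using per[of "c - i mod m"] per[of "c - i"] by (simp add: mod_simps)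
  have "(\<Prod>i\<in>{0..<m}. step x (L ! r (a (c - i))) (L ! r (a (c - (i + 1))))) =
     (\<Prod>i\<in>{0..<m}. x (ed (r (a (c - i)))) * kap (r (a (c - i)))) * (\<Prod>i\<in>{0..<m}. nu (r (r (a (c - i)))) (r (a (c - (i + 1)))))"
    by (rule cyclic_step_prod[OF m]) (simp_all add: per2 r_less an)
  also have "\<dots> = (\<Prod>i\<in>{0..<m}. x (ed (r (a (c - i)))) * kap (r (a (c - i))) * nu (r (r (a (c - i)))) (r (a (c - (i + 1)))))"
    by (simp only: prod.distrib)
  \<comment> \<open>The turn at place \<open>i\<close> of the reversed cycle is the turn at place
    \<open>c - 1 - i\<close> of the original, while the edge is the one at place
    \<open>c - i\<close>; hence two reflections with different centres follow.\<close>
  also have "\<dots> = (\<Prod>i\<in>{0..<m}. x (ed (a (c - i))) * kap (a (c - i)) * nu (r (a ((c - 1) - i))) (a ((c - 1) - i + 1)))"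
  proof (rule prod.cong[OF refl])
    fix i
    have e: "c - (i + 1) = (c - 1) - i" by simp
    show "x (ed (r (a (c - i)))) * kap (r (a (c - i))) * nu (r (r (a (c - i)))) (r (a (c - (i + 1)))) =
      x (ed (a (c - i))) * kap (a (c - i)) * nu (r (a ((c - 1) - i))) (a ((c - 1) - i + 1))"
      unfolding e using nu_skew[of "a (c - i)" "r (a ((c - 1) - i))"] by (simp add: ed_r an kap_r r_r)
  qed
  also have "\<dots> = (\<Prod>i\<in>{0..<m}. x (ed (a (c - i))) * kap (a (c - i))) * (\<Prod>i\<in>{0..<m}. nu (r (a ((c - 1) - i))) (a ((c - 1) - i + 1)))"
    by (simp only: prod.distrib)
  also have "(\<Prod>i\<in>{0..<m}. x (ed (a (c - i))) * kap (a (c - i))) = (\<Prod>i\<in>{0..<m}. x (ed (a i)) * kap (a i))"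
    by (rule prod_reflect_periodic[OF m]) (simp add: per)
  also have "(\<Prod>i\<in>{0..<m}. nu (r (a ((c - 1) - i))) (a ((c - 1) - i + 1))) = (\<Prod>i\<in>{0..<m}. nu (r (a i)) (a (i + 1)))"
    by (rule prod_reflect_periodic[OF m, of "\<lambda>i. nu (r (a i)) (a (i + 1))"]) (simp add: per per')
  also have "(\<Prod>i\<in>{0..<m}. x (ed (a i)) * kap (a i)) * \<dots> = (\<Prod>i\<in>{0..<m}. step x (L ! a i) (L ! a (i + 1)))"
    by (rule cyclic_step_prod[where a = a, OF m per an, symmetric])
  finally show ?thesis .
qed

end

context plane_graph
begin

definition cyc_weight :: "(complex set \<Rightarrow> complex) \<Rightarrow> complex list \<Rightarrow> complex" where
  "cyc_weight x l = (\<Prod>i\<in>{0..<int (length l)}. step x (eg l i) (eg l (i + 1)))"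

lemma closed_path_orb:
  assumes l: "closed_path E l" and l': "l' \<in> orb l"
  shows "closed_path E l'" "cyc_weight x l' = cyc_weight x l" "loop_length E EA l' = loop_length E EA l"
proof -
  have ne: "l \<noteq> []" and dd: "\<And>i. eg l i \<in> dirs E" and nb: "\<And>i. nobt (eg l i) (eg l (i + 1))"
    using l by (auto simp: closed_path_iff)
  have len: "length l' = length l" using l' by (simp add: orb_def)
  have m: "0 < int (length l)" using ne by simp
  have ll: "loop_length E EA l = (\<Sum>i\<in>{0..<int (length l)}. if eg l i \<in> dirs (E - EA) then 1 else 0)" if "l \<noteq> []" for l
  proof -
    have "loop_length E EA l = card {i\<in>{..<length l}. eg l (int i) \<in> dirs (E - EA)}"
      by (simp add: loop_length_def nxt_eq_nx eg_def dirs_def add.commute)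
    also have "\<dots> = (\<Sum>i<length l. if eg l (int i) \<in> dirs (E - EA) then 1 else 0)"
      by (simp add: sum.If_cases Int_def)
    also have "\<dots> = (\<Sum>i\<in>{0..<int (length l)}. if eg l i \<in> dirs (E - EA) then 1 else 0)"
      by (rule sum_int)
    finally show ?thesis .
  qed
  have ne': "l' \<noteq> []" using len ne by auto
  obtain c where "(\<forall>i. nx l' i = nx l (i + c)) \<or> (\<forall>i. nx l' i = nx l (c - i))"
    using l' by (auto simp: orb_def)
  then have "closed_path E l' \<and> cyc_weight x l' = cyc_weight x l \<and> loop_length E EA l' = loop_length E EA l"
  proof
    assume c: "\<forall>i. nx l' i = nx l (i + c)"
    then have eg: "eg l' i = eg l (i + c)" for i by (simp add: eg_def algebra_simps)
    have "nobt (eg l' i) (eg l' (i + 1))" for i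
      using nb[of "i + c"] by (simp add: eg algebra_simps)
    then have "closed_path E l'" using ne' dd by (simp add: closed_path_iff eg)
    moreover have "cyc_weight x l' = cyc_weight x l"
    proof -
      have "(\<Prod>i\<in>{0..<int (length l)}. step x (eg l (i + c)) (eg l (i + c + 1))) = cyc_weight x l"
        unfolding cyc_weight_def by (rule prod_shift_periodic[OF m]) (simp only: eg_mod)
      then show ?thesis by (simp add: cyc_weight_def len eg ac_simps)
    qed
    moreover have "loop_length E EA l' = loop_length E EA l"
      using sum_shift_periodic[OF m, of "\<lambda>i. if eg l i \<in> dirs (E - EA) then 1 else (0::nat)" c]
      by (simp add: ll ne ne' len eg eg_mod)
    ultimately show ?thesis by blast
  next
    assume c: "\<forall>i. nx l' i = nx l (c - i)"
    \<comment> \<open>If vertices are reflected by \<open>c - i\<close>, step \<open>i\<close> runs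
      backwards along step \<open>c - 1 - i\<close>.\<close>
    then have eg: "eg l' i = prod.swap (eg l ((c - 1) - i))" for i by (simp add: eg_def algebra_simps)
    have sw: "prod.swap e \<in> dirs F \<longleftrightarrow> e \<in> dirs F" for e F
      by (cases e) (simp add: dirs_def insert_commute)
    have "nobt (eg l' i) (eg l' (i + 1))" for i
      using nb[of "c - 1 - (i + 1)"] by (auto simp: eg nobt_def algebra_simps)
    then have "closed_path E l'" using ne' dd by (simp add: closed_path_iff eg sw)
    moreover have "cyc_weight x l' = cyc_weight x l"
    proof -
      obtain L where L: "distinct L" "set L = dirs E" "sorted_wrt dirless L"
        using ex_sorted_dirs by blast
      interpret sorted_plane_graph V E L by unfold_locales (use L in auto)
      define a where "a = (\<lambda>i. ix (eg l i))"
      have a: "a i < n" "L ! a i = eg l i" for i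
        using ix_less nth_ix dd by (simp_all add: a_def)
      have "(\<Prod>i\<in>{0..<int (length l)}. step x (L ! r (a ((c - 1) - i))) (L ! r (a ((c - 1) - (i + 1))))) =
          (\<Prod>i\<in>{0..<int (length l)}. step x (L ! a i) (L ! a (i + 1)))"
        by (rule cyclic_step_prod_reverse[OF m _ a(1)]) (simp add: a_def eg_mod)
      then show ?thesis by (simp only: cyc_weight_def len eg nth_r[OF a(1)] a(2))
    qed
    moreover have "loop_length E EA l' = loop_length E EA l"
      using sum_reflect_periodic[OF m, of "\<lambda>i. if eg l i \<in> dirs (E - EA) then 1 else (0::nat)" "c - 1"]
      by (simp add: ll ne ne' len eg sw eg_mod)
    ultimately show ?thesis by blast
  qed
  then show "closed_path E l'" "cyc_weight x l' = cyc_weight x l" "loop_length E EA l' = loop_length E EA l" by auto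
qed

lemma loop_weight_eq:
  assumes "closed_path E l"
  shows "loop_weight x l = - cyc_weight x l / of_nat (multiplicity_loop l)"
proof -
  have nb: "nobt (eg l i) (eg l (i + 1))" for i using assms by (simp add: closed_path_iff)
  let ?t = "\<lambda>i. turn (nx l (i+1) - nx l i) (nx l (i+2) - nx l (i+1))"
  have "cyc_weight x l = (\<Prod>i\<in>{0..<int (length l)}. x {nx l i, nx l (i + 1)} * exp (\<i> * of_real (?t i) / 2))"
    unfolding cyc_weight_def by (rule prod.cong) (use nb in \<open>auto simp: step_def eg_def nobt_def add.assoc\<close>)
  also have "\<dots> = (\<Prod>i<length l. x {nx l (int i), nx l (int i + 1)} * exp (\<i> * of_real (?t (int i)) / 2))"
    by (rule prod_int[symmetric])
  also have "\<dots> = (\<Prod>i<length l. x {nx l (int i), nx l (int i + 1)}) * exp (\<Sum>i<length l. \<i> * of_real (?t (int i)) / 2)"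
    by (simp add: prod.distrib exp_sum)
  also have "(\<Sum>i<length l. \<i> * of_real (?t (int i)) / 2) = \<i> * of_real (winding l) / 2"
    by (simp add: winding_def nxt_eq_nx sum_distrib_left sum_divide_distrib add.commute)
  finally have "cyc_weight x l = (\<Prod>i<length l. x {nxt l i, nxt l (i + 1)}) * exp (\<i> * of_real (winding l) / 2)"
    by (simp add: nxt_eq_nx add.commute)
  then show ?thesis by (simp add: loop_weight_def loop_sign_def)
qed

text \<open>There are \<open>p\<close> distinct rotations and as many reversals. No rotation equals
  a reversal: the resulting reflection symmetry would have its axis at a vertex or at an
  edge.\<close>

lemma card_orb:
  assumes l: "closed_path E l"
  defines "p \<equiv> LEAST p. 0 < p \<and> rotate p l = l"
  shows "card (orb l) = 2 * p" "0 < p" "p dvd length l"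
proof -
  have ne: "l \<noteq> []" and nb: "\<And>i. nobt (eg l i) (eg l (i + 1))" and dd: "\<And>i. eg l i \<in> dirs E"
    using l by (auto simp: closed_path_iff)
  let ?n = "length l"
  have ex: "0 < ?n \<and> rotate ?n l = l" using ne by simp
  then have p: "0 < p" "rotate p l = l" unfolding p_def by (metis (mono_tags, lifting) LeastI)+
  have min: "rotate q l \<noteq> l" if "0 < q" "q < p" for q
    using not_less_Least[of q "\<lambda>p. 0 < p \<and> rotate p l = l"] that unfolding p_def by blast
  show "0 < p" by fact
  have per: "rotate (k * p) l = l" for k
    by (induction k) (simp_all add: rotate_add[symmetric] p(2), metis p(2) rotate_rotate)
  have rmod: "rotate k l = rotate (k mod p) l" for k
  proof -
    have "rotate k l = rotate (k mod p + k div p * p) l" by (simp add: mod_div_mult_eq)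
    also have "\<dots> = rotate (k mod p) l" unfolding rotate_rotate[symmetric] per ..
    finally show ?thesis .
  qed
  have "rotate (?n mod p) l = l" using rmod[of ?n] by simp
  then have "?n mod p = 0" using min[of "?n mod p"] p(1) by (metis gr0I mod_less_divisor)
  then show "p dvd ?n" by (rule mod_0_imp_dvd)
  then have pn: "p \<le> ?n" using ne by (simp add: dvd_imp_le)
  let ?A = "(\<lambda>k. rotate k l) ` {..<p}"
  have A: "{rotate k l | k. k < ?n} = ?A"
  proof (intro equalityI subsetI)
    fix y assume "y \<in> {rotate k l | k. k < ?n}"
    then obtain k where "y = rotate (k mod p) l" using rmod by auto
    then show "y \<in> ?A" using p(1) by auto
  qed (use pn in auto)
  have inj: "inj_on (\<lambda>k. rotate k l) {..<p}"
  proof (rule inj_onI)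
    have less: False if "i < j" "j < p" "rotate i l = rotate j l" for i j
    proof -
      have "rotate (p - i) (rotate i l) = l" using that(1,2) p(2) by (simp add: rotate_rotate)
      moreover have "rotate (p - i) (rotate j l) = rotate (j - i) l"
      proof -
        have "p - i + j = (j - i) + p" using that by simp
        then show ?thesis using p(2) by (metis rotate_rotate)
      qed
      ultimately have "rotate (j - i) l = l" using that(3) by simp
      then show False using min[of "j - i"] that by simp
    qed
    fix i j assume "i \<in> {..<p}" "j \<in> {..<p}" "rotate i l = rotate j l"
    then show "i = j" using less[of i j] less[of j i] by (cases i j rule: linorder_cases) auto
  qed
  have B: "{rotate k (rev l) | k. k < ?n} = rev ` ?A"
  proof -
    have r: "rotate k (rev l) = rev (rotate (?n - k) l)" if "k < ?n" for k
      using that rotate_rev[of k l] by (cases "k = 0") auto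
    have r': "rev (rotate k l) = rotate (?n - k) (rev l)" if "k < ?n" for k
      using that rotate_rev[of "?n - k" l] by (cases "k = 0") auto
    show ?thesis
      unfolding A[symmetric]
    proof (intro equalityI subsetI)
      fix y assume "y \<in> {rotate k (rev l) | k. k < ?n}"
      then obtain k where k: "k < ?n" "y = rev (rotate (?n - k) l)" using r by auto
      have "rotate (?n - k) l = rotate ((?n - k) mod ?n) l" by (rule rotate_conv_mod)
      moreover have "(?n - k) mod ?n < ?n" using ne by simp
      ultimately show "y \<in> rev ` {rotate k l | k. k < ?n}" using k(2) by blast
    next
      fix y assume "y \<in> rev ` {rotate k l | k. k < ?n}"
      then obtain k where k: "k < ?n" "y = rotate (?n - k) (rev l)" using r' by auto
      have "rotate (?n - k) (rev l) = rotate ((?n - k) mod ?n) (rev l)" using rotate_conv_mod[of "?n - k" "rev l"] by simp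
      moreover have "(?n - k) mod ?n < ?n" using ne by simp
      ultimately show "y \<in> {rotate k (rev l) | k. k < ?n}" using k(2) by blast
    qed
  qed
  have disj: "?A \<inter> rev ` ?A = {}"
  proof (rule ccontr)
    assume "?A \<inter> rev ` ?A \<noteq> {}"
    then obtain j k where jk: "rotate j l = rev (rotate k l)" by blast
    define c where "c = int k - 1 + int j"
    have sym: "nx l i = nx l (c - i)" for i
    proof -
      have "nx (rotate j l) (i - int j) = nx (rev (rotate k l)) (i - int j)" using jk by simp
      then show ?thesis using ne by (simp add: nx_rotate nx_rev c_def algebra_simps)
    qed
    \<comment> \<open>An axis at a vertex identifies its two neighbours, which is backtracking; an
      axis at an edge identifies the ends of that edge.\<close>
    show False
    proof (cases "even c")
      case True
      then obtain s where s: "c = 2 * s" by (elim evenE)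
      have "nx l (s - 1 + 2) \<noteq> nx l (s - 1)" using nb[of "s - 1"] by (auto simp: nobt_def eg_def algebra_simps)
      moreover have "nx l (s - 1 + 2) = nx l (s - 1)" using sym[of "s - 1"] s by (simp add: algebra_simps)
      ultimately show False by blast
    next
      case False
      then obtain s where s: "c = 2 * s + 1" by (elim oddE)
      have "nx l s = nx l (s + 1)" using sym[of s] s by (simp add: algebra_simps)
      then show False using dirsD(3)[of "nx l s" "nx l (s + 1)"] dd[of s] by (simp add: eg_def)
    qed
  qed
  have "orb l = ?A \<union> rev ` ?A"
    using dihedral_orbit_eq_orb[OF ne] A B by (simp add: dihedral_orbit_def)
  then have "card (orb l) = card ?A + card (rev ` ?A)"
    using disj by (simp add: card_Un_disjoint)
  also have "card (rev ` ?A) = card ?A" by (rule card_image) (simp add: inj_on_def)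
  also have "card ?A = p" using card_image[OF inj] by simp
  finally show "card (orb l) = 2 * p" by simp
qed

end

context forest_graph
begin

section \<open>From cyclic lists of directed edges to loops\<close>

definition CP :: "nat \<Rightarrow> complex list set" where
  "CP r = {l. closed_path E l \<and> loop_length E EA l = r}"

definition edges_of :: "complex list \<Rightarrow> (complex \<times> complex) list" where
  "edges_of l = map (\<lambda>i. eg l (int i)) [0..<length l]"

lemma loop_length_count: "loop_length E EA l = card {i. i < length l \<and> rep (eg l (int i))}"
  by (simp add: loop_length_def nxt_eq_nx eg_def dirs_def add.commute)

lemma successively_cyclic:
  assumes "es \<noteq> []"
  shows "successively P (es @ [hd es]) \<longleftrightarrow> (\<forall>i<length es. P (es ! i) (es ! (Suc i mod length es)))"
proof -
  have "(es @ [hd es]) ! Suc i = es ! (Suc i mod length es)" if "i < length es" for i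
    using that assms by (cases "Suc i = length es") (auto simp: nth_append hd_conv_nth)
  then show ?thesis
    by (auto simp: successively_conv_nth nth_append less_Suc_eq_le)
qed

lemma edges_of_Cyc:
  assumes l: "l \<in> CP r" and rep0: "rep (eg l 0)"
  shows "edges_of l \<in> Cyc r" "map fst (edges_of l) = l" "wt x (edges_of l) (hd (edges_of l)) = cyc_weight x l"
proof -
  have ne: "l \<noteq> []" and dd: "\<And>i. eg l i \<in> dirs E" and nb: "\<And>i. nobt (eg l i) (eg l (i + 1))"
    using l by (auto simp: CP_def closed_path_iff)
  let ?es = "edges_of l"
  have len: "length ?es = length l" and nes: "?es \<noteq> []" using ne by (auto simp: edges_of_def)
  have hd: "hd ?es = eg l 0" using ne by (simp add: edges_of_def hd_map)
  have nth: "?es ! i = eg l (int i)" if "i < length l" for i using that by (simp add: edges_of_def)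
  have nthS: "?es ! (Suc i mod length l) = eg l (int i + 1)" for i
  proof -
    have "Suc i mod length l < length l" using ne by simp
    then have "?es ! (Suc i mod length l) = eg l (int (Suc i) mod int (length l))"
      using nth by (simp add: zmod_int)
    then show ?thesis using eg_mod(1)[of l "int (Suc i)"] by (simp add: add.commute)
  qed
  have s: "successively nobt (?es @ [hd ?es])"
    unfolding successively_cyclic[OF nes] len using nb nth nthS by simp
  have "length (filter rep ?es) = card {i. i < length l \<and> rep (?es ! i)}"
    by (simp add: length_filter_conv_card len)
  also have "{i. i < length l \<and> rep (?es ! i)} = {i. i < length l \<and> rep (eg l (int i))}" using nth by auto
  finally have "length (filter rep ?es) = r" using l by (simp add: CP_def loop_length_count)
  moreover have "set ?es \<subseteq> dirs E" using dd by (auto simp: edges_of_def)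
  ultimately have "?es \<in> Paths r (hd ?es) (hd ?es)" using s nes by (simp add: Paths_def)
  then show "?es \<in> Cyc r" using rep0 hd by (auto simp: Cyc_def)
  show "map fst ?es = l"
    by (rule nth_equalityI) (auto simp: len nth eg_def nx_nth)
  have "wt x ?es (hd ?es) = (\<Prod>i<length l. step x (?es ! i) ((?es @ [hd ?es]) ! Suc i))"
    by (simp add: wt_eq_prod len)
  also have "\<dots> = (\<Prod>i<length l. step x (eg l (int i)) (eg l (int i + 1)))"
  proof (rule prod.cong[OF refl])
    fix i assume i: "i \<in> {..<length l}"
    have "(?es @ [hd ?es]) ! Suc i = ?es ! (Suc i mod length l)"
      using i nes len by (cases "Suc i = length l") (auto simp: nth_append hd_conv_nth)
    then show "step x (?es ! i) ((?es @ [hd ?es]) ! Suc i) = step x (eg l (int i)) (eg l (int i + 1))"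
      using i nth nthS by simp
  qed
  also have "\<dots> = cyc_weight x l" unfolding cyc_weight_def by (rule prod_int)
  finally show "wt x ?es (hd ?es) = cyc_weight x l" .
qed

lemma Cyc_map_fst:
  assumes "es \<in> Cyc r"
  shows "map fst es \<in> CP r" "rep (eg (map fst es) 0)" "edges_of (map fst es) = es"
proof -
  obtain a where a: "rep a" "es \<in> Paths r a a" using assms by (auto simp: Cyc_def)
  then have es: "es \<noteq> []" "set es \<subseteq> dirs E" "successively nobt (es @ [hd es])" "length (filter rep es) = r" "rep (hd es)"
    by (auto simp: Paths_def)
  let ?l = "map fst es" and ?n = "length es"
  have nb: "nobt (es ! i) (es ! (Suc i mod ?n))" if "i < ?n" for i
    using es(3) that unfolding successively_cyclic[OF es(1)] by blast
  have eg: "eg ?l (int i) = es ! i" if "i < ?n" for i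
  proof -
    have m: "Suc i mod ?n < ?n" using es(1) by simp
    have "nx ?l (int i + 1) = fst (es ! (Suc i mod ?n))"
      using m by (simp add: nx_def zmod_int[symmetric] add.commute flip: of_nat_Suc)
    also have "\<dots> = snd (es ! i)" using nb[OF that] by (simp add: nobt_def)
    finally show ?thesis using that by (simp add: eg_def nx_nth[of i ?l] prod_eq_iff)
  qed
  have eg': "eg ?l i = es ! nat (i mod int ?n)" for i
  proof -
    have "nat (i mod int ?n) < ?n" "int (nat (i mod int ?n)) = i mod int ?n" using es(1) by (simp_all add: nat_less_iff)
    then show ?thesis using eg[of "nat (i mod int ?n)"] eg_mod(1)[of ?l i] by simp
  qed
  have "eg ?l i \<in> dirs E \<and> nobt (eg ?l i) (eg ?l (i + 1))" for i
  proof -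
    define j where "j = nat (i mod int ?n)"
    have j: "j < ?n" "int j = i mod int ?n" using es(1) by (simp_all add: j_def nat_less_iff)
    have "int (Suc j mod ?n) = (i + 1) mod int ?n"
      by (simp add: zmod_int j mod_simps add.commute)
    then have "nat ((i + 1) mod int ?n) = Suc j mod ?n" by linarith
    then have "eg ?l (i + 1) = es ! (Suc j mod ?n)" by (simp add: eg')
    moreover have "eg ?l i = es ! j" by (simp add: eg' j_def)
    ultimately show ?thesis using nb[OF j(1)] es(2) j(1) nth_mem by auto
  qed
  then have cp: "closed_path E ?l" using es(1) by (simp add: closed_path_iff)
  have "{i. i < length ?l \<and> rep (eg ?l (int i))} = {i. i < ?n \<and> rep (es ! i)}" using eg by auto
  then have "loop_length E EA ?l = r"
    using es(4) by (simp add: loop_length_count length_filter_conv_card)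
  then show "?l \<in> CP r" using cp by (simp add: CP_def)
  show "rep (eg ?l 0)" using eg[of 0] es by (simp add: hd_conv_nth)
  show "edges_of ?l = es"
    by (rule nth_equalityI) (auto simp: edges_of_def eg)
qed

lemma sum_Cyc: "(\<Sum>es\<in>Cyc r. wt x es (hd es)) = (\<Sum>l\<in>{l\<in>CP r. rep (eg l 0)}. cyc_weight x l)"
  by (rule sum.reindex_bij_witness[of _ edges_of "map fst"])
    (use edges_of_Cyc Cyc_map_fst in \<open>auto, metis\<close>)

lemma rotate_orb: "l \<noteq> [] \<Longrightarrow> rotate k l \<in> orb l"
  by (auto simp: orb_def nx_rotate)

lemma rotate_CP: "l \<in> CP r \<Longrightarrow> rotate k l \<in> CP r"
  using closed_path_orb[OF _ rotate_orb[of l k]] by (auto simp: CP_def closed_path_iff)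

lemma eg_rotate: "l \<noteq> [] \<Longrightarrow> eg (rotate k l) i = eg l (i + int k)"
  by (simp add: eg_def nx_rotate algebra_simps)

lemma CP_nonempty: "l \<in> CP r \<Longrightarrow> l \<noteq> []"
  by (auto simp: CP_def closed_path_def)

text \<open>With \<open>r\<close> positive, a rotation brings a representative edge to the front,
  which lands in the finite set \<open>Cyc r\<close>.\<close>

lemma finite_CP:
  assumes r: "0 < r"
  shows "finite (CP r)"
proof (rule finite_subset)
  show "CP r \<subseteq> (\<Union>es\<in>Cyc r. (\<lambda>k. rotate k (map fst es)) ` {..length es})"
  proof
    fix l assume l: "l \<in> CP r"
    then have ne: "l \<noteq> []" by (rule CP_nonempty)
    have "card {i. i < length l \<and> rep (eg l (int i))} \<noteq> 0"
      using l r by (simp add: CP_def loop_length_count)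
    then obtain k where k: "k < length l" "rep (eg l (int k))"
      by (metis (no_types, lifting) Collect_empty_eq card.empty)
    have l': "rotate k l \<in> CP r" "rep (eg (rotate k l) 0)"
      using rotate_CP[OF l] k ne by (simp_all add: eg_rotate)
    have "l = rotate (length l - k) (rotate k l)" using k by (simp add: rotate_rotate)
    then have "l = rotate (length l - k) (map fst (edges_of (rotate k l)))"
      using edges_of_Cyc(2)[OF l'] by simp
    moreover have "length (edges_of (rotate k l)) = length l" by (simp add: edges_of_def)
    ultimately show "l \<in> (\<Union>es\<in>Cyc r. (\<lambda>k. rotate k (map fst es)) ` {..length es})"
      using edges_of_Cyc(1)[OF l'] by (intro UN_I[of "edges_of (rotate k l)"]) auto
  qed
qed (use finite_Cyc[OF r] in auto)

text \<open>Counts closed paths with a marked step in two ways. Rotating the mark to the front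
  preserves the weight, and exactly \<open>r\<close> of the \<open>length l\<close> marks are
  representative.\<close>

lemma sum_rep_start:
  assumes r: "0 < r"
  shows "(\<Sum>l\<in>{l\<in>CP r. rep (eg l 0)}. cyc_weight x l) = (\<Sum>l\<in>CP r. of_nat r * cyc_weight x l / of_nat (length l))"
proof -
  let ?S = "SIGMA l:CP r. {..<length l}"
  note fin = finite_CP[OF r]
  have "(\<Sum>l\<in>CP r. of_nat r * cyc_weight x l / of_nat (length l)) =
      (\<Sum>l\<in>CP r. \<Sum>k<length l. if rep (eg l (int k)) then cyc_weight x l / of_nat (length l) else 0)"
  proof (rule sum.cong[OF refl])
    fix l assume "l \<in> CP r"
    then have "r = card {i. i < length l \<and> rep (eg l (int i))}" by (simp add: CP_def loop_length_count)
    then show "of_nat r * cyc_weight x l / of_nat (length l) = (\<Sum>k<length l. if rep (eg l (int k)) then cyc_weight x l / of_nat (length l) else 0)"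
      by (simp add: sum.If_cases Int_def)
  qed
  also have "\<dots> = (\<Sum>(l, k)\<in>?S. if rep (eg l (int k)) then cyc_weight x l / of_nat (length l) else 0)"
    by (rule sum.Sigma) (use fin in auto)
  also have "\<dots> = (\<Sum>(l, k)\<in>?S. if rep (eg l 0) then cyc_weight x l / of_nat (length l) else 0)"
  proof (rule sum.reindex_bij_witness[of _ "\<lambda>(l, k). (rotate (length l - k) l, k)" "\<lambda>(l, k). (rotate k l, k)"])
    fix p assume p: "p \<in> ?S"
    obtain l k where lk: "p = (l, k)" by fastforce
    have l: "l \<in> CP r" "k < length l" and ne: "l \<noteq> []" using p lk CP_nonempty by auto
    have "cyc_weight x (rotate k l) = cyc_weight x l"
      using closed_path_orb(2)[OF _ rotate_orb[OF ne]] l by (simp add: CP_def)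
    then show "(case case p of (l, k) \<Rightarrow> (rotate k l, k) of (l, k) \<Rightarrow> if rep (eg l 0) then cyc_weight x l / of_nat (length l) else 0) =
        (case p of (l, k) \<Rightarrow> if rep (eg l (int k)) then cyc_weight x l / of_nat (length l) else 0)"
      by (simp add: lk eg_rotate[OF ne])
  qed (auto simp: rotate_rotate intro!: rotate_CP)
  also have "\<dots> = (\<Sum>l\<in>CP r. \<Sum>k<length l. if rep (eg l 0) then cyc_weight x l / of_nat (length l) else 0)"
    by (rule sum.Sigma[symmetric]) (use fin in auto)
  also have "\<dots> = (\<Sum>l\<in>CP r. if rep (eg l 0) then cyc_weight x l else 0)"
    by (rule sum.cong[OF refl]) (use CP_nonempty in auto)
  also have "\<dots> = (\<Sum>l\<in>{l\<in>CP r. rep (eg l 0)}. cyc_weight x l)"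
    using fin by (simp add: sum.inter_filter)
  finally show ?thesis ..
qed

text \<open>Closed paths split into dihedral orbits, each with one lexicographically least member.
  An orbit has \<open>2 * p\<close> elements of length \<open>p * m\<close>, where \<open>m\<close>
  is the multiplicity, so dividing by the length leaves \<open>2 / m\<close>; the minus sign is that
  of \<open>loop_sign\<close>.\<close>

lemma f_r_eq:
  assumes r: "0 < r"
  shows "(\<Sum>l\<in>CP r. of_nat r * cyc_weight x l / of_nat (length l)) = - (2 * of_nat r) * f_r E EA x r"
proof -
  let ?Lp = "{l. is_loop E l \<and> loop_length E EA l = r}"
  note fin = finite_CP[OF r]
  have LpCP: "?Lp \<subseteq> CP r" by (auto simp: is_loop_def CP_def)
  have sub: "orb l \<subseteq> CP r" if "l \<in> CP r" for l
    using closed_path_orb that by (auto simp: CP_def)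
  have loop_orb: "is_loop E l \<longleftrightarrow> closed_path E l \<and> (\<forall>l'\<in>orb l. lexle l l')" for l
    by (cases "l = []") (simp_all add: is_loop_def closed_path_def dihedral_orbit_eq_orb)
  have U: "CP r = (\<Union>l\<in>?Lp. orb l)"
  proof (intro equalityI subsetI)
    fix l assume l: "l \<in> CP r"
    have "finite (orb l)" using sub[OF l] fin finite_subset by blast
    then obtain m where m: "m \<in> orb l" "\<forall>l'\<in>orb l. lexle m l'"
      using ex_lexle_min[of "orb l"] orb_refl by blast
    have "is_loop E m" using m orb_eq[OF m(1)] closed_path_orb(1)[OF _ m(1)] l by (simp add: loop_orb CP_def)
    moreover have "loop_length E EA m = r" using closed_path_orb(3)[OF _ m(1)] l by (simp add: CP_def)
    ultimately show "l \<in> (\<Union>l\<in>?Lp. orb l)" using orb_sym[OF m(1)] by auto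
  qed (use LpCP sub in blast)
  have disj: "orb l \<inter> orb l' = {}" if "l \<in> ?Lp" "l' \<in> ?Lp" "l \<noteq> l'" for l l'
  proof (rule ccontr)
    assume "orb l \<inter> orb l' \<noteq> {}"
    then have "orb l = orb l'" using orb_eq by blast
    then have "lexle l l'" "lexle l' l" using that(1,2) orb_refl[of l] orb_refl[of l'] by (auto simp: loop_orb)
    then show False using lexle_antisym that(3) by blast
  qed
  have "(\<Sum>l\<in>CP r. of_nat r * cyc_weight x l / of_nat (length l)) = (\<Sum>l\<in>?Lp. \<Sum>l'\<in>orb l. of_nat r * cyc_weight x l' / of_nat (length l'))"
    unfolding U
  proof (rule sum.UNION_disjoint)
    show "finite ?Lp" using LpCP fin finite_subset by blast
    show "\<forall>l\<in>?Lp. finite (orb l)" using LpCP sub fin finite_subset by blast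
    show "\<forall>l\<in>?Lp. \<forall>l'\<in>?Lp. l \<noteq> l' \<longrightarrow> orb l \<inter> orb l' = {}" using disj by blast
  qed
  also have "\<dots> = (\<Sum>l\<in>?Lp. - (2 * of_nat r) * loop_weight x l)"
  proof (rule sum.cong[OF refl])
    fix l assume "l \<in> ?Lp"
    then have cp: "closed_path E l" by (simp add: is_loop_def)
    then have ne: "l \<noteq> []" by (simp add: closed_path_iff)
    define p where "p = (LEAST p. 0 < p \<and> rotate p l = l)"
    have p: "card (orb l) = 2 * p" "0 < p" "p dvd length l" using card_orb[OF cp] by (simp_all add: p_def)
    then obtain m where m: "length l = p * m" by (elim dvdE)
    then have "multiplicity_loop l = m" using p(2) by (simp add: multiplicity_loop_def p_def[symmetric])
    have "(\<Sum>l'\<in>orb l. of_nat r * cyc_weight x l' / of_nat (length l')) = (\<Sum>l'\<in>orb l. of_nat r * cyc_weight x l / of_nat (length l))"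
      by (rule sum.cong[OF refl]) (use closed_path_orb(2)[OF cp] in \<open>auto simp: orb_def\<close>)
    also have "\<dots> = of_nat (2 * p) * (of_nat r * cyc_weight x l / of_nat (p * m))"
      by (simp add: p(1) m)
    also have "\<dots> = 2 * of_nat r * cyc_weight x l / of_nat m" using p(2) by simp
    also have "\<dots> = - (2 * of_nat r) * loop_weight x l"
      using loop_weight_eq[OF cp] \<open>multiplicity_loop l = m\<close> by simp
    finally show "(\<Sum>l'\<in>orb l. of_nat r * cyc_weight x l' / of_nat (length l')) = - (2 * of_nat r) * loop_weight x l" .
  qed
  also have "\<dots> = - (2 * of_nat r) * f_r E EA x r"
    by (simp add: f_r_def sum_distrib_left)
  finally show ?thesis .
qed

theorem trace_eq_f_r:
  assumes R: "distinct ds" "set ds = dirs (E - EA)" and r: "0 < r"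
  shows "(\<Sum>i = 0..<length ds. (gram (link_weight x) ds ^\<^sub>m r) $$ (i, i)) = - (2 * of_nat r) * f_r E EA x r"
  by (simp only: trace_pow_gram_G[OF R r] sum_Cyc sum_rep_start[OF r] f_r_eq[OF r])

end

section \<open>Spectral expansion\<close>

lemma sum_diag_mult_commute:
  fixes A B :: "complex mat"
  assumes "A \<in> carrier_mat n n" "B \<in> carrier_mat n n"
  shows "(\<Sum>i = 0..<n. (A * B) $$ (i, i)) = (\<Sum>i = 0..<n. (B * A) $$ (i, i))"
proof -
  have "(\<Sum>i = 0..<n. (A * B) $$ (i, i)) = (\<Sum>i = 0..<n. \<Sum>k = 0..<n. A $$ (i, k) * B $$ (k, i))"
    by (rule sum.cong[OF refl]) (use assms in \<open>auto simp: scalar_prod_def\<close>)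
  also have "\<dots> = (\<Sum>k = 0..<n. \<Sum>i = 0..<n. B $$ (k, i) * A $$ (i, k))"
    by (subst sum.swap) (simp add: mult.commute)
  also have "\<dots> = (\<Sum>i = 0..<n. (B * A) $$ (i, i))"
    by (rule sum.cong[OF refl]) (use assms in \<open>auto simp: scalar_prod_def\<close>)
  finally show ?thesis .
qed

lemma upper_triangular_mult_diag:
  fixes A B :: "complex mat"
  assumes "A \<in> carrier_mat n n" "B \<in> carrier_mat n n" "upper_triangular A" "upper_triangular B"
  shows "upper_triangular (A * B)" "i < n \<Longrightarrow> (A * B) $$ (i, i) = A $$ (i, i) * B $$ (i, i)"
proof -
  have e: "(A * B) $$ (i, j) = (\<Sum>k = 0..<n. A $$ (i, k) * B $$ (k, j))" if "i < n" "j < n" for i j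
    using that assms by (auto simp: scalar_prod_def)
  have z: "A $$ (i, k) * B $$ (k, j) = 0" if "i < n" "j < n" "k < n" "j < i \<or> (j = i \<and> k \<noteq> i)" for i j k
  proof (cases "k < i")
    case True
    then have "A $$ (i, k) = 0" using assms that unfolding upper_triangular_def by auto
    then show ?thesis by simp
  next
    case False
    then have "j < k" using that by auto
    then have "B $$ (k, j) = 0" using assms that unfolding upper_triangular_def by auto
    then show ?thesis by simp
  qed
  show "upper_triangular (A * B)"
    unfolding upper_triangular_def
  proof (intro allI impI)
    fix i j assume ij: "i < dim_row (A * B)" "j < i"
    then have "i < n" "j < n" using assms by auto
    then show "(A * B) $$ (i, j) = 0" unfolding e[OF \<open>i < n\<close> \<open>j < n\<close>]
      using z ij(2) by (intro sum.neutral) auto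
  qed
  assume i: "i < n"
  have "(\<Sum>k = 0..<n. A $$ (i, k) * B $$ (k, i)) = (\<Sum>k\<in>{i}. A $$ (i, k) * B $$ (k, i))"
    by (rule sum.mono_neutral_right) (use z i in auto)
  then show "(A * B) $$ (i, i) = A $$ (i, i) * B $$ (i, i)" using e[OF i i] by simp
qed

lemma upper_triangular_pow_diag:
  fixes A :: "complex mat"
  assumes A: "A \<in> carrier_mat n n" "upper_triangular A"
  shows "upper_triangular (A ^\<^sub>m r) \<and> (\<forall>i<n. (A ^\<^sub>m r) $$ (i, i) = (A $$ (i, i)) ^ r)"
proof (induction r)
  case 0
  then show ?case using A by (auto simp: upper_triangular_def)
next
  case (Suc r)
  have c: "A ^\<^sub>m r \<in> carrier_mat n n" using A by simp
  show ?case using upper_triangular_mult_diag[OF c A(1) _ A(2)] Suc by (simp add: mult.commute)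
qed

text \<open>One list of eigenvalues serves both the characteristic polynomial and all traces of
  powers: it is the diagonal of a Schur triangular form.\<close>

lemma spectral_data:
  fixes A :: "complex mat"
  assumes A: "A \<in> carrier_mat n n"
  shows "\<exists>es. length es = n \<and> char_poly A = (\<Prod>a\<leftarrow>es. [:- a, 1:]) \<and>
    (\<forall>r. (\<Sum>i = 0..<n. (A ^\<^sub>m r) $$ (i, i)) = (\<Sum>a\<leftarrow>es. a ^ r))"
proof -
  obtain es where es: "char_poly A = (\<Prod>a\<leftarrow>es. [:- a, 1:])" "length es = n"
    using char_poly_factorized[OF A] by blast
  obtain B where B: "B \<in> carrier_mat n n" "upper_triangular B" "similar_mat A B"
    using schur_decomposition_exists[OF A es(1)] by blast
  have cpB: "char_poly A = (\<Prod>a\<leftarrow>diag_mat B. [:- a, 1:])"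
    using char_poly_similar[OF B(3)] char_poly_upper_triangular[OF B(1,2)] by simp
  obtain P Q where PQ: "similar_mat_wit A B P Q" using B(3) by (auto simp: similar_mat_def)
  have w: "P \<in> carrier_mat n n" "Q \<in> carrier_mat n n" "Q * P = 1\<^sub>m n"
    using similar_mat_witD2[OF A PQ] by auto
  have "(\<Sum>i = 0..<n. (A ^\<^sub>m r) $$ (i, i)) = (\<Sum>a\<leftarrow>diag_mat B. a ^ r)" for r
  proof -
    have Br: "B ^\<^sub>m r \<in> carrier_mat n n" using B(1) by simp
    have "(\<Sum>i = 0..<n. (A ^\<^sub>m r) $$ (i, i)) = (\<Sum>i = 0..<n. ((P * B ^\<^sub>m r) * Q) $$ (i, i))"
      by (simp only: similar_mat_wit_pow_id[OF PQ])
    also have "\<dots> = (\<Sum>i = 0..<n. (Q * (P * B ^\<^sub>m r)) $$ (i, i))"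
      by (rule sum_diag_mult_commute) (use w Br in auto)
    also have "Q * (P * B ^\<^sub>m r) = (Q * P) * B ^\<^sub>m r"
      by (rule assoc_mult_mat[symmetric]) (use w Br in auto)
    also have "\<dots> = B ^\<^sub>m r" unfolding w(3) by (rule left_mult_one_mat[OF Br])
    also have "(\<Sum>i = 0..<n. (B ^\<^sub>m r) $$ (i, i)) = (\<Sum>i = 0..<n. (B $$ (i, i)) ^ r)"
      using upper_triangular_pow_diag[OF B(1,2), of r] by simp
    also have "\<dots> = (\<Sum>a\<leftarrow>diag_mat B. a ^ r)"
      using B(1) by (simp add: diag_mat_def comp_def interv_sum_list_conv_sum_set_nat)
    finally show ?thesis .
  qed
  then show ?thesis using cpB B(1) by (intro exI[of _ "diag_mat B"]) (simp add: diag_mat_def)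
qed

lemma proots_linear_prod:
  fixes es :: "complex list"
  shows "proots (\<Prod>a\<leftarrow>es. [:- a, 1:]) = mset es"
proof (induction es)
  case (Cons a es)
  have "(\<Prod>a\<leftarrow>es. [:- a, 1:]) \<noteq> (0 :: complex poly)"
    by (auto simp: prod_list_zero_iff)
  then show ?case using Cons by (simp add: proots_mult del: mult_pCons_left)
qed simp

lemma det_one_minus_char_poly:
  fixes A :: "complex mat"
  assumes A: "A \<in> carrier_mat n n" and cp: "char_poly A = (\<Prod>a\<leftarrow>es. [:- a, 1:])" and len: "length es = n"
  shows "det (1\<^sub>m n - t \<cdot>\<^sub>m A) = (\<Prod>a\<leftarrow>es. 1 - t * a)"
proof (cases "t = 0")
  case True
  have "1\<^sub>m n - t \<cdot>\<^sub>m A = 1\<^sub>m n" by (rule eq_matI) (use A True in auto)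
  then show ?thesis using True by (simp add: map_replicate_const)
next
  case False
  have "poly (char_poly A) (1 / t) = det ((1 / t) \<cdot>\<^sub>m 1\<^sub>m n - A)"
    unfolding char_poly_def
    by (rule poly_det_cong[of _ n]) (use A in \<open>auto simp: char_poly_matrix_def\<close>)
  moreover have "1\<^sub>m n - t \<cdot>\<^sub>m A = t \<cdot>\<^sub>m ((1 / t) \<cdot>\<^sub>m 1\<^sub>m n - A)"
    by (rule eq_matI) (use A False in \<open>auto simp: algebra_simps\<close>)
  ultimately have "det (1\<^sub>m n - t \<cdot>\<^sub>m A) = t ^ n * poly (char_poly A) (1 / t)"
    using A by simp
  also have "\<dots> = (\<Prod>a\<leftarrow>es. 1 - t * a)"
    unfolding cp len[symmetric] using False by (induction es) (auto simp: algebra_simps)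
  finally show ?thesis .
qed

section \<open>Fixing the sign of the square root\<close>

lemma continuous_square_eq:
  fixes f g :: "real \<Rightarrow> complex"
  assumes "continuous_on {0..1} f" "continuous_on {0..1} g"
    and "\<And>t. t \<in> {0..1} \<Longrightarrow> (f t)\<^sup>2 = (g t)\<^sup>2" "\<And>t. t \<in> {0..1} \<Longrightarrow> g t \<noteq> 0" "f 0 = g 0"
  shows "f 1 = g 1"
proof -
  \<comment> \<open>The quotient is continuous on an interval with values 1 and -1, hence
    constant.\<close>
  let ?h = "\<lambda>t. f t / g t"
  have c: "continuous_on {0..1} ?h" using assms by (intro continuous_intros) auto
  have h: "?h t \<in> {1, -1}" if "t \<in> {0..1}" for t
  proof -
    have "f t = g t \<or> f t = - g t" using assms(3)[OF that] by (simp add: power2_eq_iff)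
    then show ?thesis using assms(4)[OF that] by auto
  qed
  have "connected (?h ` {0..1})" by (rule connected_continuous_image[OF c]) simp
  moreover have "finite (?h ` {0..1})" by (rule finite_subset[OF image_subsetI[OF h]]) simp_all
  ultimately have "?h ` {0..1} = {} \<or> (\<exists>a. ?h ` {0..1} = {a})"
    by (metis connected_finite_iff_sing)
  moreover have "?h 0 \<in> ?h ` {0..1}" "?h 1 \<in> ?h ` {0..1}" by (rule imageI, simp)+
  ultimately have "?h 1 = ?h 0" by (elim disjE exE) simp_all
  then show ?thesis using assms(4)[of 0] assms(4)[of 1] assms(5) by (simp add: field_simps)
qed

context plane_graph
begin

lemma continuous_Zfun:
  assumes "\<And>e. continuous_on S (\<lambda>t. x t e)"
  shows "continuous_on S (\<lambda>t. Zfun V E (x t))"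
  unfolding Zfun_def by (intro continuous_intros assms)

end

context forest_graph
begin

text \<open>Each nonzero entry carries exactly one representative weight, that of its row; all its
  other weights are additional. Scaling the representative weights by \<open>t\<close> therefore
  scales the whole matrix.\<close>

lemma Lam_entry_scale:
  assumes a: "a \<in> dirs (E - EA)"
    and x': "\<And>e. e \<in> EA \<Longrightarrow> x' e = x e" "\<And>e. e \<in> E - EA \<Longrightarrow> x' e = t * x e"
  shows "Lam_entry EA x' a b = t * Lam_entry EA x a b"
proof -
  obtain u v w z where ab: "a = (u, v)" "b = (w, z)" by (cases a; cases b)
  have uv: "x' {u, v} = t * x {u, v}" using a ab x'(2) by (simp add: dirs_def)
  show ?thesis
  proof (cases "v \<noteq> w \<and> (\<exists>p. linkpath EA v w p)")
    case True
    define p where "p = (SOME p. linkpath EA v w p)"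
    have "linkpath EA v w p" unfolding p_def using True by (simp add: someI_ex)
    then have "(\<Prod>i < length p - 1. x' {p ! i, p ! (i+1)}) = (\<Prod>i < length p - 1. x {p ! i, p ! (i+1)})"
      by (intro prod.cong refl x'(1)) (auto simp: linkpath_def)
    then show ?thesis using True uv unfolding ab Lam_entry_def by (simp add: Let_def p_def[symmetric])
  next
    case False
    then show ?thesis using uv by (auto simp: ab Lam_entry_def)
  qed
qed

text \<open>Separate factors for additional and representative edges: the sign argument first
  contracts the forest and then the representative edges.\<close>

definition scaled :: "complex \<Rightarrow> complex \<Rightarrow> (complex set \<Rightarrow> complex) \<Rightarrow> complex set \<Rightarrow> complex" where
  "scaled s t x e = (if e \<in> EA then s * x e else t * x e)"

lemma dir_rep_eq: "dir_rep E EA = dirs (E - EA)"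
  by (auto simp: dir_rep_def dirs_def)

lemma dir_list: "distinct (dir_list E EA)" "set (dir_list E EA) = dirs (E - EA)"
proof -
  have "\<exists>l. distinct l \<and> set l = dir_rep E EA"
    using finite_distinct_list[of "dirs (E - EA)"] finite_dirs_subset[of "E - EA"] dir_rep_eq by auto
  then have "distinct (dir_list E EA) \<and> set (dir_list E EA) = dir_rep E EA"
    unfolding dir_list_def by (rule someI_ex)
  then show "distinct (dir_list E EA)" "set (dir_list E EA) = dirs (E - EA)" by (auto simp: dir_rep_eq)
qed

lemma Lambda_mat_eq: "Lambda_mat E EA x = gram (link_weight x) (dir_list E EA)"
proof -
  have "Lam_entry EA x (dir_list E EA ! i) (dir_list E EA ! j) = link_weight x (dir_list E EA ! i) (dir_list E EA ! j)"
    if "i < length (dir_list E EA)" "j < length (dir_list E EA)" for i j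
    by (rule Lam_entry_eq_G) (use that dir_list(2) nth_mem in blast)+
  then show ?thesis by (auto simp: Lambda_mat_def Let_def gram_def intro!: eq_matI)
qed

lemma Lambda_mat_carrier: "Lambda_mat E EA x \<in> carrier_mat (length (dir_list E EA)) (length (dir_list E EA))"
  by (simp add: Lambda_mat_def Let_def)

lemma Zfun_square: "(Zfun V E x)\<^sup>2 = det (1\<^sub>m (length (dir_list E EA)) - Lambda_mat E EA x)"
proof -
  have "gram (one_minus (link_weight x)) (dir_list E EA) = 1\<^sub>m (length (dir_list E EA)) - Lambda_mat E EA x"
    unfolding Lambda_mat_eq
    by (rule eq_matI) (auto simp: gram_def one_minus_def nth_eq_iff_index_eq[OF dir_list(1)])
  then show ?thesis using det_one_minus_G[OF dir_list, of x] by simp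
qed

lemma Zfun_scaled_square:
  "(Zfun V E (scaled s t x))\<^sup>2 = det (1\<^sub>m (length (dir_list E EA)) - t \<cdot>\<^sub>m Lambda_mat E EA (scaled s 1 x))"
proof -
  have "Lam_entry EA (scaled s t x) (dir_list E EA ! i) (dir_list E EA ! j) = t * Lam_entry EA (scaled s 1 x) (dir_list E EA ! i) (dir_list E EA ! j)"
    if "i < length (dir_list E EA)" for i j
    by (rule Lam_entry_scale) (use that dir_list(2) nth_mem in \<open>auto simp: scaled_def\<close>)
  then have "Lambda_mat E EA (scaled s t x) = t \<cdot>\<^sub>m Lambda_mat E EA (scaled s 1 x)"
    by (intro eq_matI) (simp_all add: Lambda_mat_def Let_def)
  then show ?thesis by (simp add: Zfun_square)
qed

lemma scaled_1 [simp]: "scaled 1 1 x = x"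
  by (auto simp: scaled_def)

lemma continuous_Zfun_scaled:
  assumes "continuous_on S s" "continuous_on S t"
  shows "continuous_on S (\<lambda>\<tau>. Zfun V E (scaled (s \<tau>) (t \<tau>) x))"
proof (rule continuous_Zfun)
  show "continuous_on S (\<lambda>\<tau>. scaled (s \<tau>) (t \<tau>) x e)" for e
    using assms by (cases "e \<in> EA") (auto simp: scaled_def intro!: continuous_intros)
qed

text \<open>The square is constantly $1$ when the additional edges are scaled down to zero, so the sign is
  fixed by continuity.\<close>

lemma Zfun_forest: "Zfun V E (scaled 1 0 x) = 1"
proof -
  have "Zfun V E (scaled (of_real 1) 0 x) = 1"
  proof (rule continuous_square_eq[where f = "\<lambda>s. Zfun V E (scaled (of_real s) 0 x)" and g = "\<lambda>_. 1"])
    show "continuous_on {0..1} (\<lambda>s. Zfun V E (scaled (of_real s) 0 x))"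
      by (intro continuous_Zfun_scaled continuous_intros)
    fix s :: real
    have "1\<^sub>m (length (dir_list E EA)) - 0 \<cdot>\<^sub>m Lambda_mat E EA (scaled (of_real s) 1 x) = 1\<^sub>m (length (dir_list E EA))"
      by (rule eq_matI) (use Lambda_mat_carrier[of "scaled (of_real s) 1 x"] in auto)
    then show "(Zfun V E (scaled (of_real s) 0 x))\<^sup>2 = 1\<^sup>2" by (simp add: Zfun_scaled_square)
  next
    obtain L where L: "distinct L" "set L = dirs E" "sorted_wrt dirless L"
      using ex_sorted_dirs by blast
    interpret sorted_plane_graph V E L by unfold_locales (use L in auto)
    have "scaled (of_real 0) 0 x = (\<lambda>_. 0)" by (auto simp: scaled_def)
    then show "Zfun V E (scaled (of_real 0) 0 x) = 1" using Zfun_zero by simp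
  qed auto
  then show ?thesis by simp
qed

theorem Zfun_eq_loop_expansion:
  assumes rho: "spectral_radius (Lambda_mat E EA x) < 1"
  shows "summable (\<lambda>r. norm (f_r E EA x (Suc r)))"
    and "Zfun V E x = exp (\<Sum>r. f_r E EA x (Suc r))"
    and "Zfun V E x = (\<Prod>lam\<in>#proots (char_poly (Lambda_mat E EA x)). exp (Ln (1 - lam) / 2))"
proof -
  let ?A = "Lambda_mat E EA x" and ?m = "length (dir_list E EA)"
  note A = Lambda_mat_carrier[of x]
  obtain es where es: "length es = ?m" "char_poly ?A = (\<Prod>a\<leftarrow>es. [:- a, 1:])"
    and tr: "\<And>r. (\<Sum>i = 0..<?m. (?A ^\<^sub>m r) $$ (i, i)) = (\<Sum>a\<leftarrow>es. a ^ r)"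
    using spectral_data[OF A] by blast
  have small: "norm a < 1" if a: "a \<in> set es" for a
  proof -
    have m: "0 < ?m" using es(1) a by (auto simp: length_pos_if_in_set)
    have "poly (char_poly ?A) a = 0"
      unfolding es(2) using a by (induction es) auto
    then have "a \<in> spectrum ?A" using spectrum_root_char_poly[OF A] by blast
    then have "norm a \<le> spectral_radius ?A" using spectral_radius_mem_max(2)[OF A m] by blast
    then show ?thesis using rho by simp
  qed
  \<comment> \<open>Up to the factor one half, each eigenvalue contributes the coefficient of the
    logarithm series.\<close>
  have f: "f_r E EA x (Suc r) = (\<Sum>a\<leftarrow>es. - (a ^ Suc r / of_nat (Suc r)) / 2)" for r
  proof -
    have "(\<Sum>a\<leftarrow>es. a ^ Suc r) = - (2 * of_nat (Suc r)) * f_r E EA x (Suc r)"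
      using trace_eq_f_r[OF dir_list, of "Suc r" x] tr[of "Suc r"] by (simp add: Lambda_mat_eq del: pow_mat.simps of_nat_Suc)
    then have "f_r E EA x (Suc r) = (\<Sum>a\<leftarrow>es. a ^ Suc r) * (- 1 / (2 * of_nat (Suc r)))"
      by (simp add: field_simps del: of_nat_Suc power_Suc)
    also have "\<dots> = (\<Sum>a\<leftarrow>es. a ^ Suc r * (- 1 / (2 * of_nat (Suc r))))"
      by (rule sum_list_mult_const[symmetric])
    also have "\<dots> = (\<Sum>a\<leftarrow>es. - (a ^ Suc r / of_nat (Suc r)) / 2)"
      by (rule arg_cong[where f = sum_list], rule map_cong[OF refl]) (simp add: field_simps del: of_nat_Suc power_Suc)
    finally show ?thesis .
  qed
  have s1: "(\<lambda>r. - (a ^ Suc r / of_nat (Suc r)) / 2) sums (Ln (1 - a) / 2)" 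
    and s2: "summable (\<lambda>r. norm (- (a ^ Suc r / of_nat (Suc r)) / 2))" if "norm a < 1" for a :: complex
  proof -
    have "(\<lambda>n. (-1) ^ Suc n / of_nat n * (- a) ^ n) sums ln (1 + - a)"
      by (rule Ln_series) (use that in simp)
    then have "(\<lambda>n. - (a ^ n / of_nat n)) sums Ln (1 - a)"
      by (simp add: power_minus[of a] mult_ac)
    then have "(\<lambda>n. - (a ^ Suc n / of_nat (Suc n))) sums Ln (1 - a)"
      by (subst sums_Suc_iff) simp
    then show "(\<lambda>r. - (a ^ Suc r / of_nat (Suc r)) / 2) sums (Ln (1 - a) / 2)" by (rule sums_divide)
    show "summable (\<lambda>r. norm (- (a ^ Suc r / of_nat (Suc r)) / 2))"
    proof (rule summable_comparison_test)
      show "summable (\<lambda>r. norm a ^ Suc r)" using that by (simp add: summable_geometric summable_Suc_iff)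
      have "norm (- (a ^ Suc r / of_nat (Suc r)) / 2) \<le> norm a ^ Suc r" for r
      proof -
        have "norm (- (a ^ Suc r / of_nat (Suc r)) / 2) = norm a ^ Suc r / (real (Suc r) * 2)"
          by (simp add: norm_divide norm_power norm_mult del: of_nat_Suc)
        also have "\<dots> \<le> norm a ^ Suc r / 1"
          by (rule divide_left_mono) simp_all
        finally show ?thesis by simp
      qed
      then show "\<exists>N. \<forall>r\<ge>N. norm (norm (- (a ^ Suc r / of_nat (Suc r)) / 2)) \<le> norm a ^ Suc r" by simp
    qed
  qed
  have sums: "(\<lambda>r. f_r E EA x (Suc r)) sums (\<Sum>a\<leftarrow>es. Ln (1 - a) / 2) \<and> summable (\<lambda>r. norm (f_r E EA x (Suc r)))"
  proof -
    have "(\<lambda>r. \<Sum>a\<leftarrow>es'. - (a ^ Suc r / of_nat (Suc r)) / 2) sums (\<Sum>a\<leftarrow>es'. Ln (1 - a) / 2) \<and>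
      summable (\<lambda>r. norm (\<Sum>a\<leftarrow>es'. - (a ^ Suc r / of_nat (Suc r)) / 2))" if "set es' \<subseteq> set es" for es'
      using that
    proof (induction es')
      case (Cons b bs)
      have b: "norm b < 1" using Cons.prems small by simp
      let ?g = "\<lambda>r. \<Sum>a\<leftarrow>bs. - (a ^ Suc r / of_nat (Suc r)) / 2"
      let ?f = "\<lambda>r. - (b ^ Suc r / of_nat (Suc r)) / 2"
      have IH: "?g sums (\<Sum>a\<leftarrow>bs. Ln (1 - a) / 2)" "summable (\<lambda>r. norm (?g r))" using Cons by auto
      have "(\<lambda>r. ?f r + ?g r) sums (Ln (1 - b) / 2 + (\<Sum>a\<leftarrow>bs. Ln (1 - a) / 2))"
        by (rule sums_add[OF s1[OF b] IH(1)])
      moreover have "summable (\<lambda>r. norm (?f r + ?g r))"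
      proof (rule summable_comparison_test[OF _ summable_add[OF s2[OF b] IH(2)]])
        have "norm (norm (?f r + ?g r)) \<le> norm (?f r) + norm (?g r)" for r
          using norm_triangle_ineq[of "?f r" "?g r"] by (simp only: real_norm_def abs_norm_cancel)
        then show "\<exists>N. \<forall>r\<ge>N. norm (norm (?f r + ?g r)) \<le> norm (?f r) + norm (?g r)" by blast
      qed
      ultimately show ?case by (simp only: list.map sum_list.Cons)
    qed simp
    then show ?thesis unfolding f by blast
  qed
  then show "summable (\<lambda>r. norm (f_r E EA x (Suc r)))" by blast
  let ?g = "\<lambda>\<tau>. \<Prod>a\<leftarrow>es. exp (Ln (1 - of_real \<tau> * a) / 2)"
  \<comment> \<open>Keeps the whole scaling path away from the branch cut of
    \<open>Ln\<close>.\<close>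
  have re: "0 < Re (1 - of_real \<tau> * a)" if "\<tau> \<in> {0..1}" "a \<in> set es" for \<tau> :: real and a
  proof -
    have "norm (of_real \<tau> * a) < 1"
      using that small[OF that(2)] mult_left_le_one_le[of "norm a" \<tau>] by (simp add: norm_mult)
    then have "Re (of_real \<tau> * a) < 1" using complex_Re_le_cmod[of "of_real \<tau> * a"] by linarith
    then show ?thesis by simp
  qed
  have "Zfun V E (scaled 1 (of_real 1) x) = ?g 1"
  proof (rule continuous_square_eq[where f = "\<lambda>\<tau>. Zfun V E (scaled 1 (of_real \<tau>) x)" and g = ?g])
    show "continuous_on {0..1} (\<lambda>\<tau>. Zfun V E (scaled 1 (of_real \<tau>) x))"
      by (intro continuous_Zfun_scaled continuous_intros)
    have "continuous_on {0..1} (\<lambda>\<tau>. \<Prod>a\<leftarrow>es'. exp (Ln (1 - of_real \<tau> * a) / 2))" if "set es' \<subseteq> set es" for es'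
      using that
    proof (induction es')
      case (Cons b bs)
      have "1 - of_real \<tau> * b \<notin> \<real>\<^sub>\<le>\<^sub>0" if "\<tau> \<in> {0..1}" for \<tau> :: real
        using re[OF that, of b] Cons.prems by (auto simp: complex_nonpos_Reals_iff)
      then have "continuous_on {0..1} (\<lambda>\<tau>. exp (Ln (1 - of_real \<tau> * b) / 2))"
        by (intro continuous_intros continuous_on_Ln) simp_all
      then show ?case using Cons by (simp add: continuous_on_mult)
    qed simp
    then show "continuous_on {0..1} ?g" by blast
    show "?g \<tau> \<noteq> 0" for \<tau> by (auto simp: prod_list_zero_iff)
    \<comment> \<open>Only additional edges keep their weight at the start of the path;
      \<open>Zfun_forest\<close> gives 1 there.\<close>
    show "Zfun V E (scaled 1 (of_real 0) x) = ?g 0"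
      using Zfun_forest by (simp add: map_replicate_const)
    fix \<tau> :: real assume \<tau>: "\<tau> \<in> {0..1}"
    have "(\<Prod>a\<leftarrow>es'. exp (Ln (1 - of_real \<tau> * a) / 2))\<^sup>2 = (\<Prod>a\<leftarrow>es'. 1 - of_real \<tau> * a)" if "set es' \<subseteq> set es" for es'
      using that
    proof (induction es')
      case (Cons b bs)
      have "0 < Re (1 - of_real \<tau> * b)" using re[OF \<tau>, of b] Cons.prems by simp
      then have "1 - of_real \<tau> * b \<noteq> 0" by (metis less_irrefl zero_complex.sel(1))
      then have "(exp (Ln (1 - of_real \<tau> * b) / 2))\<^sup>2 = 1 - of_real \<tau> * b"
        by (simp add: exp_double[symmetric])
      then show ?case using Cons by (simp add: power_mult_distrib)
    qed simp
    then show "(Zfun V E (scaled 1 (of_real \<tau>) x))\<^sup>2 = (?g \<tau>)\<^sup>2"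
      by (simp add: Zfun_scaled_square det_one_minus_char_poly[OF A es(2,1)])
  qed
  then have Z: "Zfun V E x = (\<Prod>a\<leftarrow>es. exp (Ln (1 - a) / 2))" by simp
  have "exp (\<Sum>a\<leftarrow>es. Ln (1 - a) / 2) = (\<Prod>a\<leftarrow>es. exp (Ln (1 - a) / 2))"
    by (induction es) (auto simp: exp_add)
  then show "Zfun V E x = exp (\<Sum>r. f_r E EA x (Suc r))"
    using Z sums sums_unique by metis
  show "Zfun V E x = (\<Prod>lam\<in>#proots (char_poly ?A). exp (Ln (1 - lam) / 2))"
    unfolding es(2) proots_linear_prod Z by (simp flip: prod_mset_prod_list)
qed

end

theorem mainTheorem2:
  fixes V :: "complex set" and E EA :: "complex set set" and x :: "complex set \<Rightarrow> complex"
  assumes "finite V"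
    and "simple_edges V E"
    and "no_vertex_on_edge V E"
    and "EA \<subseteq> E"
    and "acyclic_edges EA"
    and "spectral_radius (Lambda_mat E EA x) < 1"
  shows "summable (\<lambda>r. norm (f_r E EA x (Suc r)))
    \<and> Zfun V E x = exp (\<Sum>r. f_r E EA x (Suc r))
    \<and> Zfun V E x = (\<Prod>lam\<in>#proots (char_poly (Lambda_mat E EA x)). exp (Ln (1 - lam) / 2))
    \<and> (Zfun V E x)\<^sup>2 = det (1\<^sub>m (dim_row (Lambda_mat E EA x)) - Lambda_mat E EA x)"
proof -
  interpret forest_graph V E EA
    by unfold_locales (use assms in auto)
  show ?thesis
    using Zfun_eq_loop_expansion[OF assms(6)] Zfun_square[of x] Lambda_mat_carrier[of x] by auto
qed

end
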